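(* Consider the weighted recursive tree with i.i.d. vertex-weights $(W_i)_{i\in\mathbb N}$ distributed as $W$, where $W$ satisfies: (1) $W$ takes values in $(0,1]$ and $\sup\{x\in\mathbb R:\mathbb P(W\le x)<1\}=1$; (2) there exist $C,\rho>0$ and $x_1\in(0,1)$ such that $\mathbb P(W\le x)\le Cx^\rho$ for all $x\in[0,x_1]$; (3) $\mathbb P(W=1)=q_0$ for some $q_0\in(0,1]$. Then, for any integer-valued $i_n=i(n)\to-\infty$ such that $i_n=o(\log n\wedge|\log r_{\log_\theta n}|)$, as $n\to\infty$, $$\frac{X^{(n)}_{i_n}-q_0(1-\theta^{-1})\theta^{-i_n+\varepsilon_n}}{\sqrt{q_0(1-\theta^{-1})\theta^{-i_n+\varepsilon_n}}}\xrightarrow{d}N(0,1).$$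
   Context: Weighted recursive tree (WRT): let $(W_i)_{i\ge1}$ be i.i.d. copies of a random variable $W$ with $\mathbb P(W>0)=1$ and $S_n:=\sum_{i=1}^nW_i$. $T_1$ consists of the single vertex $1$ (the root) with vertex-weight $W_1$. For $n\ge1$, $T_{n+1}$ is obtained from $T_n$ by adding vertex $n+1$ with vertex-weight $W_{n+1}$ and, conditionally on $T_n$ (including its vertex-weights), connecting it to one vertex $i\in[n]:=\{1,\ldots,n\}$ chosen with probability $W_i/S_n$, by an edge directed from $n+1$ to $i$. $\mathcal Z_n(i)$ denotes the in-degree of vertex $i$ in $T_n$. Set $\theta:=1+\mathbb E[W]$; $\log_\theta$ is the logarithm to base $\theta$ and $\log$ the natural logarithm. $x\wedge y=\min\{x,y\}$. Define $\varepsilon_n:=\log_\theta n-\lfloor\log_\theta n\rfloor$ and $X^{(n)}_i:=|\{j\in[n]:\mathcal Z_n(j)=\lfloor\log_\theta n\rfloor+i\}|$ for $i\in\mathbb Z$. For an index $k$ (integer or, more generally, real and positive) define $$s_k:=\inf\big\{x\in(0,1):\mathbb P(W\in(x,1))\le\exp(-(1-\theta^{-1})(1-x)k)\big\},\qquad r_k:=\exp(-(1-\theta^{-1})(1-s_k)k).$$ *)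

theory Defs
  imports
    "HOL-Probability.Probability"
    "HOL-Library.Landau_Symbols"
    "Graph_Theory.Digraph"
begin

definition total_weight :: "(nat \<Rightarrow> 'a \<Rightarrow> real) \<Rightarrow> nat \<Rightarrow> 'a \<Rightarrow> real" where
  "total_weight W n \<omega> = (\<Sum>i=1..n. W i \<omega>)"

definition wrt_algebra ::
  "'a measure \<Rightarrow> (nat \<Rightarrow> 'a \<Rightarrow> real) \<Rightarrow> (nat \<Rightarrow> 'a \<Rightarrow> nat) \<Rightarrow> nat \<Rightarrow> 'a measure" where
  "wrt_algebra M W parent n =
    sigma (space M)
      ({W i -` B \<inter> space M | i B. i \<ge> 1 \<and> B \<in> sets borel} \<union>
       {parent k -` A \<inter> space M | k A. k \<in> {2..n}})"

text \<open>
  The tree process consists of the weight \<open>W i\<close> of each vertex \<open>i \<ge> 1\<close> and the vertex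
  \<open>parent k < k\<close> to which each vertex \<open>k \<ge> 2\<close> is connected on arrival; \<open>W 0\<close>, \<open>parent 0\<close>
  and \<open>parent 1\<close> are not used.  The weights are drawn in advance, and the choice made by vertex
  \<open>n + 1\<close> is conditioned on the tree \<open>T_n\<close> together with the whole weight sequence.  This makes
  explicit that the choice depends on the weights through \<open>W 1, \<dots>, W n\<close> only:
  conditioning on the weighted tree \<open>T_n\<close> alone would leave open how the choice is coupled with
  \<open>W (n + 1)\<close> and later weights.
\<close>

locale weighted_recursive_tree = prob_space M + weight: real_distribution \<mu>
  for M :: "'a measure" and \<mu> :: "real measure"
    and W :: "nat \<Rightarrow> 'a \<Rightarrow> real" and parent :: "nat \<Rightarrow> 'a \<Rightarrow> nat" +
  assumes weight_pos: "measure \<mu> {0<..} = 1"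
    and weights_indep: "indep_vars (\<lambda>_. borel) W {1..}"
    and weights_distr: "\<And>i. i \<ge> 1 \<Longrightarrow> distr M borel (W i) = \<mu>"
    and parent_measurable:
      "\<And>n. n \<ge> 1 \<Longrightarrow> parent (Suc n) \<in> measurable M (count_space {1..n})"
    and parent_cond_prob:
      "\<And>n i. n \<ge> 1 \<Longrightarrow> i \<in> {1..n} \<Longrightarrow>
        AE \<omega> in M.
          real_cond_exp M (wrt_algebra M W parent n)
            (indicator {\<omega> \<in> space M. parent (Suc n) \<omega> = i}) \<omega>
          = W i \<omega> / total_weight W n \<omega>"

lemma (in weighted_recursive_tree) wrt_algebra_subalgebra:
  "subalgebra M (wrt_algebra M W parent n)"
proof -
  let ?G = "{W i -` B \<inter> space M | i B. i \<ge> 1 \<and> B \<in> sets borel} \<union>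
    {parent k -` A \<inter> space M | k A. k \<in> {2..n}}"
  have W: "W i \<in> borel_measurable M" if "i \<ge> 1" for i
    using weights_indep that unfolding indep_vars_def2 by auto
  have parent: "parent k -` A \<inter> space M \<in> sets M" if k: "2 \<le> k" for k A
  proof -
    obtain m where m: "k = Suc m" "m \<ge> 1"
      using k by (cases k) auto
    have par: "parent k \<in> measurable M (count_space {1..m})"
      using parent_measurable[of m] m by simp
    have "parent k -` A \<inter> space M = parent k -` (A \<inter> {1..m}) \<inter> space M"
      using measurable_space[OF par] by auto
    also have "\<dots> \<in> sets M"
      by (rule measurable_sets[OF par]) auto
    finally show ?thesis .
  qed
  have sub: "?G \<subseteq> sets M"
    using W parent by (auto intro: measurable_sets)
  have "sigma_sets (space M) ?G \<subseteq> sets M"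
    by (rule sets.sigma_sets_subset[OF sub])
  moreover have "?G \<subseteq> Pow (space M)" by auto
  ultimately show ?thesis
    unfolding subalgebra_def wrt_algebra_def by (simp add: sets_measure_of space_measure_of)
qed

definition wrt_tree ::
  "(nat \<Rightarrow> 'a \<Rightarrow> nat) \<Rightarrow> nat \<Rightarrow> 'a \<Rightarrow> (nat, nat \<times> nat) pre_digraph" where
  "wrt_tree parent n \<omega> =
    \<lparr>verts = {1..n}, arcs = (\<lambda>k. (k, parent k \<omega>)) ` {2..n}, tail = fst, head = snd\<rparr>"

definition wrt_in_degree :: "(nat \<Rightarrow> 'a \<Rightarrow> nat) \<Rightarrow> nat \<Rightarrow> nat \<Rightarrow> 'a \<Rightarrow> nat" where
  "wrt_in_degree parent n i \<omega> = in_degree (wrt_tree parent n \<omega>) i"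

definition theta :: "real measure \<Rightarrow> real" where
  "theta \<mu> = 1 + (\<integral>x. x \<partial>\<mu>)"

definition eps :: "real measure \<Rightarrow> nat \<Rightarrow> real" where
  "eps \<mu> n = log (theta \<mu>) (real n) - of_int \<lfloor>log (theta \<mu>) (real n)\<rfloor>"

definition degree_count :: "real measure \<Rightarrow> (nat \<Rightarrow> 'a \<Rightarrow> nat) \<Rightarrow> nat \<Rightarrow> int \<Rightarrow> 'a \<Rightarrow> nat" where
  "degree_count \<mu> parent n i \<omega> =
    card {j \<in> {1..n}. int (wrt_in_degree parent n j \<omega>) = \<lfloor>log (theta \<mu>) (real n)\<rfloor> + i}"

definition s_index :: "real measure \<Rightarrow> real \<Rightarrow> real" where
  "s_index \<mu> k =
    Inf {x \<in> {0<..<1}. measure \<mu> {x<..<1} \<le> exp (- (1 - 1 / theta \<mu>) * (1 - x) * k)}"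

definition r_index :: "real measure \<Rightarrow> real \<Rightarrow> real" where
  "r_index \<mu> k = exp (- (1 - 1 / theta \<mu>) * (1 - s_index \<mu> k) * k)"

end

theory Submission
  imports Defs "HOL-Real_Asymp.Real_Asymp"
begin

text \<open>
  Write \<open>\<theta> = 1 + E W\<close>, \<open>m = \<lfloor>log_\<theta> n\<rfloor> + i_n\<close> and
  \<open>l_n = q\<^sub>0 (1 - 1/\<theta>) n \<theta>^(-m)\<close>, which is the centring in the theorem.  The number \<open>X\<close> of vertices
  of in-degree \<open>m\<close> in \<open>T_n\<close> is close to a Poisson variable of parameter \<open>l_n\<close>, and a Poisson variable
  whose parameter tends to infinity is asymptotically normal.  Everything is done on the level of
  characteristic functions, so that the continuity theorem of Levy gives the conclusion.

  Once the weights are frozen, the parents of the vertices \<open>2, \<dots>, n\<close> are independent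
  (\<open>expectation_parents\<close>): vertex \<open>k\<close> is a ball thrown into one of the bins \<open>1, \<dots>, k - 1\<close>, and
  \<open>X\<close> counts the bins with exactly \<open>m\<close> balls.  Two facts about this quenched model carry the proof.

  \<^item> Poisson approximation (\<open>bins_char_poisson\<close>).  Conditioning on the set of balls in bin \<open>j\<close> and
    comparing with the experiment in which bin \<open>j\<close> is removed changes the number of other bins
    with \<open>m\<close> balls only if one of the few balls of bin \<open>j\<close> falls into a bin with at least \<open>m\<close> balls there.
    If every bin reaches \<open>m - 1\<close> balls with probability at most \<open>q\<close>, also after the removal, then
    \<open>E(X exp(iuX)) = \<Lambda> exp(iu) E(exp(iuX))\<close> up to an error of order \<open>\<Lambda> m q\<close>, where \<open>\<Lambda>\<close> is the quenched
    mean of \<open>X\<close>.  This is an approximate differential equation for the characteristic function,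
    and its exact solution is that of a Poisson variable.  The parameter \<open>l_n\<close> grows more slowly than
    any power of \<open>n\<close>, while \<open>q\<close> decays like a power of \<open>n\<close>, so the crude error bounds suffice.

  \<^item> The mean and the bound \<open>q\<close> (\<open>expected_count\<close>, \<open>degree_tail_le\<close>).  For a class of vertices, let
    \<open>T_m(n)\<close> be the expected number of those with in-degree at least \<open>m\<close>.  A new vertex attaches to
    each old vertex of weight \<open>w\<close> with probability \<open>w / S_n\<close>, so
    \<open>T_(m+1)(n + 1) = (1 - w/S_n) T_(m+1)(n) + (w/S_n) T_m(n)\<close> for vertices of weight \<open>w\<close>.
    If \<open>S_n = (\<theta> - 1) n\<close> held exactly, then \<open>\<rho>^m n\<close> with \<open>\<rho> = w / (\<theta> - 1 + w)\<close> would be a solution;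
    this is where \<open>\<theta>^(-m)\<close> for weight 1 comes from.  Since \<open>S_n\<close> deviates from its mean by at most
    \<open>n^\<gamma>\<close> with \<open>\<gamma> = 3/4\<close>, the actual values differ from this by at most a constant times
    \<open>z^(-m) n^\<gamma>\<close>, for any \<open>z < 1 + \<gamma> (\<theta> - 1)\<close> (\<open>supersolution\<close>).  Strict concavity of \<open>x \<mapsto> x^\<gamma>\<close>
    allows \<open>z > \<theta>^\<gamma>\<close>, and then the error is a negative power of \<open>n\<close> when \<open>m\<close> is close to
    \<open>log_\<theta> n\<close>.  The same estimate for a single vertex yields \<open>q\<close>.

  Vertices of weight 1 produce the main term \<open>l_n\<close>.  The others are split at the level \<open>s\<close> from the
  definition of \<open>s_k\<close>: those of weight in \<open>(s, 1)\<close> are few, and those of weight at most \<open>s\<close> have a smaller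
  rate \<open>\<rho>\<close>.  Up to the error above, both groups contribute at most a constant times \<open>l_n\<close> times a power of
  \<open>r_k\<close>, which is negligible compared with \<open>\<surd>l_n\<close> because \<open>i_n = o(|log r_k|)\<close>.  The weights behave well with probability close
  to 1 by Hoeffding's inequality, and on the exceptional event characteristic functions are bounded by 1.
\<close>

section \<open>Balls thrown independently into bins\<close>

lemma expectation_bind_pmf_finite:
  fixes h :: "'b \<Rightarrow> 'c::{banach, second_countable_topology}"
  assumes "finite (set_pmf p)" "\<And>x. x \<in> set_pmf p \<Longrightarrow> finite (set_pmf (f x))"
  shows "measure_pmf.expectation (bind_pmf p f) h =
    measure_pmf.expectation p (\<lambda>x. measure_pmf.expectation (f x) h)"
  using assms by (subst pmf_expectation_bind[of "set_pmf p"])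
    (auto intro!: integral_measure_pmf[symmetric])

lemma finite_set_Pi_pmf:
  assumes "finite B" "\<And>k. k \<in> B \<Longrightarrow> finite (set_pmf (P k))"
  shows "finite (set_pmf (Pi_pmf B d P))"
  using assms by (subst set_Pi_pmf) auto

text \<open>
  If every ball first decides by a coin toss whether it goes into bin \<open>j\<close>, then the coin tosses can be
  performed beforehand, independently of the destinations \<open>Q\<close> of the balls that avoid \<open>j\<close>.  The destinations
  may even be drawn for all balls; those of the balls sent to \<open>j\<close> are then overwritten.
\<close>

lemma Pi_pmf_bernoulli_mixture:
  assumes B: "finite B"
  shows "Pi_pmf B d (\<lambda>k. bind_pmf (H k) (\<lambda>x. if x then return_pmf j else Q k)) =
    bind_pmf (Pi_pmf B False H) (\<lambda>h.
      map_pmf (\<lambda>c k. if k \<in> B then if h k then j else c k else d) (Pi_pmf B d Q))"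
proof -
  have inner: "Pi_pmf B d (\<lambda>k. if h k then return_pmf j else Q k) =
      map_pmf (\<lambda>c k. if k \<in> B then if h k then j else c k else d) (Pi_pmf B d Q)" for h
  proof -
    have "(\<lambda>k. if h k then return_pmf j else Q k) =
        (\<lambda>k. bind_pmf (Q k) (\<lambda>x. return_pmf (if h k then j else x)))"
      by (auto simp: bind_return_pmf' fun_eq_iff)
    then show ?thesis
      using B by (simp add: Pi_pmf_bind[where d' = d] map_pmf_def)
  qed
  show ?thesis
    unfolding Pi_pmf_bind[OF B, where d' = False] inner ..
qed

definition load :: "'k set \<Rightarrow> ('k \<Rightarrow> 'b) \<Rightarrow> 'b \<Rightarrow> nat" where
  "load B c b = card {k \<in> B. c k = b}"

lemma load_insert:
  assumes "finite B" "k \<notin> B"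
  shows "load (insert k B) (f(k := y)) b = (if y = b then Suc (load B f b) else load B f b)"
proof -
  have "{l \<in> insert k B. (f(k := y)) l = b} =
      (if y = b then insert k {l \<in> B. f l = b} else {l \<in> B. f l = b})"
    using assms by auto
  then show ?thesis using assms by (simp add: load_def)
qed

lemma prob_Pi_pmf_insert:
  assumes "finite B" "k \<notin> B" and fin: "\<And>l. l \<in> insert k B \<Longrightarrow> finite (set_pmf (Q l))"
  shows "measure_pmf.prob (Pi_pmf (insert k B) d Q) A =
    measure_pmf.expectation (Q k) (\<lambda>y. measure_pmf.prob (Pi_pmf B d Q) {f. f(k := y) \<in> A})"
proof -
  have finB: "finite (set_pmf (Pi_pmf B d Q))"
    using assms by (intro finite_set_Pi_pmf) auto
  have P: "Pi_pmf (insert k B) d Q = bind_pmf (Q k) (\<lambda>y. map_pmf (\<lambda>f. f(k := y)) (Pi_pmf B d Q))"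
    using assms by (simp add: Pi_pmf_insert' map_pmf_def)
  have "measure_pmf.prob (Pi_pmf (insert k B) d Q) A =
      measure_pmf.expectation (Pi_pmf (insert k B) d Q) (indicator A)"
    by simp
  also have "\<dots> = measure_pmf.expectation (Q k) (\<lambda>y.
      measure_pmf.expectation (map_pmf (\<lambda>f. f(k := y)) (Pi_pmf B d Q)) (indicator A))"
    unfolding P using fin finB by (subst expectation_bind_pmf_finite) auto
  finally show ?thesis by (simp add: vimage_def)
qed

text \<open>
  Given that ball \<open>k\<close> lies in bin \<open>b\<close>, the bin has to receive \<open>m - 1\<close> of the other balls, which are
  independent of ball \<open>k\<close>.  A union bound over all bins would be too expensive here: the bound must not
  involve the number of bins.
\<close>

lemma prob_load_of_ball_ge:
  assumes B: "finite B" and k: "k \<in> B" and m: "m \<ge> 1"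
    and fin: "\<And>k. k \<in> B \<Longrightarrow> finite (set_pmf (Q k))"
    and q: "\<And>b. measure_pmf.prob (Pi_pmf B d Q) {c. load B c b \<ge> m - 1} \<le> q"
  shows "measure_pmf.prob (Pi_pmf B d Q) {c. load B c (c k) \<ge> m} \<le> q"
proof -
  define B' where "B' = B - {k}"
  have B': "B = insert k B'" "k \<notin> B'" "finite B'" using B k by (auto simp: B'_def)
  note ld = load_insert[OF B'(3,2), folded B'(1)]
  have exp: "measure_pmf.prob (Pi_pmf B d Q) A =
      measure_pmf.expectation (Q k) (\<lambda>y. measure_pmf.prob (Pi_pmf B' d Q) {f. f(k := y) \<in> A})" for A
    unfolding B'(1) using B' fin by (intro prob_Pi_pmf_insert) auto
  have le: "measure_pmf.prob (Pi_pmf B' d Q) {f. load B' f b \<ge> m - 1} \<le> q" for b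
  proof -
    have "measure_pmf.prob (Pi_pmf B' d Q) {f. load B' f b \<ge> m - 1} =
       measure_pmf.expectation (Q k) (\<lambda>y. measure_pmf.prob (Pi_pmf B' d Q) {f. load B' f b \<ge> m - 1})"
      by simp
    also have "\<dots> \<le> measure_pmf.expectation (Q k)
        (\<lambda>y. measure_pmf.prob (Pi_pmf B' d Q) {f. f(k := y) \<in> {c. load B c b \<ge> m - 1}})"
      using fin k by (intro integral_mono measure_pmf.finite_measure_mono)
        (auto simp: ld intro!: integrable_measure_pmf_finite)
    also have "\<dots> \<le> q" using q[of b] by (simp only: exp)
    finally show ?thesis .
  qed
  have "measure_pmf.prob (Pi_pmf B d Q) {c. load B c (c k) \<ge> m} =
      measure_pmf.expectation (Q k) (\<lambda>y. measure_pmf.prob (Pi_pmf B' d Q) {f. load B' f y \<ge> m - 1})"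
    using m by (simp add: exp ld le_diff_conv)
  also have "\<dots> \<le> measure_pmf.expectation (Q k) (\<lambda>y. q)"
    using fin k by (intro integral_mono le) (auto intro!: integrable_measure_pmf_finite)
  finally show ?thesis by simp
qed

text \<open>
  Moving the balls marked by \<open>h\<close> into bin \<open>j\<close> can only lower the loads of the other bins.  A bin that loses
  a ball has load below \<open>m\<close> before and hence also afterwards, so it is never counted.
\<close>

lemma card_bins_mixture:
  assumes B: "finite B"
    and small: "\<And>k. k \<in> B \<Longrightarrow> h k \<Longrightarrow> load B c (c k) < m"
  shows "{b \<in> V - {j}. load B (\<lambda>k. if k \<in> B then if h k then j else c k else d) b = m} =
    {b \<in> V - {j}. load B c b = m}"
proof -
  let ?c = "\<lambda>k. if k \<in> B then if h k then j else c k else d"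
  have "load B ?c b = m \<longleftrightarrow> load B c b = m" if "b \<noteq> j" for b
  proof (cases "\<exists>k\<in>B. h k \<and> c k = b")
    case True
    then have 1: "load B c b < m" using small by auto
    have "{k \<in> B. ?c k = b} \<subseteq> {k \<in> B. c k = b}" using that by auto
    then have "load B ?c b \<le> load B c b"
      unfolding load_def using B by (intro card_mono) auto
    then show ?thesis using 1 by simp
  next
    case False
    then have "{k \<in> B. ?c k = b} = {k \<in> B. c k = b}" using that by auto
    then show ?thesis by (simp add: load_def)
  qed
  then show ?thesis by auto
qed

lemma norm_expectation_diff_le:
  fixes f g :: "'a \<Rightarrow> complex"
  assumes fin: "finite (set_pmf p)"
    and le: "\<And>x. x \<in> set_pmf p \<Longrightarrow> norm (f x - g x) \<le> u x"
  shows "norm (measure_pmf.expectation p f - measure_pmf.expectation p g) \<le> measure_pmf.expectation p u"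
proof -
  note [simp] = integrable_measure_pmf_finite[OF fin]
  have "norm (measure_pmf.expectation p f - measure_pmf.expectation p g) =
      norm (measure_pmf.expectation p (\<lambda>x. f x - g x))"
    by (subst Bochner_Integration.integral_diff) auto
  also have "\<dots> \<le> measure_pmf.expectation p (\<lambda>x. norm (f x - g x))"
    by (rule integral_norm_bound)
  also have "\<dots> \<le> measure_pmf.expectation p u"
    using le by (intro integral_mono_AE) (auto simp: AE_measure_pmf_iff)
  finally show ?thesis .
qed

section \<open>Poisson approximation for the number of bins with a given load\<close>

text \<open>
  Decompose the configuration as in \<open>Pi_pmf_bernoulli_mixture\<close>: \<open>h\<close> marks the balls in bin \<open>j\<close> and an independent
  configuration avoids \<open>j\<close>.  Let \<open>A\<close> be the characteristic function of the number of bins with load \<open>m\<close>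
  in the latter.  For every fixed \<open>h\<close> with at most \<open>m\<close> marks the conditional characteristic function of the
  count is within \<open>2 m q\<close> of \<open>A\<close>, up to the factor \<open>exp(is)\<close> if bin \<open>j\<close> itself is counted.  Averaging over all
  \<open>h\<close> with exactly \<open>m\<close> marks gives the first expectation, and averaging over all \<open>h\<close> the second one; more than
  \<open>m\<close> marks have probability at most \<open>q\<close>.  The error keeps the factor \<open>P(load of j = m)\<close>, so that
  it remains small after summation over a large number of bins.
\<close>

lemma count_size_bias:
  fixes B :: "'k set" and V :: "'b set" and P Q :: "'k \<Rightarrow> 'b pmf" and s :: real and m :: nat
  defines "F \<equiv> \<lambda>c :: 'k \<Rightarrow> 'b. iexp (s * real (card {b \<in> V. load B c b = m}))"
  assumes B: "finite B" and V: "finite V" and j: "j \<in> V" and m: "m \<ge> 1"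
    and mix: "\<And>k. k \<in> B \<Longrightarrow> P k = bind_pmf (H k) (\<lambda>x. if x then return_pmf j else Q k)"
    and Qj: "\<And>k. k \<in> B \<Longrightarrow> j \<notin> set_pmf (Q k)"
    and finQ: "\<And>k. k \<in> B \<Longrightarrow> finite (set_pmf (Q k))"
    and q: "\<And>b. measure_pmf.prob (Pi_pmf B d Q) {c. load B c b \<ge> m - 1} \<le> q"
    and qj: "measure_pmf.prob (Pi_pmf B d P) {c. load B c j \<ge> m} \<le> q"
  shows "norm (measure_pmf.expectation (Pi_pmf B d P) (\<lambda>c. of_bool (load B c j = m) * F c)
      - measure_pmf.prob (Pi_pmf B d P) {c. load B c j = m} * iexp s
        * measure_pmf.expectation (Pi_pmf B d P) F)
    \<le> measure_pmf.prob (Pi_pmf B d P) {c. load B c j = m} * ((4 * real m + 2) * q)"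
proof -
  let ?H = "Pi_pmf B False H" and ?Q = "Pi_pmf B d Q" and ?P = "Pi_pmf B d P"
  let ?mix = "\<lambda>h c k. if k \<in> B then if h k then j else c k else d"
  define X' where "X' c = card {b \<in> V - {j}. load B c b = m}" for c :: "'k \<Rightarrow> 'b"
  define G where "G h = measure_pmf.expectation ?Q (\<lambda>c. F (?mix h c))" for h
  define A where "A = measure_pmf.expectation ?Q (\<lambda>c. iexp (s * real (X' c)))"
  define N where "N h = card {k \<in> B. h k}" for h :: "'k \<Rightarrow> bool"
  define \<pi> where "\<pi> = measure_pmf.prob ?P {c. load B c j = m}"
  have q0: "q \<ge> 0" using q[of undefined] by (meson measure_nonneg order_trans)
  have finQ': "finite (set_pmf ?Q)" using B finQ by (rule finite_set_Pi_pmf)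
  have finH: "finite (set_pmf ?H)" using B by (rule finite_set_Pi_pmf) auto
  have Peq: "?P = bind_pmf ?H (\<lambda>h. map_pmf (?mix h) ?Q)"
  proof -
    have "?P = Pi_pmf B d (\<lambda>k. bind_pmf (H k) (\<lambda>x. if x then return_pmf j else Q k))"
      using mix by (intro Pi_pmf_cong) auto
    then show ?thesis using Pi_pmf_bernoulli_mixture[OF B] by simp
  qed
  have EP: "measure_pmf.expectation ?P f =
      measure_pmf.expectation ?H (\<lambda>h. measure_pmf.expectation ?Q (\<lambda>c. f (?mix h c)))"
    for f :: "('k \<Rightarrow> 'b) \<Rightarrow> 'z::{banach, second_countable_topology}"
    unfolding Peq using finH finQ' by (subst expectation_bind_pmf_finite) auto
  have cj: "c k \<noteq> j" if "c \<in> set_pmf ?Q" "k \<in> B" for c k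
    using that Qj B by (auto simp: set_Pi_pmf PiE_dflt_def)
  have ldj: "load B (?mix h c) j = N h" if "c \<in> set_pmf ?Q" for h c
  proof -
    have "{k \<in> B. ?mix h c k = j} = {k \<in> B. h k}" using cj[OF that] by auto
    then show ?thesis by (simp add: load_def N_def)
  qed
  have split: "card {b \<in> V. load B c b = m} = of_bool (load B c j = m) + X' c" for c
  proof -
    have "{b \<in> V. load B c b = m} =
        (if load B c j = m then insert j {b \<in> V - {j}. load B c b = m} else {b \<in> V - {j}. load B c b = m})"
      using j by auto
    then show ?thesis using V by (simp add: X'_def)
  qed
  have Pev: "measure_pmf.prob ?P {c. R (load B c j)} = measure_pmf.prob ?H {h. R (N h)}" for R
  proof -
    have "measure_pmf.prob ?P {c. R (load B c j)} = measure_pmf.expectation ?P (indicator {c. R (load B c j)})"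
      by simp
    also have "\<dots> = measure_pmf.expectation ?H (\<lambda>h. measure_pmf.expectation ?Q
        (\<lambda>c. indicator {c. R (load B c j)} (?mix h c)))"
      by (rule EP)
    also have "\<dots> = measure_pmf.expectation ?H (\<lambda>h. measure_pmf.expectation ?Q
        (\<lambda>c. indicator {h. R (N h)} h))"
      by (intro Bochner_Integration.integral_cong refl integral_cong_AE)
        (auto simp: AE_measure_pmf_iff indicator_def ldj)
    finally show ?thesis by simp
  qed
  \<comment> \<open>The balls marked by \<open>h\<close> matter only if one of them sits in a bin of load at least \<open>m\<close>.\<close>
  have close: "norm (G h - iexp (s * of_bool (N h = m)) * A) \<le> 2 * real m * q" if "N h \<le> m" for h
  proof -
    let ?S = "{k \<in> B. h k}"
    let ?bad = "\<Union>k\<in>?S. {c. load B c (c k) \<ge> m}"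
    have "norm (G h - measure_pmf.expectation ?Q (\<lambda>c. iexp (s * of_bool (N h = m)) * iexp (s * real (X' c))))
        \<le> measure_pmf.expectation ?Q (\<lambda>c. 2 * indicator ?bad c)"
      unfolding G_def
    proof (rule norm_expectation_diff_le[OF finQ'])
      fix c assume c: "c \<in> set_pmf ?Q"
      have "norm (F (?mix h c) - iexp (s * of_bool (N h = m)) * iexp (s * real (X' c)))
          \<le> norm (F (?mix h c)) + norm (iexp (s * of_bool (N h = m)) * iexp (s * real (X' c)))"
        by (rule norm_triangle_ineq4)
      then have le2: "norm (F (?mix h c) - iexp (s * of_bool (N h = m)) * iexp (s * real (X' c))) \<le> 2"
        by (simp add: F_def norm_mult)
      show "norm (F (?mix h c) - iexp (s * of_bool (N h = m)) * iexp (s * real (X' c)))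
          \<le> 2 * indicator ?bad c"
      proof (cases "c \<in> ?bad")
        case False
        then have "X' (?mix h c) = X' c"
          unfolding X'_def using card_bins_mixture[OF B, where c = c and j = j and h = h and m = m and V = V and d = d]
          by (auto simp: not_le)
        then have "F (?mix h c) = iexp (s * of_bool (N h = m)) * iexp (s * real (X' c))"
          unfolding F_def split ldj[OF c] by (simp add: distrib_left exp_add of_bool_def)
        then show ?thesis by simp
      qed (use le2 in simp)
    qed
    also have "\<dots> = 2 * measure_pmf.prob ?Q ?bad" by simp
    also have "\<dots> \<le> 2 * (\<Sum>k\<in>?S. measure_pmf.prob ?Q {c. load B c (c k) \<ge> m})"
      using B by (intro mult_left_mono measure_pmf.finite_measure_subadditive_finite) auto
    also have "\<dots> \<le> 2 * (\<Sum>k\<in>?S. q)"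
      using prob_load_of_ball_ge[OF B _ m finQ q] by (intro mult_left_mono sum_mono) auto
    also have "\<dots> \<le> 2 * real m * q"
      using that q0 by (simp add: N_def mult_right_mono)
    finally show ?thesis by (simp add: A_def)
  qed
  have Gle: "norm (G h) \<le> 1" for h
    unfolding G_def
    by (rule order_trans[OF integral_norm_bound])
      (auto simp: F_def intro!: order_trans[OF integral_mono[where g = "\<lambda>_. 1"]])
  have Ale: "norm A \<le> 1"
    unfolding A_def
    by (rule order_trans[OF integral_norm_bound])
      (auto intro!: order_trans[OF integral_mono[where g = "\<lambda>_. 1"]])
  have E1: "measure_pmf.expectation ?P (\<lambda>c. of_bool (load B c j = m) * F c) =
      measure_pmf.expectation ?H (\<lambda>h. of_bool (N h = m) * G h)"
  proof -
    have "measure_pmf.expectation ?P (\<lambda>c. of_bool (load B c j = m) * F c) =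
      measure_pmf.expectation ?H (\<lambda>h. measure_pmf.expectation ?Q
        (\<lambda>c. of_bool (load B (?mix h c) j = m) * F (?mix h c)))"
      by (rule EP)
    also have "\<dots> = measure_pmf.expectation ?H (\<lambda>h. measure_pmf.expectation ?Q
        (\<lambda>c. of_bool (N h = m) * F (?mix h c)))"
      by (intro Bochner_Integration.integral_cong refl integral_cong_AE)
        (auto simp: AE_measure_pmf_iff ldj)
    finally show ?thesis by (simp add: G_def)
  qed
  have E2: "measure_pmf.expectation ?P F = measure_pmf.expectation ?H G"
    unfolding G_def by (rule EP)
  have pi_H: "\<pi> = measure_pmf.prob ?H {h. N h = m}"
    unfolding \<pi>_def by (rule Pev)
  have "norm (measure_pmf.expectation ?H (\<lambda>h. of_bool (N h = m) * G h)
      - measure_pmf.expectation ?H (\<lambda>h. of_bool (N h = m) * (iexp s * A)))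
    \<le> measure_pmf.expectation ?H (\<lambda>h. indicator {h. N h = m} h * (2 * real m * q))"
  proof (rule norm_expectation_diff_le[OF finH])
    show "norm (of_bool (N h = m) * G h - of_bool (N h = m) * (iexp s * A))
        \<le> indicator {h. N h = m} h * (2 * real m * q)" for h
      using close[of h] by (cases "N h = m") auto
  qed
  also have "measure_pmf.expectation ?H (\<lambda>h. of_bool (N h = m) * (iexp s * A)) = \<pi> * (iexp s * A)"
  proof -
    have "measure_pmf.expectation ?H (\<lambda>h. of_bool (N h = m) * (iexp s * A)) =
        measure_pmf.expectation ?H (\<lambda>h. complex_of_real (indicator {h. N h = m} h) * (iexp s * A))"
      by (intro Bochner_Integration.integral_cong) (auto simp: indicator_def)
    also have "\<dots> = measure_pmf.expectation ?H (\<lambda>h. complex_of_real (indicator {h. N h = m} h)) * (iexp s * A)"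
      by (rule integral_mult_left_zero)
    finally show ?thesis by (simp add: pi_H)
  qed
  also have "measure_pmf.expectation ?H (\<lambda>h. indicator {h. N h = m} h * (2 * real m * q)) = \<pi> * (2 * real m * q)"
    by (simp add: pi_H)
  finally have D1: "norm (measure_pmf.expectation ?H (\<lambda>h. of_bool (N h = m) * G h) - \<pi> * (iexp s * A))
    \<le> \<pi> * (2 * real m * q)" .
  have "norm (measure_pmf.expectation ?H (\<lambda>_. A) - measure_pmf.expectation ?H G)
    \<le> measure_pmf.expectation ?H (\<lambda>h. 2 * real m * q + 2 * indicator {h. N h \<ge> m} h)"
  proof (rule norm_expectation_diff_le[OF finH])
    show "norm (A - G h) \<le> 2 * real m * q + 2 * indicator {h. N h \<ge> m} h" for h
    proof (cases "N h < m")
      case True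
      then show ?thesis using close[of h] by (simp add: norm_minus_commute)
    next
      case False
      have "norm (A - G h) \<le> norm A + norm (G h)" by (rule norm_triangle_ineq4)
      moreover have "0 \<le> 2 * real m * q" using q0 by simp
      moreover have "indicator {h. N h \<ge> m} h = (1 :: real)" using False by simp
      ultimately show ?thesis using Gle[of h] Ale by linarith
    qed
  qed
  also have "\<dots> = 2 * real m * q + 2 * measure_pmf.prob ?H {h. N h \<ge> m}"
    by (subst Bochner_Integration.integral_add) (auto intro!: integrable_measure_pmf_finite finH)
  also have "\<dots> \<le> 2 * real m * q + 2 * q"
    using qj Pev[of "\<lambda>x. m \<le> x"] by simp
  finally have D2: "norm (A - measure_pmf.expectation ?H G) \<le> 2 * real m * q + 2 * q" by simp
  have "norm (measure_pmf.expectation ?H (\<lambda>h. of_bool (N h = m) * G h)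
      - \<pi> * iexp s * measure_pmf.expectation ?H G) =
    norm ((measure_pmf.expectation ?H (\<lambda>h. of_bool (N h = m) * G h) - \<pi> * (iexp s * A))
      + \<pi> * iexp s * (A - measure_pmf.expectation ?H G))"
    by (simp add: algebra_simps)
  also have "\<dots> \<le> norm (measure_pmf.expectation ?H (\<lambda>h. of_bool (N h = m) * G h) - \<pi> * (iexp s * A))
      + norm (\<pi> * iexp s * (A - measure_pmf.expectation ?H G))"
    by (rule norm_triangle_ineq)
  also have "norm (\<pi> * iexp s * (A - measure_pmf.expectation ?H G)) =
      \<pi> * norm (A - measure_pmf.expectation ?H G)"
    by (simp add: norm_mult \<pi>_def)
  also have "\<pi> * norm (A - measure_pmf.expectation ?H G) \<le> \<pi> * (2 * real m * q + 2 * q)"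
    using D2 by (intro mult_left_mono) (auto simp: \<pi>_def)
  also note D1
  finally show ?thesis
    unfolding E1 E2 \<pi>_def[symmetric] by (simp add: algebra_simps)
qed

lemma norm_exp_poisson_le:
  fixes l u :: real
  assumes "l \<ge> 0"
  shows "norm (exp (- (of_real l * (iexp u - 1)))) \<le> exp (l * u\<^sup>2 / 2)"
    and "norm (exp (of_real l * (iexp u - 1))) \<le> 1"
proof -
  have Re: "Re (of_real l * (iexp u - 1)) = - (l * (1 - cos u))"
    by (simp add: Re_exp algebra_simps)
  have "l * (1 - cos u) \<le> l * (u\<^sup>2 / 2)"
    using assms
  proof (intro mult_left_mono)
    have "1 - cos u = 2 * (sin (u / 2))\<^sup>2"
      using cos_double_sin[of "u / 2"] by simp
    also have "(sin (u / 2))\<^sup>2 \<le> (u / 2)\<^sup>2"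
      using abs_sin_x_le_abs_x[of "u / 2"] by (simp only: abs_le_square_iff)
    finally show "1 - cos u \<le> u\<^sup>2 / 2" by (simp add: power2_eq_square)
  qed
  then show "norm (exp (- (of_real l * (iexp u - 1)))) \<le> exp (l * u\<^sup>2 / 2)"
    using Re by (simp only: norm_exp_eq_Re) simp
  have "0 \<le> l * (1 - cos u)" using assms by simp
  then show "norm (exp (of_real l * (iexp u - 1))) \<le> 1"
    unfolding norm_exp_eq_Re Re by simp
qed

text \<open>
  The hypothesis says that the characteristic function \<open>\<phi>\<close> of \<open>X\<close> satisfies \<open>\<phi>' = i l exp(iu) \<phi>\<close> up to \<open>\<eta>\<close>, and
  \<open>e\<close> is the inverse of the solution for a Poisson variable.  Hence \<open>\<phi> e\<close> has a derivative of norm at most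
  \<open>\<eta> |e|\<close> and the mean value theorem applies.  At the scale \<open>s = t / \<surd>l\<close> of the central limit theorem the growth
  \<open>exp(l s\<^sup>2 / 2)\<close> of \<open>e\<close> is harmless.  The functions are extended to complex arguments only in order to use the complex mean value bound.
\<close>

lemma poisson_char_approx:
  fixes p :: "'a pmf" and X :: "'a \<Rightarrow> nat" and l s \<eta> :: real
  assumes fin: "finite (set_pmf p)" and l: "l \<ge> 0"
    and near: "\<And>u. norm (measure_pmf.expectation p (\<lambda>c. of_nat (X c) * iexp (u * real (X c)))
      - of_real l * iexp u * measure_pmf.expectation p (\<lambda>c. iexp (u * real (X c)))) \<le> \<eta>"
  shows "norm (measure_pmf.expectation p (\<lambda>c. iexp (s * real (X c))) - exp (of_real l * (iexp s - 1)))
    \<le> \<bar>s\<bar> * exp (l * s\<^sup>2 / 2) * \<eta>"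
proof -
  let ?S = "set_pmf p"
  define \<phi> where "\<phi> z = (\<Sum>c\<in>?S. of_real (pmf p c) * exp (\<i> * z * of_nat (X c)))" for z
  define \<psi> where "\<psi> z = (\<Sum>c\<in>?S. of_real (pmf p c) * (of_nat (X c) * exp (\<i> * z * of_nat (X c))))" for z
  define e where "e z = exp (- (of_real l * (exp (\<i> * z) - 1)))" for z
  have E: "measure_pmf.expectation p f = (\<Sum>c\<in>?S. of_real (pmf p c) * f c)" for f :: "'a \<Rightarrow> complex"
    using integral_measure_pmf[OF fin, of p f] by (simp add: scaleR_conv_of_real)
  have \<phi>: "measure_pmf.expectation p (\<lambda>c. iexp (u * real (X c))) = \<phi> (of_real u)" for u
    by (simp add: E \<phi>_def mult.assoc)
  have \<psi>: "measure_pmf.expectation p (\<lambda>c. of_nat (X c) * iexp (u * real (X c))) = \<psi> (of_real u)" for u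
    by (simp add: E \<psi>_def mult.assoc)
  have d\<phi>: "(\<phi> has_field_derivative \<i> * \<psi> z) (at z within A)" for z A
    unfolding \<phi>_def \<psi>_def sum_distrib_left
    by (auto intro!: derivative_eq_intros sum.cong simp: mult_ac)
  have de: "(e has_field_derivative - (\<i> * of_real l * exp (\<i> * z)) * e z) (at z within A)" for z A
    unfolding e_def by (auto intro!: derivative_eq_intros simp: mult_ac)
  \<comment> \<open>The derivative of the product is the defect in the differential equation times the factor \<open>e\<close>.\<close>
  have "norm (\<phi> (of_real s) * e (of_real s) - \<phi> 0 * e 0)
      \<le> (exp (l * s\<^sup>2 / 2) * \<eta>) * norm (of_real s - 0 :: complex)"
  proof (rule field_differentiable_bound[where S = "closed_segment 0 (of_real s)"
        and f' = "\<lambda>z. \<i> * (\<psi> z - of_real l * exp (\<i> * z) * \<phi> z) * e z"])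
    fix z :: complex
    show "((\<lambda>z. \<phi> z * e z) has_field_derivative \<i> * (\<psi> z - of_real l * exp (\<i> * z) * \<phi> z) * e z)
        (at z within closed_segment 0 (of_real s))"
      by (rule derivative_eq_intros d\<phi> de refl)+ (simp add: algebra_simps)
    assume "z \<in> closed_segment 0 (of_real s)"
    then obtain t where t: "0 \<le> t" "t \<le> 1" "z = of_real (t * s)"
      by (auto simp: in_segment scaleR_conv_of_real)
    define u where "u = t * s"
    have z: "z = of_real u" using t by (simp add: u_def)
    have "u\<^sup>2 \<le> s\<^sup>2"
      using t by (simp add: u_def power_mult_distrib mult_left_le_one_le power_le_one)
    then have "l * u\<^sup>2 \<le> l * s\<^sup>2" using l by (rule mult_left_mono)
    then have eu: "norm (e z) \<le> exp (l * s\<^sup>2 / 2)"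
      using norm_exp_poisson_le(1)[OF l, of u] unfolding e_def z
      by (elim order_trans) simp
    have "norm (\<i> * (\<psi> z - of_real l * exp (\<i> * z) * \<phi> z) * e z)
        = norm (\<psi> z - of_real l * exp (\<i> * z) * \<phi> z) * norm (e z)"
      by (simp add: norm_mult)
    also have "\<dots> \<le> \<eta> * exp (l * s\<^sup>2 / 2)"
    proof (rule mult_mono)
      show 1: "norm (\<psi> z - of_real l * exp (\<i> * z) * \<phi> z) \<le> \<eta>"
        using near[of u] by (simp only: \<phi> \<psi> z)
      show "0 \<le> \<eta>" using 1 norm_ge_zero order_trans by blast
    qed (use eu in auto)
    finally show "norm (\<i> * (\<psi> z - of_real l * exp (\<i> * z) * \<phi> z) * e z) \<le> exp (l * s\<^sup>2 / 2) * \<eta>"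
      by (simp add: mult.commute)
  qed auto
  moreover have "\<phi> 0 = 1"
    using sum_pmf_eq_1[OF fin order_refl] by (simp add: \<phi>_def flip: of_real_sum)
  moreover have "e 0 = 1" by (simp add: e_def)
  ultimately have g: "norm (\<phi> (of_real s) * e (of_real s) - 1) \<le> \<bar>s\<bar> * exp (l * s\<^sup>2 / 2) * \<eta>"
    by (simp add: mult_ac)
  let ?x = "exp (of_real l * (iexp s - 1))"
  have inv: "e (of_real s) * ?x = 1" by (simp add: e_def flip: exp_add)
  have "\<phi> (of_real s) - ?x = ?x * (\<phi> (of_real s) * e (of_real s) - 1)"
    using inv by (simp add: algebra_simps)
  then have "norm (\<phi> (of_real s) - ?x) = norm ?x * norm (\<phi> (of_real s) * e (of_real s) - 1)"
    by (simp only: norm_mult)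
  also have "\<dots> \<le> 1 * norm (\<phi> (of_real s) * e (of_real s) - 1)"
    using norm_exp_poisson_le(2)[OF l] by (rule mult_right_mono) simp
  finally show ?thesis using g unfolding \<phi> by linarith
qed

text \<open>
  The value \<open>d\<close> is a dummy bin for a ball that would go into bin \<open>j\<close> with probability 1, where conditioning is
  impossible.
\<close>

definition avoid_pmf :: "'b \<Rightarrow> 'b \<Rightarrow> 'b pmf \<Rightarrow> 'b pmf" where
  "avoid_pmf d j p = (if set_pmf p \<subseteq> {j} then return_pmf d else cond_pmf p (- {j}))"

lemma pmf_avoid_pmf:
  assumes "pmf p j < 1"
  shows "pmf (avoid_pmf d j p) b = (if b = j then 0 else pmf p b / (1 - pmf p j))"
proof -
  have ne: "\<not> set_pmf p \<subseteq> {j}"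
    using assms by (auto simp: set_pmf_subset_singleton)
  have "measure_pmf.prob p (- {j}) = 1 - pmf p j"
    using measure_pmf.prob_compl[of "{j}" p] by (simp add: Compl_eq_Diff_UNIV pmf.rep_eq)
  moreover have "set_pmf p \<inter> - {j} \<noteq> {}" using ne by auto
  ultimately show ?thesis
    using ne by (simp add: avoid_pmf_def pmf_cond)
qed

lemma avoid_pmf_support:
  assumes "d \<noteq> j"
  shows "j \<notin> set_pmf (avoid_pmf d j p)"
    and "finite (set_pmf p) \<Longrightarrow> finite (set_pmf (avoid_pmf d j p))"
proof -
  have "set_pmf p \<inter> - {j} \<noteq> {}" if "\<not> set_pmf p \<subseteq> {j}" using that by auto
  then show "j \<notin> set_pmf (avoid_pmf d j p)"
    and "finite (set_pmf p) \<Longrightarrow> finite (set_pmf (avoid_pmf d j p))"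
    using assms by (auto simp: avoid_pmf_def)
qed

lemma bernoulli_avoid_pmf_mixture:
  "p = bind_pmf (bernoulli_pmf (pmf p j)) (\<lambda>x. if x then return_pmf j else avoid_pmf d j p)"
proof (cases "pmf p j = 1")
  case True
  then have "measure_pmf.prob p {j} = 1" by (simp add: pmf.rep_eq)
  then have "AE x in p. x \<in> {j}" by (rule measure_pmf.AE_prob_1)
  then have "p = return_pmf j"
    by (simp add: AE_measure_pmf_iff subset_iff flip: set_pmf_subset_singleton)
  moreover have "bernoulli_pmf 1 = return_pmf True"
    by (rule pmf_eqI) (auto simp: indicator_def bernoulli_pmf.rep_eq split: bool.split)
  ultimately show ?thesis by (simp add: bind_return_pmf)
next
  case False
  then have lt: "pmf p j < 1" using pmf_le_1[of p j] by linarith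
  show ?thesis
  proof (rule pmf_eqI)
    show "pmf p b = pmf (bind_pmf (bernoulli_pmf (pmf p j))
        (\<lambda>x. if x then return_pmf j else avoid_pmf d j p)) b" for b
      using lt by (simp add: pmf_bind pmf_le_1 pmf_avoid_pmf[OF lt] indicator_def)
  qed
qed

lemma bins_char_poisson:
  fixes B :: "'k set" and V :: "'b set" and P :: "'k \<Rightarrow> 'b pmf" and l s q :: real and m :: nat and d :: 'b
  defines "X \<equiv> \<lambda>c :: 'k \<Rightarrow> 'b. card {b \<in> V. load B c b = m}"
  defines "\<Lambda> \<equiv> \<Sum>j\<in>V. measure_pmf.prob (Pi_pmf B d P) {c. load B c j = m}"
  assumes B: "finite B" and V: "finite V" and d: "d \<notin> V" and m: "m \<ge> 1" and l: "l \<ge> 0"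
    and fin: "\<And>k. k \<in> B \<Longrightarrow> finite (set_pmf (P k))"
    and q: "\<And>j b. j \<in> V \<Longrightarrow>
      measure_pmf.prob (Pi_pmf B d (\<lambda>k. avoid_pmf d j (P k))) {c. load B c b \<ge> m - 1} \<le> q"
    and qj: "\<And>j. j \<in> V \<Longrightarrow> measure_pmf.prob (Pi_pmf B d P) {c. load B c j \<ge> m} \<le> q"
  shows "norm (measure_pmf.expectation (Pi_pmf B d P) (\<lambda>c. iexp (s * real (X c)))
      - exp (of_real l * (iexp s - 1)))
    \<le> \<bar>s\<bar> * exp (l * s\<^sup>2 / 2) * (\<Lambda> * ((4 * real m + 2) * q) + \<bar>\<Lambda> - l\<bar>)"
proof (rule poisson_char_approx[OF _ l])
  let ?P = "Pi_pmf B d P"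
  show finP: "finite (set_pmf ?P)" using B fin by (rule finite_set_Pi_pmf)
  note [simp] = integrable_measure_pmf_finite[OF finP]
  fix u :: real
  define F where "F c = iexp (u * real (X c))" for c
  let ?\<pi> = "\<lambda>j. measure_pmf.prob ?P {c. load B c j = m}"
  have "measure_pmf.expectation ?P (\<lambda>c. of_nat (X c) * F c) =
      measure_pmf.expectation ?P (\<lambda>c. \<Sum>j\<in>V. of_bool (load B c j = m) * F c)"
  proof (intro Bochner_Integration.integral_cong refl)
    show "of_nat (X c) * F c = (\<Sum>j\<in>V. of_bool (load B c j = m) * F c)" for c
      using V by (simp add: X_def sum_distrib_right[symmetric] Int_def of_bool_def sum.If_cases)
  qed
  also have "\<dots> = (\<Sum>j\<in>V. measure_pmf.expectation ?P (\<lambda>c. of_bool (load B c j = m) * F c))"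
    by (rule Bochner_Integration.integral_sum) simp
  finally have E: "measure_pmf.expectation ?P (\<lambda>c. of_nat (X c) * F c) = \<dots>" .
  have "norm (measure_pmf.expectation ?P (\<lambda>c. of_nat (X c) * F c)
      - of_real \<Lambda> * iexp u * measure_pmf.expectation ?P F) =
    norm (\<Sum>j\<in>V. measure_pmf.expectation ?P (\<lambda>c. of_bool (load B c j = m) * F c)
      - ?\<pi> j * iexp u * measure_pmf.expectation ?P F)"
    unfolding E \<Lambda>_def by (simp add: sum_subtractf sum_distrib_right)
  also have "\<dots> \<le> (\<Sum>j\<in>V. ?\<pi> j * ((4 * real m + 2) * q))"
  proof (rule sum_norm_le)
    fix j assume j: "j \<in> V"
    then have dj: "d \<noteq> j" using d by auto
    show "norm (measure_pmf.expectation ?P (\<lambda>c. of_bool (load B c j = m) * F c)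
      - ?\<pi> j * iexp u * measure_pmf.expectation ?P F) \<le> ?\<pi> j * ((4 * real m + 2) * q)"
      unfolding F_def X_def
      by (rule count_size_bias[OF B V j m bernoulli_avoid_pmf_mixture avoid_pmf_support(1)[OF dj]
          avoid_pmf_support(2)[OF dj fin] q[OF j] qj[OF j]])
  qed
  also have "\<dots> = \<Lambda> * ((4 * real m + 2) * q)" by (simp add: \<Lambda>_def sum_distrib_right)
  finally have 1: "norm (measure_pmf.expectation ?P (\<lambda>c. of_nat (X c) * F c)
      - of_real \<Lambda> * iexp u * measure_pmf.expectation ?P F) \<le> \<Lambda> * ((4 * real m + 2) * q)" .
  have "norm (measure_pmf.expectation ?P F) \<le> 1"
    by (rule order_trans[OF integral_norm_bound]) (simp add: F_def)
  then have "\<bar>\<Lambda> - l\<bar> * norm (measure_pmf.expectation ?P F) \<le> \<bar>\<Lambda> - l\<bar>"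
    by (intro mult_left_le) auto
  then have 2: "norm (of_real (\<Lambda> - l) * iexp u * measure_pmf.expectation ?P F) \<le> \<bar>\<Lambda> - l\<bar>"
    by (simp only: norm_mult norm_of_real norm_exp_i_times mult_1_right)
  have "measure_pmf.expectation ?P (\<lambda>c. of_nat (X c) * F c)
      - of_real l * iexp u * measure_pmf.expectation ?P F =
    (measure_pmf.expectation ?P (\<lambda>c. of_nat (X c) * F c)
      - of_real \<Lambda> * iexp u * measure_pmf.expectation ?P F)
    + of_real (\<Lambda> - l) * iexp u * measure_pmf.expectation ?P F"
    by (simp add: algebra_simps)
  then show "norm (measure_pmf.expectation ?P (\<lambda>c. of_nat (X c) * iexp (u * real (X c)))
      - of_real l * iexp u * measure_pmf.expectation ?P (\<lambda>c. iexp (u * real (X c))))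
      \<le> \<Lambda> * ((4 * real m + 2) * q) + \<bar>\<Lambda> - l\<bar>"
    using norm_triangle_mono[OF 1 2] by (simp only: F_def[abs_def])
qed

section \<open>In-degree tails: recursion and comparison with the linear solution\<close>

text \<open>
  Ball \<open>k\<close> is the vertex \<open>k\<close> of the tree, \<open>P k\<close> the law of its parent, and the load of bin \<open>b\<close> the in-degree of
  vertex \<open>b\<close>.  Working with the events \<open>\<ge> m\<close> instead of \<open>= m\<close> makes the recursion hold for the count of a class of
  vertices with the mere size of the class as initial datum at \<open>m = 0\<close>.
\<close>

definition degree_tail :: "(nat \<Rightarrow> nat pmf) \<Rightarrow> nat \<Rightarrow> nat \<Rightarrow> nat \<Rightarrow> real" where
  "degree_tail P n b m = measure_pmf.prob (Pi_pmf {2..n} 0 P) {c. load {2..n} c b \<ge> m}"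

lemma degree_tail_bounds: "0 \<le> degree_tail P n b m" "degree_tail P n b m \<le> 1"
  by (auto simp: degree_tail_def)

lemma degree_tail_0 [simp]: "degree_tail P n b 0 = 1"
  by (simp add: degree_tail_def)

lemma degree_tail_eq_0:
  assumes "m \<ge> n" "n \<ge> 1"
  shows "degree_tail P n b m = 0"
proof -
  have "load {2..n} c b \<le> card {2..n}" for c
    unfolding load_def by (intro card_mono) auto
  then have "load {2..n} c b \<le> n - 1" for c by simp
  then have "load {2..n} c b < m" for c
    using assms by (metis diff_less le_less_trans less_le_trans zero_less_one less_eq_Suc_le One_nat_def)
  then show ?thesis by (simp add: degree_tail_def not_le[symmetric] flip: not_le)
qed

lemma degree_tail_late:
  assumes "\<And>k. k \<in> {2..n} \<Longrightarrow> b \<notin> set_pmf (P k)" "m \<ge> 1"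
  shows "degree_tail P n b m = 0"
proof -
  have "load {2..n} c b = 0" if "c \<in> set_pmf (Pi_pmf {2..n} 0 P)" for c
  proof -
    have "{k \<in> {2..n}. c k = b} = {}"
      using that assms by (auto simp: set_Pi_pmf PiE_dflt_def)
    then show ?thesis unfolding load_def by (metis card.empty)
  qed
  then have "set_pmf (Pi_pmf {2..n} 0 P) \<inter> {c. load {2..n} c b \<ge> m} = {}"
    using assms(2) by fastforce
  then show ?thesis unfolding degree_tail_def by (simp add: measure_pmf_zero_iff)
qed

lemma degree_tail_Suc:
  assumes "n \<ge> 1" and fin: "\<And>k. finite (set_pmf (P k))"
  shows "degree_tail P (Suc n) b (Suc m) = degree_tail P n b (Suc m)
    + pmf (P (Suc n)) b * (degree_tail P n b m - degree_tail P n b (Suc m))"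
proof -
  have ins: "{2..Suc n} = insert (Suc n) {2..n}" using assms(1) by auto
  have "degree_tail P (Suc n) b (Suc m) = measure_pmf.expectation (P (Suc n))
      (\<lambda>y. measure_pmf.prob (Pi_pmf {2..n} 0 P) {f. f(Suc n := y) \<in> {c. load {2..Suc n} c b \<ge> Suc m}})"
    unfolding degree_tail_def ins using fin by (intro prob_Pi_pmf_insert) auto
  also have "\<dots> = measure_pmf.expectation (P (Suc n))
      (\<lambda>y. degree_tail P n b (Suc m)
        + indicator {b} y * (degree_tail P n b m - degree_tail P n b (Suc m)))"
    unfolding ins by (intro Bochner_Integration.integral_cong refl)
      (auto simp: load_insert degree_tail_def indicator_def)
  also have "\<dots> = degree_tail P n b (Suc m)
      + pmf (P (Suc n)) b * (degree_tail P n b m - degree_tail P n b (Suc m))"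
    using fin by (subst Bochner_Integration.integral_add)
      (auto intro!: integrable_measure_pmf_finite simp: pmf.rep_eq)
  finally show ?thesis .
qed

lemma degree_tail_antimono: "m \<le> m' \<Longrightarrow> degree_tail P n b m' \<le> degree_tail P n b m"
  unfolding degree_tail_def by (intro measure_pmf.finite_measure_mono) auto

text \<open>
  The constants of the comparison argument: \<open>\<mu>\<close> is the mean weight, \<open>n powr \<gamma>\<close> the size of the
  deviations, and \<open>K\<close> the time from which on the weights are controlled.  The comparison function is
  \<open>(1/z)^m * n powr \<gamma>\<close>.  From time \<open>n\<close> to \<open>n + 1\<close> it grows by a factor of at least \<open>1 + g/n\<close>, whereas the recursion
  multiplies it by about \<open>1 + (z - 1) / (\<mu> n)\<close>; the gap \<open>\<eta>\<close> between the two absorbs the inhomogeneous terms.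
\<close>

locale tail_rates =
  fixes \<mu> \<gamma> z g \<eta> :: real and K :: nat
  assumes mu: "\<mu> > 0" and gam: "0 < \<gamma>" "\<gamma> < 1" and z: "1 < z" "z \<le> 1 + \<mu>"
    and eta: "\<eta> > 0" and K: "K \<ge> 1"
    and K_large: "\<And>n. n \<ge> K \<Longrightarrow> 4 * real n powr (\<gamma> - 1) \<le> \<mu>" "\<And>n. n \<ge> K \<Longrightarrow> 2 \<le> \<mu> * real n"
      "\<And>n. n \<ge> K \<Longrightarrow> (z - 1) / \<mu> * (1 + 4 / \<mu> * real n powr (\<gamma> - 1)) \<le> g - \<eta>"
    and growth: "\<And>n. n \<ge> K \<Longrightarrow> real n powr \<gamma> * (1 + g / real n) \<le> real (Suc n) powr \<gamma>"
begin

definition residual_const :: real where "residual_const = 4 / \<mu>"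

lemma residual_const_nonneg: "residual_const \<ge> 0"
  using mu by (simp add: residual_const_def)

text \<open>
  Large enough to dominate the values at time \<open>K\<close>, where all in-degrees are below \<open>K\<close>, and the residual divided by
  the gap \<open>\<eta>\<close>.
\<close>

definition error_const :: real where
  "error_const = 2 * real K * z ^ K + 2 * real K + residual_const / \<eta> + 1"

text \<open>
  The attachment probability \<open>p n\<close> per unit of weight is close to \<open>1 / (\<mu> n)\<close>.  It will be used for
  \<open>1 / S n\<close> and for \<open>1 / (S n - 1)\<close>, where \<open>S n\<close> is the total weight.
\<close>

definition near_rate :: "(nat \<Rightarrow> real) \<Rightarrow> bool" where
  "near_rate p \<longleftrightarrow> (\<forall>n\<ge>K. 0 \<le> p n \<and> p n \<le> 1 \<and>
    \<bar>\<mu> * (real n * p n) - 1\<bar> \<le> residual_const * real n powr (\<gamma> - 1) \<and> (z - 1) * (real n * p n) \<le> g - \<eta>)"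

lemma error_const_ge: "error_const \<ge> 1" "error_const \<ge> 2 * real K * z ^ K" "error_const \<ge> 2 * real K" "residual_const \<le> error_const * \<eta>"
proof -
  have "residual_const / \<eta> \<ge> 0" "2 * real K * z ^ K \<ge> 0" using residual_const_nonneg eta z by auto
  then show "error_const \<ge> 1" "error_const \<ge> 2 * real K * z ^ K" "error_const \<ge> 2 * real K" by (auto simp: error_const_def)
  have "residual_const / \<eta> \<le> error_const" using \<open>2 * real K * z ^ K \<ge> 0\<close> by (simp add: error_const_def)
  then show "residual_const \<le> error_const * \<eta>" using eta by (simp add: field_simps)
qed

lemma K_powr: "1 \<le> real K powr \<gamma>" "real K powr \<gamma> \<le> real K"
  using K gam powr_mono[of \<gamma> 1 "real K"] by (auto intro!: ge_one_powr_ge_zero)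

text \<open>
  Induction on \<open>n\<close>, simultaneously for all \<open>m\<close>: the comparison function is multiplied by at most
  \<open>1 + (z - 1) p n \<le> 1 + (g - \<eta>)/n\<close> and the residual adds at most \<open>\<eta>/n\<close>, in total less than the
  growth \<open>1 + g/n\<close>.
\<close>

lemma supersolution:
  fixes D :: "nat \<Rightarrow> nat \<Rightarrow> real"
  assumes p: "near_rate p" and x: "0 \<le> x" "x \<le> 1"
    and base: "\<And>n. n \<ge> K \<Longrightarrow> D 0 n \<le> error_const * real n powr \<gamma>"
    and init: "\<And>m. D m K \<le> error_const * (1 / z) ^ m * real K powr \<gamma>"
    and step: "\<And>m n. n \<ge> K \<Longrightarrow> D (Suc m) (Suc n) \<le> (1 - x * p n) * D (Suc m) n + x * p n * D m n
      + residual_const * real n powr (\<gamma> - 1) * (1 / z) ^ Suc m"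
    and n: "n \<ge> K"
  shows "D m n \<le> error_const * (1 / z) ^ m * real n powr \<gamma>"
  using n
proof (induction n arbitrary: m rule: dec_induct)
  case base
  show ?case by (rule init)
next
  case (step n)
  note nK = \<open>K \<le> n\<close>
  show ?case
  proof (cases m)
    case 0
    then show ?thesis using assms(4)[of "Suc n"] nK by simp
  next
    case (Suc m')
    \<comment> \<open>Passing from level \<open>m'\<close> to \<open>Suc m'\<close> costs a factor \<open>z\<close>, whence the factor \<open>1 + x p (z - 1)\<close>.\<close>
    define y where "y = (1 / z) ^ Suc m'"
    let ?N = "real n powr \<gamma>"
    have n0: "real n > 0" using nK K by simp
    have pn: "0 \<le> p n" "p n \<le> 1" "(z - 1) * (real n * p n) \<le> g - \<eta>"
      using p nK by (auto simp: near_rate_def)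
    have xp: "0 \<le> x * p n" "x * p n \<le> 1" "x * p n \<le> p n"
      using x pn by (auto intro: mult_le_one mult_left_le_one_le)
    have y0: "y > 0" using z by (simp add: y_def)
    have yz: "(1 / z) ^ m' = z * y" using z by (simp add: y_def)
    have pow: "real n powr (\<gamma> - 1) = ?N / real n"
      using n0 by (simp add: powr_diff)
    have "D (Suc m') (Suc n) \<le> (1 - x * p n) * D (Suc m') n + x * p n * D m' n
        + residual_const * real n powr (\<gamma> - 1) * y"
      unfolding y_def by (rule assms(6)[OF nK])
    also have "\<dots> \<le> (1 - x * p n) * (error_const * y * ?N) + x * p n * (error_const * (z * y) * ?N)
        + residual_const * (?N / real n) * y"
      using step.IH[of "Suc m'", folded y_def] step.IH[of m'] xp unfolding pow yz
      by (intro add_mono mult_left_mono order_refl) auto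
    also have "\<dots> = y * ?N * (error_const + error_const * ((z - 1) * (x * p n)) + residual_const / real n)"
      by (simp add: algebra_simps)
    also have "\<dots> \<le> y * ?N * (error_const + error_const * ((g - \<eta>) / real n) + error_const * \<eta> / real n)"
    proof (intro mult_left_mono add_mono order_refl divide_right_mono error_const_ge(4))
      have "(z - 1) * (x * p n) \<le> (z - 1) * p n" using xp z by (intro mult_left_mono) auto
      also have "\<dots> \<le> (g - \<eta>) / real n" using pn(3) n0 by (simp add: field_simps)
      finally show "(z - 1) * (x * p n) \<le> (g - \<eta>) / real n" .
    qed (use y0 n0 error_const_ge(1) in auto)
    also have "\<dots> = error_const * y * (?N * (1 + g / real n))"
      using n0 by (simp add: field_simps)
    also have "\<dots> \<le> error_const * y * real (Suc n) powr \<gamma>"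
      using growth[OF nK] y0 error_const_ge(1) by (intro mult_left_mono) auto
    finally show ?thesis unfolding Suc y_def .
  qed
qed

definition class_tail :: "nat set \<Rightarrow> (nat \<Rightarrow> nat pmf) \<Rightarrow> nat \<Rightarrow> nat \<Rightarrow> real" where
  "class_tail U P m n = (\<Sum>b\<in>U \<inter> {..n}. degree_tail P n b m)"

lemma class_tail_0: "class_tail U P 0 n = real (card (U \<inter> {..n}))"
  by (simp add: class_tail_def)

lemma class_tail_nonneg: "0 \<le> class_tail U P m n"
  by (simp add: class_tail_def degree_tail_bounds sum_nonneg)

lemma class_tail_Suc_Suc:
  assumes fin: "\<And>k. finite (set_pmf (P k))" and n: "n \<ge> 1"
    and late: "\<And>k. 2 \<le> k \<Longrightarrow> set_pmf (P k) \<subseteq> {..<k}"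
  shows "class_tail U P (Suc m) (Suc n) = class_tail U P (Suc m) n
    + (\<Sum>b\<in>U \<inter> {..n}. pmf (P (Suc n)) b * (degree_tail P n b m - degree_tail P n b (Suc m)))"
proof -
  have "class_tail U P (Suc m) (Suc n) = (\<Sum>b\<in>U \<inter> {..n}. degree_tail P (Suc n) b (Suc m))"
    unfolding class_tail_def
  proof (rule sum.mono_neutral_right)
    have "degree_tail P (Suc n) (Suc n) (Suc m) = 0"
      using late by (intro degree_tail_late) fastforce+
    then show "\<forall>b\<in>U \<inter> {..Suc n} - U \<inter> {..n}. degree_tail P (Suc n) b (Suc m) = 0"
      by (auto simp: le_Suc_eq)
  qed auto
  also have "\<dots> = (\<Sum>b\<in>U \<inter> {..n}. degree_tail P n b (Suc m)
      + pmf (P (Suc n)) b * (degree_tail P n b m - degree_tail P n b (Suc m)))"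
    by (simp add: degree_tail_Suc[OF n fin])
  finally show ?thesis by (simp add: class_tail_def sum.distrib)
qed

lemma ratio_le:
  assumes "0 \<le> x" "x \<le> 1"
  shows "0 \<le> x / (\<mu> + x)" "x / (\<mu> + x) \<le> 1 / z" "x / (\<mu> + x) \<le> 1"
proof -
  show 1: "0 \<le> x / (\<mu> + x)" using assms mu by simp
  have "z * x \<le> (1 + \<mu>) * x" using z assms by (intro mult_right_mono) auto
  also have "\<dots> \<le> \<mu> + x" using mu assms mult_left_le[of x \<mu>] by (simp add: algebra_simps)
  finally show 2: "x / (\<mu> + x) \<le> 1 / z" using z mu assms by (simp add: field_simps)
  also have "1 / z \<le> 1" using z by simp
  finally show "x / (\<mu> + x) \<le> 1" .
qed

text \<open>
  For \<open>p n = 1 / (\<mu> n)\<close> the function \<open>\<rho>^m n\<close> solves the recursion exactly, since \<open>x (1 - \<rho>) = \<mu> \<rho>\<close>.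
\<close>

lemma linear_solution_residual:
  assumes p: "near_rate p" and n: "n \<ge> K" and x: "0 \<le> x" "x \<le> 1" and a: "0 \<le> a" "a \<le> 1"
  defines "\<rho> \<equiv> x / (\<mu> + x)"
  shows "\<bar>(1 - x * p n) * (a * \<rho> ^ Suc m * real n) + x * p n * (a * \<rho> ^ m * real n)
      - a * \<rho> ^ Suc m * real (Suc n)\<bar> \<le> residual_const * real n powr (\<gamma> - 1) * (1 / z) ^ Suc m"
proof -
  have \<rho>: "0 \<le> \<rho>" "\<rho> \<le> 1 / z" using ratio_le[OF x] by (auto simp: \<rho>_def)
  have "x * (1 - \<rho>) = \<mu> * \<rho>" using mu x by (simp add: \<rho>_def field_simps)
  then have e: "x * \<rho> ^ m - x * \<rho> ^ Suc m = \<mu> * \<rho> ^ Suc m"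
    by (metis (no_types, lifting) mult.assoc mult.commute power_Suc right_diff_distrib mult_1_right)
  have "(1 - x * p n) * (a * \<rho> ^ Suc m * real n) + x * p n * (a * \<rho> ^ m * real n)
      - a * \<rho> ^ Suc m * real (Suc n)
    = a * (real n * p n) * (x * \<rho> ^ m - x * \<rho> ^ Suc m) - a * \<rho> ^ Suc m"
    by (simp add: algebra_simps)
  also have "\<dots> = a * \<rho> ^ Suc m * (\<mu> * (real n * p n) - 1)"
    unfolding e by (simp add: algebra_simps)
  finally have *: "(1 - x * p n) * (a * \<rho> ^ Suc m * real n) + x * p n * (a * \<rho> ^ m * real n)
      - a * \<rho> ^ Suc m * real (Suc n) = a * \<rho> ^ Suc m * (\<mu> * (real n * p n) - 1)" .
  have "\<bar>a * \<rho> ^ Suc m * (\<mu> * (real n * p n) - 1)\<bar> = (a * \<rho> ^ Suc m) * \<bar>\<mu> * (real n * p n) - 1\<bar>"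
    using a \<rho> by (simp add: abs_mult)
  also have "\<dots> \<le> (1 * (1 / z) ^ Suc m) * (residual_const * real n powr (\<gamma> - 1))"
    using p n a \<rho> z by (intro mult_mono power_mono) (auto simp: near_rate_def)
  finally show ?thesis unfolding * by (simp add: mult_ac)
qed

lemma class_tail_init:
  assumes "real (card (U \<inter> {..K})) \<le> 2 * real K"
  shows "class_tail U P m K \<le> error_const * (1 / z) ^ m * real K powr \<gamma>"
proof (cases "m \<ge> K")
  case True
  then have "class_tail U P m K = 0" using K by (simp add: class_tail_def degree_tail_eq_0)
  then show ?thesis using error_const_ge(1) z by simp
next
  case False
  have "class_tail U P m K \<le> (\<Sum>b\<in>U \<inter> {..K}. 1)"
    unfolding class_tail_def by (intro sum_mono degree_tail_bounds)
  also have "\<dots> \<le> 2 * real K" using assms by simp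
  also have "\<dots> \<le> 2 * real K * (z ^ K * (1 / z) ^ m)"
  proof -
    have "z ^ m \<le> z ^ K" using False z by (intro power_increasing) auto
    then have "1 \<le> z ^ K * (1 / z) ^ m" using z by (simp add: power_one_over field_simps)
    then show ?thesis using mult_left_mono[of 1 _ "2 * real K"] by simp
  qed
  also have "\<dots> = 2 * real K * z ^ K * (1 / z) ^ m" by simp
  also have "\<dots> \<le> error_const * (1 / z) ^ m"
    using error_const_ge(2) z by (intro mult_right_mono) auto
  also have "\<dots> \<le> error_const * (1 / z) ^ m * real K powr \<gamma>"
    using mult_left_mono[OF K_powr(1), of "error_const * (1 / z) ^ m"] error_const_ge(1) z by simp
  finally show ?thesis .
qed

text \<open>
  The difference between the expected number of vertices with in-degree at least \<open>m\<close> in a class \<open>U\<close> of density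
  \<open>a\<close> and the linear solution satisfies the recursion as an inequality with the residual above as inhomogeneity,
  hence it is dominated by the comparison function.
\<close>

lemma class_tail_upper:
  assumes p: "near_rate p" and x: "0 \<le> x" "x \<le> 1" and a: "0 \<le> a" "a \<le> 1"
    and fin: "\<And>k. finite (set_pmf (P k))"
    and late: "\<And>k. 2 \<le> k \<Longrightarrow> set_pmf (P k) \<subseteq> {..<k}"
    and le: "\<And>n b. n \<ge> K \<Longrightarrow> b \<in> U \<Longrightarrow> b \<le> n \<Longrightarrow> pmf (P (Suc n)) b \<le> x * p n"
    and card: "\<And>n. n \<ge> K \<Longrightarrow> real (card (U \<inter> {..n})) \<le> a * real n + real n powr \<gamma>"
    and n: "n \<ge> K"
  shows "class_tail U P m n \<le> a * (x / (\<mu> + x)) ^ m * real n + error_const * (1 / z) ^ m * real n powr \<gamma>"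
proof -
  define \<rho> where "\<rho> = x / (\<mu> + x)"
  have "class_tail U P m n - a * \<rho> ^ m * real n \<le> error_const * (1 / z) ^ m * real n powr \<gamma>"
  proof (rule supersolution[OF p x _ _ _ n, where D = "\<lambda>m n. class_tail U P m n - a * \<rho> ^ m * real n"])
    show "class_tail U P 0 n - a * \<rho> ^ 0 * real n \<le> error_const * real n powr \<gamma>" if "n \<ge> K" for n
    proof -
      have "class_tail U P 0 n - a * \<rho> ^ 0 * real n \<le> 1 * real n powr \<gamma>"
        using card[OF that] by (simp add: class_tail_0)
      also have "\<dots> \<le> error_const * real n powr \<gamma>" using error_const_ge(1) by (intro mult_right_mono) auto
      finally show ?thesis .
    qed
    show "class_tail U P m K - a * \<rho> ^ m * real K \<le> error_const * (1 / z) ^ m * real K powr \<gamma>" for m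
    proof -
      have "a * real K \<le> real K" using a by (simp add: mult_left_le_one_le)
      then have "real (card (U \<inter> {..K})) \<le> 2 * real K"
        using card[of K] K_powr(2) by simp
      moreover have "0 \<le> a * \<rho> ^ m * real K" using a ratio_le[OF x] by (simp add: \<rho>_def)
      ultimately show ?thesis using class_tail_init[of U P m] by linarith
    qed
    fix m n assume nK: "n \<ge> K"
    have n1: "n \<ge> 1" using nK K by simp
    have rec: "class_tail U P (Suc m) (Suc n) = class_tail U P (Suc m) n
        + (\<Sum>b\<in>U \<inter> {..n}. pmf (P (Suc n)) b * (degree_tail P n b m - degree_tail P n b (Suc m)))"
      using fin n1 late by (intro class_tail_Suc_Suc) auto
    have "class_tail U P (Suc m) (Suc n) \<le> class_tail U P (Suc m) n
        + (\<Sum>b\<in>U \<inter> {..n}. x * p n * (degree_tail P n b m - degree_tail P n b (Suc m)))"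
      unfolding rec
      using le[OF nK] degree_tail_antimono[of m "Suc m" P n]
      by (intro add_left_mono sum_mono mult_right_mono) auto
    also have "\<dots> = (1 - x * p n) * class_tail U P (Suc m) n + x * p n * class_tail U P m n"
      by (simp add: class_tail_def sum_distrib_left sum_subtractf algebra_simps)
    finally have "class_tail U P (Suc m) (Suc n) \<le> (1 - x * p n) * class_tail U P (Suc m) n + x * p n * class_tail U P m n" .
    moreover have "(1 - x * p n) * (a * \<rho> ^ Suc m * real n) + x * p n * (a * \<rho> ^ m * real n)
      - a * \<rho> ^ Suc m * real (Suc n) \<le> residual_const * real n powr (\<gamma> - 1) * (1 / z) ^ Suc m"
      using linear_solution_residual[OF p nK x a, of m] unfolding \<rho>_def by linarith
    ultimately show "class_tail U P (Suc m) (Suc n) - a * \<rho> ^ Suc m * real (Suc n)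
        \<le> (1 - x * p n) * (class_tail U P (Suc m) n - a * \<rho> ^ Suc m * real n)
          + x * p n * (class_tail U P m n - a * \<rho> ^ m * real n) + residual_const * real n powr (\<gamma> - 1) * (1 / z) ^ Suc m"
      unfolding right_diff_distrib by linarith
  qed
  then show ?thesis by (simp add: \<rho>_def)
qed

lemma class_tail_lower:
  assumes p: "near_rate p" and a: "0 \<le> a" "a \<le> 1"
    and fin: "\<And>k. finite (set_pmf (P k))"
    and late: "\<And>k. 2 \<le> k \<Longrightarrow> set_pmf (P k) \<subseteq> {..<k}"
    and eq: "\<And>n b. n \<ge> K \<Longrightarrow> b \<in> U \<Longrightarrow> b \<le> n \<Longrightarrow> pmf (P (Suc n)) b = p n"
    and card: "\<And>n. n \<ge> K \<Longrightarrow> real (card (U \<inter> {..n})) \<ge> a * real n - real n powr \<gamma>"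
    and n: "n \<ge> K"
  shows "class_tail U P m n \<ge> a * (1 / (\<mu> + 1)) ^ m * real n - error_const * (1 / z) ^ m * real n powr \<gamma>"
proof -
  define \<rho> where "\<rho> = 1 / (\<mu> + 1)"
  note r = ratio_le[of 1, simplified]
  have "a * \<rho> ^ m * real n - class_tail U P m n \<le> error_const * (1 / z) ^ m * real n powr \<gamma>"
  proof (rule supersolution[OF p _ _ _ _ _ n, where x = 1 and D = "\<lambda>m n. a * \<rho> ^ m * real n - class_tail U P m n"])
    show "a * \<rho> ^ 0 * real n - class_tail U P 0 n \<le> error_const * real n powr \<gamma>" if "n \<ge> K" for n
    proof -
      have "a * \<rho> ^ 0 * real n - class_tail U P 0 n \<le> 1 * real n powr \<gamma>"
        using card[OF that] by (simp add: class_tail_0)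
      also have "\<dots> \<le> error_const * real n powr \<gamma>" using error_const_ge(1) by (intro mult_right_mono) auto
      finally show ?thesis .
    qed
    show "a * \<rho> ^ m * real K - class_tail U P m K \<le> error_const * (1 / z) ^ m * real K powr \<gamma>" for m
    proof -
      have "a * \<rho> ^ m * real K \<le> 1 * (1 / z) ^ m * real K"
        using a r by (intro mult_right_mono mult_mono power_mono) (auto simp: \<rho>_def)
      also have "\<dots> \<le> (1 / z) ^ m * error_const" 
        using error_const_ge(3) z by (simp add: mult_left_mono)
      also have "\<dots> \<le> error_const * (1 / z) ^ m * real K powr \<gamma>"
        using mult_left_mono[OF K_powr(1), of "error_const * (1 / z) ^ m"] error_const_ge(1) z by (simp add: mult.commute)
      finally show ?thesis using class_tail_nonneg[of U P m K] by linarith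
    qed
    fix m n assume nK: "n \<ge> K"
    have n1: "n \<ge> 1" using nK K by simp
    have rec: "class_tail U P (Suc m) (Suc n) = class_tail U P (Suc m) n
        + (\<Sum>b\<in>U \<inter> {..n}. pmf (P (Suc n)) b * (degree_tail P n b m - degree_tail P n b (Suc m)))"
      using fin n1 late by (intro class_tail_Suc_Suc) auto
    have "class_tail U P (Suc m) (Suc n) = class_tail U P (Suc m) n
        + (\<Sum>b\<in>U \<inter> {..n}. p n * (degree_tail P n b m - degree_tail P n b (Suc m)))"
      unfolding rec using eq[OF nK] by simp
    also have "\<dots> = (1 - 1 * p n) * class_tail U P (Suc m) n + 1 * p n * class_tail U P m n"
      by (simp add: class_tail_def sum_distrib_left sum_subtractf algebra_simps)
    finally have "class_tail U P (Suc m) (Suc n) = (1 - 1 * p n) * class_tail U P (Suc m) n + 1 * p n * class_tail U P m n" .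
    moreover have "a * \<rho> ^ Suc m * real (Suc n) - ((1 - 1 * p n) * (a * \<rho> ^ Suc m * real n)
      + 1 * p n * (a * \<rho> ^ m * real n)) \<le> residual_const * real n powr (\<gamma> - 1) * (1 / z) ^ Suc m"
      using linear_solution_residual[OF p nK _ _ a, of 1 m] unfolding \<rho>_def by linarith
    ultimately show "a * \<rho> ^ Suc m * real (Suc n) - class_tail U P (Suc m) (Suc n)
        \<le> (1 - 1 * p n) * (a * \<rho> ^ Suc m * real n - class_tail U P (Suc m) n)
          + 1 * p n * (a * \<rho> ^ m * real n - class_tail U P m n) + residual_const * real n powr (\<gamma> - 1) * (1 / z) ^ Suc m"
      unfolding right_diff_distrib by linarith
  qed auto
  then show ?thesis by (simp add: \<rho>_def)
qed

end

section \<open>The tree with frozen weights\<close>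

definition parent_pmf :: "(nat \<Rightarrow> real) \<Rightarrow> nat \<Rightarrow> nat pmf" where
  "parent_pmf w k = (if k \<ge> 2
    then embed_pmf (\<lambda>i. if i \<in> {1..<k} then w i / (\<Sum>l=1..<k. w l) else 0) else return_pmf 0)"

lemma pmf_parent_pmf:
  assumes "k \<ge> 2" and pos: "\<And>i. i \<ge> 1 \<Longrightarrow> w i > 0"
  shows "pmf (parent_pmf w k) i = (if i \<in> {1..<k} then w i / (\<Sum>l=1..<k. w l) else 0)"
proof -
  let ?f = "\<lambda>i. if i \<in> {1..<k} then w i / (\<Sum>l=1..<k. w l) else 0"
  have S: "(\<Sum>l=1..<k. w l) > 0"
    using assms by (intro sum_pos) auto
  have nn: "?f i \<ge> 0" for i
    using S pos[of i] by auto
  have "(\<integral>\<^sup>+i. ennreal (?f i) \<partial>count_space UNIV) = (\<Sum>i=1..<k. ennreal (?f i))"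
    by (rule nn_integral_count_space') auto
  also have "\<dots> = ennreal (\<Sum>i=1..<k. ?f i)"
    by (intro sum_ennreal) (rule nn)
  also have "(\<Sum>i=1..<k. ?f i) = 1"
    using S by (simp flip: sum_divide_distrib)
  finally have "(\<integral>\<^sup>+i. ennreal (?f i) \<partial>count_space UNIV) = 1" by simp
  then have "pmf (embed_pmf ?f) i = ?f i"
    by (intro pmf_embed_pmf) (use nn in blast)+
  then show ?thesis
    unfolding parent_pmf_def using assms(1) by (simp only: if_True)
qed

lemma set_parent_pmf:
  assumes pos: "\<And>i. i \<ge> 1 \<Longrightarrow> w i > 0"
  shows "set_pmf (parent_pmf w k) \<subseteq> {..<max 1 k}" "finite (set_pmf (parent_pmf w k))"
    "k \<ge> 2 \<Longrightarrow> set_pmf (parent_pmf w k) = {1..<k}"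
proof -
  show *: "set_pmf (parent_pmf w k) = {1..<k}" if "k \<ge> 2" for k
  proof -
    have "(\<Sum>l=1..<k. w l) > 0" using that pos by (intro sum_pos) auto
    then have "pmf (parent_pmf w k) i \<noteq> 0 \<longleftrightarrow> i \<in> {1..<k}" for i
      using pos[of i] by (auto simp: pmf_parent_pmf[OF that pos])
    then show ?thesis unfolding set_eq_iff set_pmf_iff by (intro allI)
  qed
  show "set_pmf (parent_pmf w k) \<subseteq> {..<max 1 k}"
    using *[of k] by (cases "k \<ge> 2") (auto simp: parent_pmf_def)
  then show "finite (set_pmf (parent_pmf w k))"
    by (rule finite_subset) simp
qed

lemma set_avoid_pmf: "set_pmf (avoid_pmf d j p) \<subseteq> insert d (set_pmf p)"
proof -
  have "set_pmf p \<inter> - {j} \<noteq> {}" if "\<not> set_pmf p \<subseteq> {j}" using that by auto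
  then show ?thesis by (auto simp: avoid_pmf_def)
qed

context tail_rates begin

text \<open>
  The three quantities that determine the expected numbers of vertices with a given in-degree.  For random weights
  \<open>q0\<close> and \<open>r\<close> will be the probabilities that a weight is 1 and that it lies in \<open>(s, 1)\<close>.
\<close>

definition good_weights :: "real \<Rightarrow> real \<Rightarrow> real \<Rightarrow> (nat \<Rightarrow> real) \<Rightarrow> bool" where
  "good_weights q0 s r w \<longleftrightarrow> (\<forall>i\<ge>1. 0 < w i \<and> w i \<le> 1) \<and> (\<forall>n\<ge>K.
    \<bar>(\<Sum>i=1..n. w i) - \<mu> * real n\<bar> \<le> real n powr \<gamma> \<and>
    \<bar>real (card {i \<in> {1..n}. w i = 1}) - q0 * real n\<bar> \<le> real n powr \<gamma> \<and>
    \<bar>real (card {i \<in> {1..n}. s < w i \<and> w i < 1}) - r * real n\<bar> \<le> real n powr \<gamma>)"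

lemma near_rate_inverse:
  assumes "\<And>n. n \<ge> K \<Longrightarrow> \<bar>S n - \<mu> * real n\<bar> \<le> 2 * real n powr \<gamma>"
  shows "near_rate (\<lambda>n. 1 / S n)" "\<And>n. n \<ge> K \<Longrightarrow> S n \<ge> 1"
proof -
  have S: "S n \<ge> \<mu> * real n / 2" "S n \<ge> 1" "\<bar>\<mu> * (real n * (1 / S n)) - 1\<bar> \<le> residual_const * real n powr (\<gamma> - 1)"
      if n: "n \<ge> K" for n
  proof -
    have n0: "real n > 0" using n K by simp
    have pow: "real n powr (\<gamma> - 1) = real n powr \<gamma> / real n"
      using n0 by (simp add: powr_diff)
    have "4 * real n powr \<gamma> \<le> \<mu> * real n"
      using K_large(1)[OF n] n0 unfolding pow by (simp add: field_simps)
    then show S1: "S n \<ge> \<mu> * real n / 2" using assms[OF n] by linarith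
    then show S2: "S n \<ge> 1" using K_large(2)[OF n] by linarith
    have "\<mu> * (real n * (1 / S n)) - 1 = (\<mu> * real n - S n) / S n"
      using S2 by (simp add: diff_divide_distrib)
    then have "\<bar>\<mu> * (real n * (1 / S n)) - 1\<bar> = \<bar>S n - \<mu> * real n\<bar> / S n"
      using S2 by (simp only: abs_divide abs_minus_commute)
    also have "\<dots> \<le> (2 * real n powr \<gamma>) / (\<mu> * real n / 2)"
      using assms[OF n] S1 mu n0 by (intro frac_le) auto
    also have "\<dots> = residual_const * real n powr (\<gamma> - 1)"
      using mu n0 unfolding pow residual_const_def by (simp add: field_simps)
    finally show "\<bar>\<mu> * (real n * (1 / S n)) - 1\<bar> \<le> residual_const * real n powr (\<gamma> - 1)" .
  qed
  then show "\<And>n. n \<ge> K \<Longrightarrow> S n \<ge> 1" by blast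
  show "near_rate (\<lambda>n. 1 / S n)"
    unfolding near_rate_def
  proof (intro allI impI conjI)
    fix n assume n: "n \<ge> K"
    show "0 \<le> 1 / S n" "1 / S n \<le> 1" using S(2)[OF n] by auto
    show b: "\<bar>\<mu> * (real n * (1 / S n)) - 1\<bar> \<le> residual_const * real n powr (\<gamma> - 1)" by (rule S(3)[OF n])
    then have "\<mu> * (real n * (1 / S n)) \<le> 1 + residual_const * real n powr (\<gamma> - 1)" by linarith
    then have "(z - 1) / \<mu> * (\<mu> * (real n * (1 / S n))) \<le> (z - 1) / \<mu> * (1 + residual_const * real n powr (\<gamma> - 1))"
      using z mu by (intro mult_left_mono) auto
    also have "\<dots> \<le> g - \<eta>" using K_large(3)[OF n] by (simp add: residual_const_def)
    finally show "(z - 1) * (real n * (1 / S n)) \<le> g - \<eta>" using mu by simp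
  qed
qed

lemma powr_ge_1: "n \<ge> K \<Longrightarrow> 1 \<le> real n powr \<gamma>"
  using K gam by (intro ge_one_powr_ge_zero) auto

lemma degree_tail_le:
  assumes p: "near_rate p" and fin: "\<And>k. finite (set_pmf (P k))"
    and late: "\<And>k. 2 \<le> k \<Longrightarrow> set_pmf (P k) \<subseteq> {..<k}"
    and le: "\<And>n. n \<ge> K \<Longrightarrow> pmf (P (Suc n)) b \<le> p n" and n: "n \<ge> K"
    and m: "m \<ge> 1"
  shows "degree_tail P n b m \<le> error_const * (1 / z) ^ m * real n powr \<gamma>"
proof (cases "b \<le> n")
  case True
  have "real (card ({b} \<inter> {..n})) \<le> 0 * real n + real n powr \<gamma>" if "n \<ge> K" for n
    using powr_ge_1[OF that] by (cases "b \<le> n") auto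
  then have "class_tail {b} P m n \<le> 0 * (1 / (\<mu> + 1)) ^ m * real n + error_const * (1 / z) ^ m * real n powr \<gamma>"
    using le by (intro class_tail_upper[OF p _ _ _ _ fin late _ _ n]) auto
  then show ?thesis using True by (simp add: class_tail_def)
next
  case False
  then have "degree_tail P n b m = 0"
    using late by (intro degree_tail_late m) fastforce
  then show ?thesis using error_const_ge(1) z by simp
qed

text \<open>
  The four copies of the comparison bound stem from the vertices of weight 1 (for the levels \<open>m\<close> and \<open>m + 1\<close>), of
  weight at most \<open>s\<close> and of weight in \<open>(s, 1)\<close>; the remaining term bounds the linear solutions of the last two classes.
\<close>

definition mean_error :: "real \<Rightarrow> real \<Rightarrow> nat \<Rightarrow> nat \<Rightarrow> real" where
  "mean_error s r m n = 4 * (error_const * (1 / z) ^ m * real n powr \<gamma>)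
    + real n * (1 / (1 + \<mu>)) ^ m * (r + exp (- (1 - 1 / (1 + \<mu>)) * (1 - s) * real m))"

context
  fixes q0 s r :: real and w :: "nat \<Rightarrow> real"
  assumes w: "good_weights q0 s r w"
    and q0: "0 \<le> q0" "q0 \<le> 1" and s: "0 \<le> s" "s < 1" and r: "0 \<le> r" "r \<le> 1"
begin

lemma good_weights_at:
  assumes "n \<ge> K"
  shows "\<bar>(\<Sum>i=1..n. w i) - \<mu> * real n\<bar> \<le> real n powr \<gamma>"
    "\<bar>real (card {i \<in> {1..n}. w i = 1}) - q0 * real n\<bar> \<le> real n powr \<gamma>"
    "\<bar>real (card {i \<in> {1..n}. s < w i \<and> w i < 1}) - r * real n\<bar> \<le> real n powr \<gamma>"
proof -
  note g = w[unfolded good_weights_def, THEN conjunct2, rule_format, OF assms]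
  show "\<bar>(\<Sum>i=1..n. w i) - \<mu> * real n\<bar> \<le> real n powr \<gamma>" by (rule g[THEN conjunct1])
  show "\<bar>real (card {i \<in> {1..n}. w i = 1}) - q0 * real n\<bar> \<le> real n powr \<gamma>"
    by (rule g[THEN conjunct2, THEN conjunct1])
  show "\<bar>real (card {i \<in> {1..n}. s < w i \<and> w i < 1}) - r * real n\<bar> \<le> real n powr \<gamma>"
    by (rule g[THEN conjunct2, THEN conjunct2])
qed

lemma weight_range: "i \<ge> 1 \<Longrightarrow> 0 < w i" "i \<ge> 1 \<Longrightarrow> w i \<le> 1"
proof -
  have *: "\<forall>i\<ge>1. 0 < w i \<and> w i \<le> 1" using w unfolding good_weights_def by (rule conjunct1)
  show "i \<ge> 1 \<Longrightarrow> 0 < w i" "i \<ge> 1 \<Longrightarrow> w i \<le> 1" using * by simp_all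
qed

abbreviation "S n \<equiv> \<Sum>i=1..n. w i"
abbreviation "P \<equiv> parent_pmf w"

lemma finite_parent_pmf: "finite (set_pmf (P k))"
  by (rule set_parent_pmf(2)) (rule weight_range(1))

lemma parent_pmf_earlier: "2 \<le> k \<Longrightarrow> set_pmf (P k) \<subseteq> {..<k}"
proof -
  assume "2 \<le> k"
  moreover have "set_pmf (P k) \<subseteq> {..<max 1 k}" by (rule set_parent_pmf(1)) (rule weight_range(1))
  ultimately show ?thesis by (simp add: max_def split: if_splits)
qed

lemma pmf_P: assumes "n \<ge> 1" shows "pmf (P (Suc n)) b = (if b \<in> {1..n} then w b / S n else 0)"
proof -
  have "pmf (P (Suc n)) b = (if b \<in> {1..<Suc n} then w b / (\<Sum>l=1..<Suc n. w l) else 0)"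
    by (rule pmf_parent_pmf) (use assms in simp, rule weight_range(1))
  then show ?thesis by (simp only: atLeastLessThanSuc_atLeastAtMost)
qed

lemma near_rate_S: "near_rate (\<lambda>n. 1 / S n)"
  and near_rate_S1: "near_rate (\<lambda>n. 1 / (S n - 1))"
  and total_weight_gt: "\<And>n. n \<ge> K \<Longrightarrow> S n - 1 \<ge> 1"
proof -
  have b: "\<bar>S n - \<mu> * real n\<bar> \<le> 2 * real n powr \<gamma>" "\<bar>S n - 1 - \<mu> * real n\<bar> \<le> 2 * real n powr \<gamma>"
    if "n \<ge> K" for n
  proof -
    note good_weights_at(1)[OF that]
    then show "\<bar>S n - \<mu> * real n\<bar> \<le> 2 * real n powr \<gamma>" "\<bar>S n - 1 - \<mu> * real n\<bar> \<le> 2 * real n powr \<gamma>"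
      using powr_ge_1[OF that] by linarith+
  qed
  show "near_rate (\<lambda>n. 1 / S n)" using b(1) by (rule near_rate_inverse)
  show "near_rate (\<lambda>n. 1 / (S n - 1))" using b(2) by (rule near_rate_inverse)
  show "\<And>n. n \<ge> K \<Longrightarrow> S n - 1 \<ge> 1" using b(2) by (rule near_rate_inverse)
qed

lemma pmf_P_le:
  assumes n: "n \<ge> K" and x: "0 \<le> x" "b \<ge> 1 \<Longrightarrow> w b \<le> x"
  shows "pmf (P (Suc n)) b \<le> x / S n"
proof -
  have n1: "n \<ge> 1" using n K by simp
  have S: "S n > 0" using total_weight_gt[OF n] by linarith
  show ?thesis
  proof (cases "b \<in> {1..n}")
    case True
    then have "w b \<le> x" using x(2) by simp
    then show ?thesis
      unfolding pmf_P[OF n1] if_P[OF True] using S by (intro divide_right_mono) linarith+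
  next
    case False
    then show ?thesis
      unfolding pmf_P[OF n1] if_not_P[OF False] using S x(1) by (intro divide_nonneg_pos)
  qed
qed

text \<open>
  Removing bin \<open>j\<close> raises the probability of the other bins from \<open>w b / S n\<close> to \<open>w b / (S n - w j)\<close>, which the
  comparison argument tolerates.
\<close>

lemma degree_tail_avoid_le:
  assumes n: "n \<ge> K" and m: "m \<ge> 1" and j: "j \<ge> 1"
  shows "degree_tail (\<lambda>k. avoid_pmf 0 j (P k)) n b m \<le> error_const * (1 / z) ^ m * real n powr \<gamma>"
proof (rule degree_tail_le[OF near_rate_S1 _ _ _ n m])
  show "finite (set_pmf (avoid_pmf 0 j (P k)))" for k
    using finite_parent_pmf[of k] set_avoid_pmf[of 0 j "P k"] by (meson finite_insert finite_subset)
  show "set_pmf (avoid_pmf 0 j (P k)) \<subseteq> {..<k}" if "2 \<le> k" for k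
    using parent_pmf_earlier[OF that] set_avoid_pmf[of 0 j "P k"] that by auto
  show "pmf (avoid_pmf 0 j (P (Suc n))) b \<le> 1 / (S n - 1)" if n: "n \<ge> K" for n
  proof -
    have n1: "n \<ge> 1" using n K by simp
    note S = total_weight_gt[OF n]
    have S0: "S n > 0" and S1: "S n > 1" using S by linarith+
    have pj: "pmf (P (Suc n)) j \<le> 1 / S n" and pb: "pmf (P (Suc n)) b \<le> 1 / S n"
      by (rule pmf_P_le[OF n]; simp add: weight_range)+
    have "1 / S n < 1" using S1 by (simp only: divide_less_eq_1_pos[OF S0])
    then have lt: "pmf (P (Suc n)) j < 1" using pj by linarith
    have "pmf (avoid_pmf 0 j (P (Suc n))) b \<le> pmf (P (Suc n)) b / (1 - pmf (P (Suc n)) j)"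
      using lt by (simp add: pmf_avoid_pmf[OF lt])
    also have "\<dots> \<le> (1 / S n) / (1 - 1 / S n)"
    proof (rule frac_le)
      show "0 \<le> 1 / S n" by (rule order_trans[OF pmf_nonneg pb])
      show "0 < 1 - 1 / S n" using \<open>1 / S n < 1\<close> by linarith
    qed (use pb pj in linarith)+
    also have "\<dots> = 1 / (S n - 1)"
    proof -
      have "1 - 1 / S n = (S n - 1) / S n" using S0 by (simp only: diff_divide_distrib divide_self)
      then show ?thesis using S0 by simp
    qed
    finally show ?thesis .
  qed
qed

lemma degree_tail_parent_le:
  assumes n: "n \<ge> K" and m: "m \<ge> 1"
  shows "degree_tail P n b m \<le> error_const * (1 / z) ^ m * real n powr \<gamma>"
proof (rule degree_tail_le[OF near_rate_S finite_parent_pmf parent_pmf_earlier _ n m])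
  show "pmf (P (Suc n)) b \<le> 1 / S n" if "n \<ge> K" for n
    by (rule pmf_P_le[OF that]; simp add: weight_range)
qed

lemma class_tail_bounded_weight:
  assumes U: "U \<subseteq> {1..}" and x: "0 \<le> x" "x \<le> 1" "\<And>b. b \<in> U \<Longrightarrow> w b \<le> x" and a: "0 \<le> a" "a \<le> 1"
    and card: "\<And>n. n \<ge> K \<Longrightarrow> real (card (U \<inter> {..n})) \<le> a * real n + real n powr \<gamma>"
    and n: "n \<ge> K"
  shows "class_tail U P m n \<le> a * (x / (\<mu> + x)) ^ m * real n + error_const * (1 / z) ^ m * real n powr \<gamma>"
proof (rule class_tail_upper[OF near_rate_S x(1,2) a finite_parent_pmf parent_pmf_earlier _ card n])
  show "pmf (P (Suc n)) b \<le> x * (1 / S n)" if "n \<ge> K" "b \<in> U" "b \<le> n" for n b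
    unfolding times_divide_eq_right mult_1_right
    by (rule pmf_P_le[OF that(1) x(1)]) (rule x(3)[OF that(2)])
qed

text \<open>
  The number of vertices with in-degree exactly \<open>m\<close> is a difference of two tails.  The vertices of weight
  1 give \<open>q0 \<theta>^(-m) (1 - 1/\<theta>) n\<close> up to the comparison bound.  A vertex of weight at most \<open>s\<close> is compared with
  weight exactly \<open>s\<close>, where \<open>s / (\<mu> + s) \<le> exp(- (1 - 1/\<theta>) (1 - s)) / \<theta>\<close>; a vertex of weight in \<open>(s, 1)\<close> is
  compared with weight 1.
\<close>

lemma expected_count:
  assumes n: "n \<ge> K"
  shows "\<bar>(\<Sum>j\<in>{1..n}. measure_pmf.prob (Pi_pmf {2..n} 0 P) {c. load {2..n} c j = m})
      - q0 * (1 - 1 / (1 + \<mu>)) * real n * (1 / (1 + \<mu>)) ^ m\<bar> \<le> mean_error s r m n"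
proof -
  define U1 where "U1 = {i \<in> {1..}. w i = 1}"
  define U2 where "U2 = {i \<in> {1..}. w i \<le> s}"
  define U3 where "U3 = {i \<in> {1..}. s < w i \<and> w i < 1}"
  define \<theta> where "\<theta> = 1 + \<mu>"
  let ?Y = "\<lambda>m. error_const * (1 / z) ^ m * real n powr \<gamma>"
  have prob: "measure_pmf.prob (Pi_pmf {2..n} 0 P) {c. load {2..n} c j = m}
      = degree_tail P n j m - degree_tail P n j (Suc m)" for j
  proof -
    have "{c. load {2..n} c j \<ge> m} = {c. load {2..n} c j = m} \<union> {c. load {2..n} c j \<ge> Suc m}"
      by auto
    then show ?thesis unfolding degree_tail_def
      by (simp add: measure_pmf.finite_measure_Union disjoint_iff)
  qed
  have U: "(\<Sum>j\<in>{1..n}. degree_tail P n j m') = class_tail U1 P m' n + class_tail U2 P m' n + class_tail U3 P m' n" for m'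
  proof -
    have "b \<in> {1..n} \<longleftrightarrow> b \<in> (U1 \<inter> {..n} \<union> U2 \<inter> {..n}) \<union> U3 \<inter> {..n}" for b
      using weight_range(2)[of b] s(2) unfolding U1_def U2_def U3_def
      by (cases "w b = 1"; cases "w b \<le> s") auto
    then have "{1..n} = (U1 \<inter> {..n} \<union> U2 \<inter> {..n}) \<union> U3 \<inter> {..n}" by blast
    moreover have "U1 \<inter> {..n} \<inter> (U2 \<inter> {..n}) = {}" "(U1 \<inter> {..n} \<union> U2 \<inter> {..n}) \<inter> (U3 \<inter> {..n}) = {}"
      using s by (auto simp: U1_def U2_def U3_def)
    ultimately show ?thesis
      unfolding class_tail_def by (simp only:) (subst sum.union_disjoint; simp)+
  qed
  have cards: "U1 \<inter> {..n} = {i \<in> {1..n}. w i = 1}" "U3 \<inter> {..n} = {i \<in> {1..n}. s < w i \<and> w i < 1}" for n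
    by (auto simp: U1_def U3_def)
  have c1: "\<bar>real (card (U1 \<inter> {..n})) - q0 * real n\<bar> \<le> real n powr \<gamma>"
    "\<bar>real (card (U3 \<inter> {..n})) - r * real n\<bar> \<le> real n powr \<gamma>" if "n \<ge> K" for n
    unfolding cards by (rule good_weights_at[OF that])+
  have c2: "real (card (U2 \<inter> {..n})) \<le> 1 * real n + real n powr \<gamma>" for n
  proof -
    have "card (U2 \<inter> {..n}) \<le> card {1..n}" by (intro card_mono) (auto simp: U2_def)
    then have "real (card (U2 \<inter> {..n})) \<le> real n" by simp
    then show ?thesis using powr_ge_zero[of "real n" \<gamma>] by linarith
  qed
  have u1: "class_tail U1 P m' n \<le> q0 * (1 / (\<mu> + 1)) ^ m' * real n + ?Y m'" for m'
  proof (rule class_tail_bounded_weight[OF _ _ _ _ q0 _ n])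
    show "real (card (U1 \<inter> {..n})) \<le> q0 * real n + real n powr \<gamma>" if "n \<ge> K" for n
      using c1(1)[OF that] by linarith
  qed (auto simp: U1_def)
  have l1: "class_tail U1 P m' n \<ge> q0 * (1 / (\<mu> + 1)) ^ m' * real n - ?Y m'" for m'
  proof (rule class_tail_lower[OF near_rate_S q0 finite_parent_pmf parent_pmf_earlier _ _ n])
    show "pmf (P (Suc n)) b = 1 / S n" if "n \<ge> K" "b \<in> U1" "b \<le> n" for n b
      using that pmf_P[of n b] by (auto simp: U1_def)
    show "real (card (U1 \<inter> {..n})) \<ge> q0 * real n - real n powr \<gamma>" if "n \<ge> K" for n
      using c1(1)[OF that] by linarith
  qed
  \<comment> \<open>The trivial density 1 suffices for the light vertices, since their rate \<open>s / (\<mu> + s)\<close> is smaller.\<close>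
  have u2: "class_tail U2 P m n \<le> 1 * (s / (\<mu> + s)) ^ m * real n + ?Y m"
    by (rule class_tail_bounded_weight[OF _ _ _ _ _ _ c2 n]) (use s in \<open>auto simp: U2_def\<close>)
  have u3: "class_tail U3 P m n \<le> r * (1 / (\<mu> + 1)) ^ m * real n + ?Y m"
  proof (rule class_tail_bounded_weight[OF _ _ _ _ r _ n])
    show "real (card (U3 \<inter> {..n})) \<le> r * real n + real n powr \<gamma>" if "n \<ge> K" for n
      using c1(2)[OF that] by linarith
  qed (auto simp: U3_def)
  have tail_mono: "class_tail V P (Suc m) n \<le> class_tail V P m n" for V
    unfolding class_tail_def by (intro sum_mono degree_tail_antimono) auto
  have Y: "?Y (Suc m) \<le> ?Y m"
    using z error_const_ge(1) by (intro mult_right_mono mult_left_mono power_decreasing) auto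
  have \<rho>s: "(s / (\<mu> + s)) ^ m \<le> (1 / \<theta>) ^ m * exp (- (1 - 1 / \<theta>) * (1 - s) * real m)"
  proof -
    have "\<theta> * s / (\<mu> + s) = 1 - \<mu> * (1 - s) / (\<mu> + s)"
      using mu s by (simp add: \<theta>_def field_simps)
    also have "\<dots> \<le> 1 - \<mu> * (1 - s) / \<theta>"
      using mu s by (intro diff_left_mono divide_left_mono) (auto simp: \<theta>_def)
    also have "\<dots> = 1 + (- (1 - 1 / \<theta>) * (1 - s))"
      using mu by (simp add: \<theta>_def field_simps)
    also have "\<dots> \<le> exp (- (1 - 1 / \<theta>) * (1 - s))" by (rule exp_ge_add_one_self)
    finally have "s / (\<mu> + s) \<le> (1 / \<theta>) * exp (- (1 - 1 / \<theta>) * (1 - s))"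
      using mu by (simp add: \<theta>_def field_simps)
    then have "(s / (\<mu> + s)) ^ m \<le> ((1 / \<theta>) * exp (- (1 - 1 / \<theta>) * (1 - s))) ^ m"
      using mu s by (intro power_mono) auto
    then show ?thesis
      by (simp only: power_mult_distrib exp_of_nat2_mult)
  qed
  have comm: "\<mu> + 1 = \<theta>" by (simp add: \<theta>_def)
  define t where "t = (1 / \<theta>) ^ m * real n"
  define Y where "Y = ?Y m"
  define e where "e = exp (- (1 - 1 / \<theta>) * (1 - s) * real m)"
  have "class_tail U1 P m n - q0 * t \<le> Y" "q0 * t - class_tail U1 P m n \<le> Y"
    using u1[of m] l1[of m] unfolding comm t_def Y_def by (simp_all add: mult.assoc)
  moreover have "class_tail U1 P (Suc m) n - q0 * (1 / \<theta>) * t \<le> Y" "q0 * (1 / \<theta>) * t - class_tail U1 P (Suc m) n \<le> Y"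
    using u1[of "Suc m"] l1[of "Suc m"] Y unfolding comm t_def Y_def by (simp_all add: mult.assoc)
  moreover have "class_tail U2 P m n \<le> t * e + Y"
    using u2 mult_right_mono[OF \<rho>s, of "real n"] unfolding t_def Y_def e_def by (simp add: mult_ac)
  moreover have "class_tail U3 P m n \<le> t * r + Y"
    using u3 unfolding comm t_def Y_def by (simp add: mult_ac)
  moreover have "(\<Sum>j\<in>{1..n}. measure_pmf.prob (Pi_pmf {2..n} 0 P) {c. load {2..n} c j = m})
      = (class_tail U1 P m n + class_tail U2 P m n + class_tail U3 P m n) - (class_tail U1 P (Suc m) n + class_tail U2 P (Suc m) n + class_tail U3 P (Suc m) n)"
    unfolding prob by (simp only: sum_subtractf U)
  moreover have "0 \<le> class_tail U2 P (Suc m) n" "0 \<le> class_tail U3 P (Suc m) n" by (rule class_tail_nonneg)+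
  moreover have "q0 * (1 - 1 / \<theta>) * real n * (1 / \<theta>) ^ m = q0 * t - q0 * (1 / \<theta>) * t"
    by (simp add: t_def algebra_simps)
  moreover have "mean_error s r m n = 4 * Y + (t * r + t * e)"
    unfolding mean_error_def \<theta>_def[symmetric] t_def Y_def e_def by (simp add: algebra_simps)
  ultimately show ?thesis
    using tail_mono[of U2] tail_mono[of U3] unfolding \<theta>_def[symmetric] by linarith
qed

lemma quenched_char:
  fixes u :: real
  defines "l \<equiv> \<lambda>m n. q0 * (1 - 1 / (1 + \<mu>)) * real n * (1 / (1 + \<mu>)) ^ m"
  assumes n: "n \<ge> K" and m: "m \<ge> 2"
  shows "norm (measure_pmf.expectation (Pi_pmf {2..n} 0 P)
        (\<lambda>c. iexp (u * real (card {j \<in> {1..n}. load {2..n} c j = m})))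
      - exp (of_real (l m n) * (iexp u - 1)))
    \<le> \<bar>u\<bar> * exp (l m n * u\<^sup>2 / 2) * ((l m n + mean_error s r m n)
        * ((4 * real m + 2) * (error_const * (1 / z) ^ (m - 1) * real n powr \<gamma>)) + mean_error s r m n)"
proof -
  let ?\<Lambda> = "\<Sum>j\<in>{1..n}. measure_pmf.prob (Pi_pmf {2..n} 0 P) {c. load {2..n} c j = m}"
  let ?q = "error_const * (1 / z) ^ (m - 1) * real n powr \<gamma>"
  have l: "l m n \<ge> 0" using q0 mu by (simp add: l_def)
  have \<Lambda>: "\<bar>?\<Lambda> - l m n\<bar> \<le> mean_error s r m n"
    unfolding l_def by (rule expected_count[OF n])
  have q: "0 \<le> ?q" using error_const_ge(1) z by simp
  have "norm (measure_pmf.expectation (Pi_pmf {2..n} 0 P)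
        (\<lambda>c. iexp (u * real (card {j \<in> {1..n}. load {2..n} c j = m})))
      - exp (of_real (l m n) * (iexp u - 1)))
    \<le> \<bar>u\<bar> * exp (l m n * u\<^sup>2 / 2) * (?\<Lambda> * ((4 * real m + 2) * ?q) + \<bar>?\<Lambda> - l m n\<bar>)"
  proof (rule bins_char_poisson[OF _ _ _ _ l finite_parent_pmf])
    show "measure_pmf.prob (Pi_pmf {2..n} 0 (\<lambda>k. avoid_pmf 0 j (P k))) {c. m - 1 \<le> load {2..n} c b} \<le> ?q"
      if "j \<in> {1..n}" for j b
      using degree_tail_avoid_le[OF n, of "m - 1" j b] m that by (simp add: degree_tail_def)
    show "measure_pmf.prob (Pi_pmf {2..n} 0 P) {c. m \<le> load {2..n} c j} \<le> ?q" for j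
    proof -
      have "degree_tail P n j m \<le> degree_tail P n j (m - 1)" by (rule degree_tail_antimono) simp
      also have "\<dots> \<le> ?q" using m by (intro degree_tail_parent_le[OF n]) simp
      finally show ?thesis by (simp add: degree_tail_def)
    qed
  qed (use m in auto)
  also have "\<dots> \<le> \<bar>u\<bar> * exp (l m n * u\<^sup>2 / 2) * ((l m n + mean_error s r m n) * ((4 * real m + 2) * ?q) + mean_error s r m n)"
    using \<Lambda> q by (intro mult_left_mono add_mono mult_right_mono) auto
  finally show ?thesis .
qed

end

end

section \<open>From frozen weights to random weights\<close>

text \<open>
  The expectation under the law of the tree with frozen weights, written as a finite sum, from which the measurability
  in the weights is evident.
\<close>

definition quenched_expectation :: "nat \<Rightarrow> ((nat \<Rightarrow> nat) \<Rightarrow> complex) \<Rightarrow> (nat \<Rightarrow> real) \<Rightarrow> complex" where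
  "quenched_expectation n F w = (\<Sum>c\<in>PiE_dflt {2..n} 0 (\<lambda>k. {1..<k}).
    of_real (\<Prod>k\<in>{2..n}. w (c k) / (\<Sum>l=1..k - 1. w l)) * F c)"

lemma quenched_expectation_eq:
  assumes pos: "\<And>i. i \<ge> 1 \<Longrightarrow> w i > 0"
  shows "quenched_expectation n F w = measure_pmf.expectation (Pi_pmf {2..n} 0 (parent_pmf w)) F"
proof -
  let ?A = "PiE_dflt {2..n} 0 (\<lambda>k. {1..<k})"
  have fin: "finite ?A" by auto
  have "measure_pmf.expectation (Pi_pmf {2..n} 0 (parent_pmf w)) F =
      (\<Sum>c\<in>?A. pmf (Pi_pmf {2..n} 0 (parent_pmf w)) c *\<^sub>R F c)"
  proof (rule integral_measure_pmf[OF fin])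
    fix c assume "c \<in> set_pmf (Pi_pmf {2..n} 0 (parent_pmf w))"
    then show "c \<in> ?A"
      using set_parent_pmf(3)[of w] pos by (auto simp: set_Pi_pmf PiE_dflt_def)
  qed
  also have "\<dots> = quenched_expectation n F w"
    unfolding quenched_expectation_def
  proof (rule sum.cong[OF refl])
    fix c assume c: "c \<in> ?A"
    have "pmf (Pi_pmf {2..n} 0 (parent_pmf w)) c = (\<Prod>k\<in>{2..n}. pmf (parent_pmf w k) (c k))"
      using c by (intro pmf_Pi') (auto simp: PiE_dflt_def)
    also have "\<dots> = (\<Prod>k\<in>{2..n}. w (c k) / (\<Sum>l=1..k - 1. w l))"
    proof (rule prod.cong[OF refl])
      fix k assume k: "k \<in> {2..n}"
      have "c k \<in> {1..<k}" using c k by (auto simp: PiE_dflt_def)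
      moreover have "{1..<k} = {1..k - 1}" using k by auto
      moreover have "pmf (parent_pmf w k) (c k) = (if c k \<in> {1..<k} then w (c k) / (\<Sum>l=1..<k. w l) else 0)"
        by (rule pmf_parent_pmf) (use k pos in auto)
      ultimately show "pmf (parent_pmf w k) (c k) = w (c k) / (\<Sum>l=1..k - 1. w l)"
        by (simp only: if_True)
    qed
    finally show "pmf (Pi_pmf {2..n} 0 (parent_pmf w)) c *\<^sub>R F c =
        of_real (\<Prod>k\<in>{2..n}. w (c k) / (\<Sum>l=1..k - 1. w l)) * F c"
      by (simp add: scaleR_conv_of_real)
  qed
  finally show ?thesis ..
qed

lemma norm_quenched_expectation_le:
  assumes pos: "\<And>i. i \<ge> 1 \<Longrightarrow> w i > 0" and F: "\<And>c. norm (F c) \<le> 1"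
  shows "norm (quenched_expectation n F w) \<le> 1"
proof -
  have "norm (measure_pmf.expectation (Pi_pmf {2..n} 0 (parent_pmf w)) F)
      \<le> measure_pmf.expectation (Pi_pmf {2..n} 0 (parent_pmf w)) (\<lambda>c. norm (F c))"
    by (rule integral_norm_bound)
  also have "\<dots> \<le> measure_pmf.expectation (Pi_pmf {2..n} 0 (parent_pmf w)) (\<lambda>c. 1)"
    using F by (intro integral_mono measure_pmf.integrable_const_bound[where B = 1]) auto
  finally show ?thesis by (simp add: quenched_expectation_eq[of w, OF pos])
qed

lemma integral_sum_of_real_mult:
  fixes F :: "'c \<Rightarrow> complex"
  assumes "\<And>c. c \<in> A \<Longrightarrow> integrable M (h c)"
  shows "(\<integral>\<omega>. (\<Sum>c\<in>A. of_real (h c \<omega>) * F c) \<partial>M) = (\<Sum>c\<in>A. of_real (\<integral>\<omega>. h c \<omega> \<partial>M) * F c)"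
  using assms by (subst Bochner_Integration.integral_sum)
    (auto intro!: integrable_mult_left integrable_of_real simp: integral_complex_of_real)

context weighted_recursive_tree begin

lemma weight_measurable: "i \<ge> 1 \<Longrightarrow> W i \<in> borel_measurable M"
  using weights_indep unfolding indep_vars_def2 by auto

lemma space_wrt_algebra: "space (wrt_algebra M W parent n) = space M"
  using wrt_algebra_subalgebra[of n] by (simp add: subalgebra_def)

lemma sets_wrt_algebra:
  "sets (wrt_algebra M W parent n) = sigma_sets (space M)
      ({W i -` B \<inter> space M | i B. i \<ge> 1 \<and> B \<in> sets borel} \<union>
       {parent k -` A \<inter> space M | k A. k \<in> {2..n}})"
  unfolding wrt_algebra_def by (rule sets_measure_of) auto

lemma weight_wrt_measurable: "i \<ge> 1 \<Longrightarrow> W i \<in> borel_measurable (wrt_algebra M W parent n)"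
  by (rule measurableI) (auto simp: space_wrt_algebra sets_wrt_algebra intro!: sigma_sets.Basic)

lemma parent_wrt_measurable:
  "k \<in> {2..n} \<Longrightarrow> {\<omega> \<in> space M. parent k \<omega> = a} \<in> sets (wrt_algebra M W parent n)"
proof -
  assume k: "k \<in> {2..n}"
  have "{\<omega> \<in> space M. parent k \<omega> = a} = parent k -` {a} \<inter> space M" by auto
  then show ?thesis
    unfolding sets_wrt_algebra by (simp only:) (rule sigma_sets.Basic, use k in blast)
qed

lemma wrt_algebra_mono:
  assumes "g \<in> borel_measurable (wrt_algebra M W parent n)" "n \<le> n'"
  shows "(g :: 'a \<Rightarrow> real) \<in> borel_measurable (wrt_algebra M W parent n')"
proof -
  have "sets (wrt_algebra M W parent n) \<subseteq> sets (wrt_algebra M W parent n')"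
    unfolding sets_wrt_algebra using assms(2) by (intro sigma_sets_mono') fastforce
  then show ?thesis
    using assms(1) unfolding measurable_def space_wrt_algebra by blast
qed

lemma AE_weight_pos: "AE \<omega> in M. \<forall>i\<ge>1. W i \<omega> > 0"
proof -
  have "AE \<omega> in M. W i \<omega> > 0" if "i \<ge> 1" for i
  proof -
    have "AE x in \<mu>. x \<in> {0<..}" using weight_pos by (intro weight.AE_prob_1) auto
    then have "AE x in distr M borel (W i). x \<in> {0<..}" unfolding weights_distr[OF that] .
    then show ?thesis using weight_measurable[OF that] by (subst (asm) AE_distr_iff) auto
  qed
  then show ?thesis by (simp add: AE_all_countable) 
qed

definition "attach_prob c k \<omega> = W (c k) \<omega> / total_weight W (k - 1) \<omega>"

lemma attach_prob_bounds:
  assumes "\<forall>i\<ge>1. W i \<omega> > 0" "k \<ge> 2" "c k \<in> {1..<k}"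
  shows "0 \<le> attach_prob c k \<omega>" "attach_prob c k \<omega> \<le> 1"
proof -
  have "W (c k) \<omega> \<le> total_weight W (k - 1) \<omega>"
    unfolding total_weight_def using assms by (intro member_le_sum) (auto simp: less_imp_le)
  moreover have "W (c k) \<omega> > 0" using assms by simp
  ultimately show "0 \<le> attach_prob c k \<omega>" "attach_prob c k \<omega> \<le> 1"
    by (auto simp: attach_prob_def)
qed

lemma attach_prob_measurable:
  assumes "k \<ge> 2" "c k \<in> {1..<k}"
  shows "attach_prob c k \<in> borel_measurable (wrt_algebra M W parent n)"
proof -
  have [measurable]: "W (c k) \<in> borel_measurable (wrt_algebra M W parent n)"
    using assms by (intro weight_wrt_measurable) auto
  have [measurable]: "total_weight W (k - 1) \<in> borel_measurable (wrt_algebra M W parent n)"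
    unfolding total_weight_def[abs_def] by (intro borel_measurable_sum weight_wrt_measurable) auto
  show ?thesis unfolding attach_prob_def[abs_def] by measurable
qed

text \<open>
  Peel off the last vertex: conditionally on the earlier tree and all weights, its parent is \<open>c n\<close> with probability
  \<open>attach_prob c n\<close>, which depends on the weights alone and is therefore absorbed into \<open>g\<close> in the induction.
\<close>

lemma joint_parent_prob:
  fixes g :: "'a \<Rightarrow> real"
  assumes n: "n \<ge> 1" and c: "\<And>k. k \<in> {2..n} \<Longrightarrow> c k \<in> {1..<k}"
    and g: "g \<in> borel_measurable (wrt_algebra M W parent 1)"
    and bdd: "AE \<omega> in M. \<bar>g \<omega>\<bar> \<le> 1"
  shows "(\<integral>\<omega>. g \<omega> * (\<Prod>k\<in>{2..n}. indicator {\<omega> \<in> space M. parent k \<omega> = c k} \<omega>) \<partial>M) =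
    (\<integral>\<omega>. g \<omega> * (\<Prod>k\<in>{2..n}. attach_prob c k \<omega>) \<partial>M)"
  using n c g bdd
proof (induction n arbitrary: g rule: dec_induct)
  case base
  then show ?case by simp
next
  case (step n)
  let ?F = "wrt_algebra M W parent n"
  let ?I = "\<lambda>k. indicator {\<omega> \<in> space M. parent k \<omega> = c k} :: 'a \<Rightarrow> real"
  let ?f = "\<lambda>\<omega>. g \<omega> * (\<Prod>k\<in>{2..n}. ?I k \<omega>)"
  have sub: "subalgebra M ?F" by (rule wrt_algebra_subalgebra)
  interpret sub: sigma_finite_subalgebra M ?F
    using sub finite_measure_axioms
    by (intro finite_measure_subalgebra_is_sigma_finite) (simp add: finite_measure_subalgebra_def finite_measure_subalgebra_axioms_def)
  have n1: "n \<ge> 1" using step.hyps by simp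
  have ins: "{2..Suc n} = insert (Suc n) {2..n}" using n1 by auto
  have cS: "c (Suc n) \<in> {1..n}" using step.prems(1)[of "Suc n"] n1 by auto
  have f: "?f \<in> borel_measurable ?F"
    using parent_wrt_measurable[of _ n] wrt_algebra_mono[OF step.prems(2) n1]
    by (intro borel_measurable_times borel_measurable_prod borel_measurable_indicator) auto
  have par: "parent (Suc n) \<in> measurable M (count_space {1..n})"
    using parent_measurable[OF n1] .
  have ISuc: "{\<omega> \<in> space M. parent (Suc n) \<omega> = c (Suc n)} \<in> sets M"
  proof -
    have "{\<omega> \<in> space M. parent (Suc n) \<omega> = c (Suc n)} = parent (Suc n) -` {c (Suc n)} \<inter> space M" by auto
    then show ?thesis using measurable_sets[OF par, of "{c (Suc n)}"] cS by simp
  qed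
  have fM: "?f \<in> borel_measurable M" by (rule measurable_from_subalg[OF sub f])
  have prod_le: "0 \<le> (\<Prod>k\<in>{2..n}. ?I k \<omega>)" "(\<Prod>k\<in>{2..n}. ?I k \<omega>) \<le> 1" for \<omega>
    by (auto intro!: prod_nonneg prod_le_1 simp: indicator_def)
  have int: "integrable M (\<lambda>\<omega>. ?f \<omega> * ?I (Suc n) \<omega>)"
  proof (rule integrable_const_bound[where B = 1])
    show "AE \<omega> in M. norm (?f \<omega> * ?I (Suc n) \<omega>) \<le> 1"
      using step.prems(3)
    proof eventually_elim
      case (elim \<omega>)
      have "\<bar>g \<omega>\<bar> * (\<Prod>k\<in>{2..n}. ?I k \<omega>) \<le> 1"
        using elim prod_le by (intro mult_le_one) auto
      then show ?case
        using prod_le(1)[of \<omega>] by (auto simp: abs_mult indicator_def)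
    qed
  qed (use fM ISuc in measurable)
  have "(\<integral>\<omega>. g \<omega> * (\<Prod>k\<in>{2..Suc n}. ?I k \<omega>) \<partial>M) = (\<integral>\<omega>. ?f \<omega> * ?I (Suc n) \<omega> \<partial>M)"
    unfolding ins by (intro Bochner_Integration.integral_cong refl) (simp add: mult_ac)
  also have "\<dots> = (\<integral>\<omega>. ?f \<omega> * real_cond_exp M ?F (?I (Suc n)) \<omega> \<partial>M)"
    using ISuc by (intro sub.real_cond_exp_intg(2)[symmetric] int f) auto
  also have "\<dots> = (\<integral>\<omega>. ?f \<omega> * attach_prob c (Suc n) \<omega> \<partial>M)"
  proof (rule integral_cong_AE)
    show "AE \<omega> in M. ?f \<omega> * real_cond_exp M ?F (?I (Suc n)) \<omega> = ?f \<omega> * attach_prob c (Suc n) \<omega>"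
      using parent_cond_prob[OF n1 cS] by eventually_elim (simp add: attach_prob_def)
    have "attach_prob c (Suc n) \<in> borel_measurable M"
      using measurable_from_subalg[OF sub attach_prob_measurable[of "Suc n" c n]] n1 cS by auto
    then show "(\<lambda>\<omega>. ?f \<omega> * attach_prob c (Suc n) \<omega>) \<in> borel_measurable M" using fM by measurable
    have "real_cond_exp M ?F (?I (Suc n)) \<in> borel_measurable M"
      by (rule measurable_from_subalg[OF sub]) measurable
    then show "(\<lambda>\<omega>. ?f \<omega> * real_cond_exp M ?F (?I (Suc n)) \<omega>) \<in> borel_measurable M"
      using fM by measurable
  qed
  also have "\<dots> = (\<integral>\<omega>. (g \<omega> * attach_prob c (Suc n) \<omega>) * (\<Prod>k\<in>{2..n}. ?I k \<omega>) \<partial>M)"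
    by (intro Bochner_Integration.integral_cong refl) (simp add: mult_ac)
  also have "\<dots> = (\<integral>\<omega>. (g \<omega> * attach_prob c (Suc n) \<omega>) * (\<Prod>k\<in>{2..n}. attach_prob c k \<omega>) \<partial>M)"
  proof (rule step.IH)
    show "c k \<in> {1..<k}" if "k \<in> {2..n}" for k using step.prems(1)[of k] that by auto
    show "(\<lambda>\<omega>. g \<omega> * attach_prob c (Suc n) \<omega>) \<in> borel_measurable (wrt_algebra M W parent 1)"
      using step.prems(2) attach_prob_measurable[of "Suc n" c 1] n1 cS by (intro borel_measurable_times) auto
    show "AE \<omega> in M. \<bar>g \<omega> * attach_prob c (Suc n) \<omega>\<bar> \<le> 1"
      using step.prems(3) AE_weight_pos
    proof eventually_elim
      case (elim \<omega>)
      then show ?case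
        using attach_prob_bounds[of \<omega> "Suc n" c] n1 cS by (auto simp: abs_mult intro!: mult_le_one)
    qed
  qed
  also have "\<dots> = (\<integral>\<omega>. g \<omega> * (\<Prod>k\<in>{2..Suc n}. attach_prob c k \<omega>) \<partial>M)"
    unfolding ins by (intro Bochner_Integration.integral_cong refl) (simp add: mult_ac)
  finally show ?case .
qed

definition parents :: "nat \<Rightarrow> 'a \<Rightarrow> nat \<Rightarrow> nat" where
  "parents n \<omega> k = (if k \<in> {2..n} then parent k \<omega> else 0)"

lemma parent_event: "k \<ge> 2 \<Longrightarrow> {\<omega> \<in> space M. parent k \<omega> = a} \<in> sets M"
  using parent_wrt_measurable[of k k a] wrt_algebra_subalgebra[of k] by (auto simp: subalgebra_def)

text \<open>
  The law of the tree is the mixture of the laws with frozen weights.  It is enough to sum \<open>joint_parent_prob\<close> with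
  \<open>g = 1\<close> over the finitely many possible values of the parent vector, as \<open>F\<close> does not involve the weights.
\<close>

lemma expectation_parents:
  fixes F :: "(nat \<Rightarrow> nat) \<Rightarrow> complex"
  assumes n: "n \<ge> 1"
  shows "(\<integral>\<omega>. F (parents n \<omega>) \<partial>M) = (\<integral>\<omega>. quenched_expectation n F (\<lambda>i. W i \<omega>) \<partial>M)"
    and "integrable M (\<lambda>\<omega>. quenched_expectation n F (\<lambda>i. W i \<omega>))"
    and "(\<lambda>\<omega>. F (parents n \<omega>)) \<in> borel_measurable M"
proof -
  let ?A = "PiE_dflt {2..n} 0 (\<lambda>k. {1..<k})"
  let ?I = "\<lambda>c \<omega>. (\<Prod>k\<in>{2..n}. indicator {\<omega> \<in> space M. parent k \<omega> = c k} \<omega>) :: real"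
  let ?R = "\<lambda>c \<omega>. (\<Prod>k\<in>{2..n}. attach_prob c k \<omega>)"
  have fin: "finite ?A" by auto
  have cA: "c k \<in> {1..<k}" if "c \<in> ?A" "k \<in> {2..n}" for c k
    using that by (auto simp: PiE_dflt_def)
  have inA: "parents n \<omega> \<in> ?A" if "\<omega> \<in> space M" for \<omega>
  proof -
    have "parent k \<omega> \<in> {1..<k}" if k: "k \<in> {2..n}" for k
    proof -
      have "k - 1 \<ge> 1" using k unfolding atLeastAtMost_iff by linarith
      from measurable_space[OF parent_measurable[OF this] \<open>\<omega> \<in> space M\<close>]
      have "parent (Suc (k - 1)) \<omega> \<in> {1..k - 1}" by simp
      then show ?thesis using k by auto
    qed
    then show ?thesis by (auto simp: PiE_dflt_def parents_def)
  qed
  have Ieq: "?I c \<omega> = of_bool (parents n \<omega> = c)" if "\<omega> \<in> space M" "c \<in> ?A" for \<omega> c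
  proof (cases "parents n \<omega> = c")
    case True
    then have "parent k \<omega> = c k" if "k \<in> {2..n}" for k
      using that by (auto simp: parents_def)
    then show ?thesis using True \<open>\<omega> \<in> space M\<close> by simp
  next
    case False
    then obtain k where k: "parents n \<omega> k \<noteq> c k" by auto
    moreover have "parents n \<omega> k = 0" "c k = 0" if "k \<notin> {2..n}"
      using that \<open>c \<in> ?A\<close> unfolding parents_def PiE_dflt_def by (simp only: if_False, blast)
    ultimately have "k \<in> {2..n}" by fastforce
    moreover have "indicator {\<omega> \<in> space M. parent k \<omega> = c k} \<omega> = (0 :: real)"
      using k \<open>k \<in> {2..n}\<close> by (simp add: parents_def)
    ultimately have "?I c \<omega> = 0" by (intro prod_zero) auto
    then show ?thesis using False by simp
  qed
  have F: "F (parents n \<omega>) = (\<Sum>c\<in>?A. of_real (?I c \<omega>) * F c)" if "\<omega> \<in> space M" for \<omega>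
  proof -
    have "(\<Sum>c\<in>?A. of_real (?I c \<omega>) * F c) = (\<Sum>c\<in>?A. if c = parents n \<omega> then F c else 0)"
      using Ieq[OF that] by (intro sum.cong refl) auto
    also have "\<dots> = F (parents n \<omega>)" using fin inA[OF that] by simp
    finally show ?thesis ..
  qed
  have mI: "?I c \<in> borel_measurable M" for c
    by (intro borel_measurable_prod borel_measurable_indicator parent_event) auto
  have iI: "integrable M (?I c)" for c
    by (rule integrable_const_bound[OF _ mI, where B = 1])
      (auto intro!: prod_le_1 simp: indicator_def abs_prod)
  have mR: "?R c \<in> borel_measurable M" if "c \<in> ?A" for c
    using cA[OF that] measurable_from_subalg[OF wrt_algebra_subalgebra attach_prob_measurable]
    by (intro borel_measurable_prod) auto
  have iR: "integrable M (?R c)" if "c \<in> ?A" for c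
  proof (rule integrable_const_bound[OF _ mR[OF that], where B = 1])
    show "AE \<omega> in M. norm (?R c \<omega>) \<le> 1"
      using AE_weight_pos
    proof eventually_elim
      case (elim \<omega>)
      have "0 \<le> attach_prob c k \<omega> \<and> attach_prob c k \<omega> \<le> 1" if "k \<in> {2..n}" for k
        using attach_prob_bounds[OF elim, of k c] cA[OF \<open>c \<in> ?A\<close> that] that by auto
      then show ?case by (auto intro!: prod_le_1 simp: abs_prod)
    qed
  qed
  have qe: "quenched_expectation n F (\<lambda>i. W i \<omega>) = (\<Sum>c\<in>?A. of_real (?R c \<omega>) * F c)" for \<omega>
    by (simp add: quenched_expectation_def attach_prob_def total_weight_def)
  show "integrable M (\<lambda>\<omega>. quenched_expectation n F (\<lambda>i. W i \<omega>))"
    unfolding qe using iR by (intro Bochner_Integration.integrable_sum integrable_mult_left integrable_of_real) auto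
  have "(\<lambda>\<omega>. \<Sum>c\<in>?A. of_real (?I c \<omega>) * F c) \<in> borel_measurable M"
    using mI by measurable
  then show "(\<lambda>\<omega>. F (parents n \<omega>)) \<in> borel_measurable M"
    using F by (subst measurable_cong) auto
  have "(\<integral>\<omega>. F (parents n \<omega>) \<partial>M) = (\<integral>\<omega>. (\<Sum>c\<in>?A. of_real (?I c \<omega>) * F c) \<partial>M)"
    using F by (intro Bochner_Integration.integral_cong) auto
  also have "\<dots> = (\<Sum>c\<in>?A. of_real (\<integral>\<omega>. ?I c \<omega> \<partial>M) * F c)"
    by (rule integral_sum_of_real_mult) (rule iI)
  also have "\<dots> = (\<Sum>c\<in>?A. of_real (\<integral>\<omega>. ?R c \<omega> \<partial>M) * F c)"
  proof (rule sum.cong[OF refl])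
    fix c assume c: "c \<in> ?A"
    have "(\<integral>\<omega>. ?I c \<omega> \<partial>M) = (\<integral>\<omega>. ?R c \<omega> \<partial>M)"
      using joint_parent_prob[OF n cA[OF c], of "\<lambda>_. 1"] by simp
    then show "of_real (\<integral>\<omega>. ?I c \<omega> \<partial>M) * F c = of_real (\<integral>\<omega>. ?R c \<omega> \<partial>M) * F c" by simp
  qed
  also have "\<dots> = (\<integral>\<omega>. (\<Sum>c\<in>?A. of_real (?R c \<omega>) * F c) \<partial>M)"
    by (rule integral_sum_of_real_mult[symmetric]) (rule iR)
  finally show "(\<integral>\<omega>. F (parents n \<omega>) \<partial>M) = (\<integral>\<omega>. quenched_expectation n F (\<lambda>i. W i \<omega>) \<partial>M)"
    unfolding qe .
qed

lemma degree_count_eq: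
  "degree_count \<mu> parent n i \<omega> =
    card {j \<in> {1..n}. int (load {2..n} (parents n \<omega>) j) = \<lfloor>log (theta \<mu>) (real n)\<rfloor> + i}"
proof -
  have "wrt_in_degree parent n j \<omega> = load {2..n} (parents n \<omega>) j" for j
  proof -
    have "in_arcs (wrt_tree parent n \<omega>) j = (\<lambda>k. (k, parent k \<omega>)) ` {k \<in> {2..n}. parent k \<omega> = j}"
      by (auto simp: in_arcs_def wrt_tree_def)
    then have "wrt_in_degree parent n j \<omega> = card {k \<in> {2..n}. parent k \<omega> = j}"
      by (simp add: wrt_in_degree_def in_degree_def card_image inj_on_def)
    also have "{k \<in> {2..n}. parent k \<omega> = j} = {k \<in> {2..n}. parents n \<omega> k = j}"
      by (auto simp: parents_def)
    finally show ?thesis by (simp add: load_def)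
  qed
  then show ?thesis by (simp add: degree_count_def)
qed

lemma degree_count_measurable [measurable]:
  "(\<lambda>\<omega>. real (degree_count \<mu> parent n i \<omega>)) \<in> borel_measurable M"
proof (cases "n \<ge> 1")
  case True
  let ?F = "\<lambda>c. complex_of_real (real (card {j \<in> {1..n}. int (load {2..n} c j) = \<lfloor>log (theta \<mu>) (real n)\<rfloor> + i}))"
  have "(\<lambda>\<omega>. Re (?F (parents n \<omega>))) \<in> borel_measurable M"
    by (rule measurable_compose[OF expectation_parents(3)[OF True, of ?F]
        borel_measurable_continuous_onI[OF linear_continuous_on[OF bounded_linear_Re]]])
  then show ?thesis unfolding Re_complex_of_real degree_count_eq .
next
  case False
  then have "{j \<in> {1..n}. Q j} = {}" for Q by auto
  then show ?thesis unfolding degree_count_def by (simp only: card.empty) simp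
qed

end

section \<open>Concentration of the weights\<close>

text \<open>
  Hoeffding's inequality for a deviation of \<open>n powr (3/4)\<close> gives the exponent \<open>- 2 * sqrt n\<close>; three such events are needed
  for each \<open>n \<ge> K\<close>.
\<close>

definition deviation_tail :: "nat \<Rightarrow> real" where
  "deviation_tail K = 3 * (\<Sum>n. 2 * exp (- 2 * sqrt (real (n + K))))"

lemma summable_exp_sqrt: "summable (\<lambda>n. 2 * exp (- 2 * sqrt (real n)))"
proof (rule summable_comparison_test_bigo)
  show "summable (\<lambda>n. norm (1 / real n ^ 2))"
    using inverse_power_summable[of 2, where 'a = real] by (simp add: inverse_eq_divide)
  show "(\<lambda>n. 2 * exp (- 2 * sqrt (real n))) \<in> O(\<lambda>n. 1 / real n ^ 2)"
    by real_asymp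
qed

lemma deviation_tail_tendsto_0: "deviation_tail \<longlonglongrightarrow> 0"
proof -
  let ?f = "\<lambda>n. 2 * exp (- 2 * sqrt (real n))"
  have "deviation_tail = (\<lambda>K. 3 * (suminf ?f - (\<Sum>n<K. ?f n)))"
    unfolding deviation_tail_def[abs_def]
    using suminf_minus_initial_segment[OF summable_exp_sqrt] by simp
  moreover have "(\<lambda>K. 3 * (suminf ?f - (\<Sum>n<K. ?f n))) \<longlonglongrightarrow> 3 * (suminf ?f - suminf ?f)"
    using summable_LIMSEQ[OF summable_exp_sqrt] by (intro tendsto_intros)
  ultimately show ?thesis by (simp only: diff_self mult_zero_right)
qed

context weighted_recursive_tree begin

lemma sum_concentration:
  fixes f :: "real \<Rightarrow> real"
  assumes f [measurable]: "f \<in> borel_measurable borel"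
    and f01: "\<And>x. x \<in> {0<..1} \<Longrightarrow> 0 \<le> f x \<and> f x \<le> 1"
    and range: "measure \<mu> {0<..1} = 1" and n: "n \<ge> 1" and e: "e \<ge> 0"
  shows "prob {\<omega> \<in> space M. \<bar>(\<Sum>i=1..n. f (W i \<omega>)) - real n * (\<integral>x. f x \<partial>\<mu>)\<bar> \<ge> e}
    \<le> 2 * exp (- 2 * e\<^sup>2 / real n)"
proof -
  note Wm = weight_measurable
  have dW: "distr M borel (\<lambda>\<omega>. f (W i \<omega>)) = distr \<mu> borel f" if "i \<ge> 1" for i
    using Wm[OF that] by (simp add: weights_distr[OF that, symmetric] distr_distr o_def)
  have AE\<mu>: "AE x in \<mu>. x \<in> {0<..1}" using range by (intro weight.AE_prob_1) auto
  interpret H: Hoeffding_ineq_iid M "{1..n}" "\<lambda>i \<omega>. f (W i \<omega>)" "\<lambda>\<omega>. f (W 1 \<omega>)" 0 1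
    "expectation (\<lambda>\<omega>. f (W 1 \<omega>))"
  proof (unfold_locales, goal_cases)
    case 2
    show ?case
      by (intro indep_vars_compose2[OF indep_vars_subset[OF weights_indep]]) auto
  next
    case (3 i)
    then show ?case using dW[of i] dW[of 1] by simp
  next
    case 4
    show ?case using Wm[of 1] by simp
  next
    case 5
    have "AE x in distr M borel (W 1). x \<in> {0<..1}" unfolding weights_distr[OF order_refl] by (rule AE\<mu>)
    then have "AE \<omega> in M. W 1 \<omega> \<in> {0<..1}" using Wm[of 1] by (subst (asm) AE_distr_iff) auto
    then show ?case by eventually_elim (use f01 in auto)
  qed auto
  have E: "expectation (\<lambda>\<omega>. f (W 1 \<omega>)) = (\<integral>x. f x \<partial>\<mu>)"
    using Wm[of 1] by (simp add: weights_distr[of 1, symmetric] integral_distr)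
  show ?thesis
  proof -
    have c: "card {1..n} = n" and ne: "{1..n} \<noteq> {}" using n by auto
    show ?thesis
      using H.Hoeffding_ineq_abs_ge[OF e zero_less_one ne] unfolding E c
      by (simp only: diff_zero power_one mult_1_right)
  qed
qed

lemma uniform_concentration:
  fixes f :: "real \<Rightarrow> real"
  assumes f: "f \<in> borel_measurable borel"
    and f01: "\<And>x. x \<in> {0<..1} \<Longrightarrow> 0 \<le> f x \<and> f x \<le> 1"
    and range: "measure \<mu> {0<..1} = 1" and K: "K \<ge> 1"
  obtains A where "A \<in> sets M" "prob A \<le> deviation_tail K / 3"
    "\<And>\<omega> n. \<omega> \<in> space M - A \<Longrightarrow> n \<ge> K \<Longrightarrow>
      \<bar>(\<Sum>i=1..n. f (W i \<omega>)) - real n * (\<integral>x. f x \<partial>\<mu>)\<bar> \<le> real n powr (3 / 4)"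
proof -
  define B where "B n = {\<omega> \<in> space M. \<bar>(\<Sum>i=1..n. f (W i \<omega>)) - real n * (\<integral>x. f x \<partial>\<mu>)\<bar> \<ge> real n powr (3 / 4)}" for n
  note Wm = weight_measurable
  have "(\<lambda>\<omega>. \<Sum>i=1..n. f (W i \<omega>)) \<in> borel_measurable M" for n
    using measurable_compose[OF Wm f] by (intro borel_measurable_sum) auto
  then have B: "B n \<in> sets M" for n unfolding B_def by measurable
  have le: "prob (B (n + K)) \<le> 2 * exp (- 2 * sqrt (real (n + K)))" for n
  proof -
    have pos: "real (n + K) > 0" using K by simp
    have "(real (n + K) powr (3 / 4))\<^sup>2 = real (n + K) powr (1 / 2) * real (n + K)"
    proof -
      have "(real (n + K) powr (3 / 4))\<^sup>2 = real (n + K) powr (1 / 2 + 1)"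
        unfolding power2_eq_square by (simp flip: powr_add)
      also have "\<dots> = real (n + K) powr (1 / 2) * real (n + K)"
        using pos by (subst powr_add) simp
      finally show ?thesis .
    qed
    then have "(real (n + K) powr (3 / 4))\<^sup>2 / real (n + K) = sqrt (real (n + K))"
      using pos by (simp add: powr_half_sqrt)
    then have "- 2 * (real (n + K) powr (3 / 4))\<^sup>2 / real (n + K) = - 2 * sqrt (real (n + K))"
      by (simp only: times_divide_eq_right[symmetric])
    moreover have "prob (B (n + K)) \<le> 2 * exp (- 2 * (real (n + K) powr (3 / 4))\<^sup>2 / real (n + K))"
      unfolding B_def using K by (intro sum_concentration[OF f f01 range]) auto
    ultimately show ?thesis by (simp only:)
  qed
  have sm: "summable (\<lambda>n. 2 * exp (- 2 * sqrt (real (n + K))))"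
    using summable_exp_sqrt by (subst summable_iff_shift)
  have sp: "summable (\<lambda>n. prob (B (n + K)))"
    using le by (intro summable_comparison_test'[OF sm, of 0]) auto
  have "prob (\<Union>n. B (n + K)) \<le> (\<Sum>n. prob (B (n + K)))"
    using B sp by (intro finite_measure_subadditive_countably) auto
  also have "\<dots> \<le> (\<Sum>n. 2 * exp (- 2 * sqrt (real (n + K))))"
    by (rule suminf_le[OF le sp sm])
  finally have "prob (\<Union>n. B (n + K)) \<le> deviation_tail K / 3"
    by (simp add: deviation_tail_def)
  moreover have "\<bar>(\<Sum>i=1..n. f (W i \<omega>)) - real n * (\<integral>x. f x \<partial>\<mu>)\<bar> \<le> real n powr (3 / 4)"
    if "\<omega> \<in> space M - (\<Union>n. B (n + K))" "n \<ge> K" for \<omega> n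
  proof -
    obtain j where "n = j + K" using \<open>n \<ge> K\<close> by (metis add.commute le_Suc_ex)
    then have "\<omega> \<notin> B n" using that by blast
    then show ?thesis using that by (simp add: B_def)
  qed
  ultimately show thesis using B that[of "\<Union>n. B (n + K)"] by blast
qed

text \<open>
  The bound on the exceptional event is uniform in \<open>s\<close>.  This matters because \<open>s\<close> will vary with the size of the tree,
  so that no single almost sure statement covers the vertices of weight in \<open>(s, 1)\<close>.
\<close>

lemma good_weights_event:
  assumes rates: "tail_rates (theta \<mu> - 1) (3 / 4) z g \<eta> K"
    and range: "measure \<mu> {0<..1} = 1" and s: "0 \<le> s"
  obtains A where "A \<in> sets M" "prob A \<le> deviation_tail K"
    "AE \<omega> in M. \<omega> \<notin> A \<longrightarrow> tail_rates.good_weights (theta \<mu> - 1) (3 / 4) K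
      (measure \<mu> {1}) s (measure \<mu> {s<..<1}) (\<lambda>i. W i \<omega>)"
proof -
  interpret R: tail_rates "theta \<mu> - 1" "3 / 4" z g \<eta> K by fact
  have K: "K \<ge> 1" by (rule R.K)
  let ?f2 = "\<lambda>x. indicator {1} x :: real" and ?f3 = "\<lambda>x. indicator {s<..<1} x :: real"
  obtain A1 where A1: "A1 \<in> sets M" "prob A1 \<le> deviation_tail K / 3"
    "\<And>\<omega> n. \<omega> \<in> space M - A1 \<Longrightarrow> n \<ge> K \<Longrightarrow>
      \<bar>(\<Sum>i=1..n. W i \<omega>) - real n * (\<integral>x. x \<partial>\<mu>)\<bar> \<le> real n powr (3 / 4)"
    by (rule uniform_concentration[of "\<lambda>x. x", OF _ _ range K]) auto
  obtain A2 where A2: "A2 \<in> sets M" "prob A2 \<le> deviation_tail K / 3"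
    "\<And>\<omega> n. \<omega> \<in> space M - A2 \<Longrightarrow> n \<ge> K \<Longrightarrow>
      \<bar>(\<Sum>i=1..n. ?f2 (W i \<omega>)) - real n * (\<integral>x. ?f2 x \<partial>\<mu>)\<bar> \<le> real n powr (3 / 4)"
    by (rule uniform_concentration[of ?f2, OF _ _ range K]) (auto simp: indicator_def)
  obtain A3 where A3: "A3 \<in> sets M" "prob A3 \<le> deviation_tail K / 3"
    "\<And>\<omega> n. \<omega> \<in> space M - A3 \<Longrightarrow> n \<ge> K \<Longrightarrow>
      \<bar>(\<Sum>i=1..n. ?f3 (W i \<omega>)) - real n * (\<integral>x. ?f3 x \<partial>\<mu>)\<bar> \<le> real n powr (3 / 4)"
    by (rule uniform_concentration[of ?f3, OF _ _ range K]) (auto simp: indicator_def)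
  have "AE \<omega> in M. W i \<omega> \<in> {0<..1}" if "i \<ge> 1" for i
  proof -
    note Wm = weight_measurable[OF that]
    have "AE x in \<mu>. x \<in> {0<..1}" using range by (intro weight.AE_prob_1) auto
    then have "AE x in distr M borel (W i). x \<in> {0<..1}" unfolding weights_distr[OF that] .
    then show ?thesis using Wm by (subst (asm) AE_distr_iff) auto
  qed
  then have AEW: "AE \<omega> in M. \<forall>i\<ge>1. W i \<omega> \<in> {0<..1}" by (simp add: AE_all_countable)
  define A where "A = A1 \<union> A2 \<union> A3"
  have "prob A \<le> prob (A1 \<union> A2) + prob A3"
    unfolding A_def using A1 A2 A3 by (intro measure_Un_le) auto
  also have "prob (A1 \<union> A2) \<le> prob A1 + prob A2"
    using A1 A2 by (intro measure_Un_le) auto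
  finally have "prob A \<le> deviation_tail K" using A1(2) A2(2) A3(2) by simp
  moreover have "A \<in> sets M" using A1 A2 A3 by (auto simp: A_def)
  moreover have "AE \<omega> in M. \<omega> \<notin> A \<longrightarrow> R.good_weights (measure \<mu> {1}) s (measure \<mu> {s<..<1}) (\<lambda>i. W i \<omega>)"
    using AEW AE_space
  proof eventually_elim
    case (elim \<omega>)
    have c: "real (card {i \<in> {1..n}. W i \<omega> \<in> S}) = (\<Sum>i=1..n. indicator S (W i \<omega>))" for n and S :: "real set"
      by (simp add: indicator_def sum.If_cases Int_def)
    show ?case
    proof
      assume nA: "\<omega> \<notin> A"
      show "R.good_weights (measure \<mu> {1}) s (measure \<mu> {s<..<1}) (\<lambda>i. W i \<omega>)"
        unfolding R.good_weights_def
      proof (intro conjI allI impI)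
        fix n assume n: "n \<ge> K"
        show "\<bar>(\<Sum>i=1..n. W i \<omega>) - (theta \<mu> - 1) * real n\<bar> \<le> real n powr (3 / 4)"
          using A1(3)[of \<omega> n] elim nA n by (simp add: A_def theta_def mult.commute)
        show "\<bar>real (card {i \<in> {1..n}. W i \<omega> = 1}) - measure \<mu> {1} * real n\<bar> \<le> real n powr (3 / 4)"
          using A2(3)[of \<omega> n] c[of n "{1}"] elim nA n by (simp add: A_def mult.commute)
        show "\<bar>real (card {i \<in> {1..n}. s < W i \<omega> \<and> W i \<omega> < 1}) - measure \<mu> {s<..<1} * real n\<bar> \<le> real n powr (3 / 4)"
          using A3(3)[of \<omega> n] c[of n "{s<..<1}"] elim nA n by (simp add: A_def mult.commute)
      qed (use elim in auto)
    qed
  qed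
  ultimately show thesis using that by blast
qed

lemma theta_gt_1:
  assumes range: "measure \<mu> {0<..1} = 1"
  shows "1 < theta \<mu>"
proof -
  have AE\<mu>: "AE x in \<mu>. x \<in> {0<..1}" using range by (intro weight.AE_prob_1) auto
  have int: "integrable \<mu> (\<lambda>x. x)"
    by (rule weight.integrable_const_bound[where B = 1]) (use AE\<mu> in auto)
  have AE0: "AE x in \<mu>. 0 \<le> x" using AE\<mu> by eventually_elim auto
  then have nn: "0 \<le> (\<integral>x. x \<partial>\<mu>)" by (rule integral_nonneg_AE)
  have "(\<integral>x. x \<partial>\<mu>) \<noteq> 0"
  proof
    assume "(\<integral>x. x \<partial>\<mu>) = 0"
    then have "AE x in \<mu>. x = 0"
      using integral_nonneg_eq_0_iff_AE[OF int AE0] by simp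
    then have "AE x in \<mu>. False" using AE\<mu> by eventually_elim auto
    then show False by simp
  qed
  then show ?thesis using nn by (simp add: theta_def)
qed

text \<open>
  The set in the definition of \<open>s_index\<close> is non-empty because \<open>P(W \<in> (x, 1))\<close> vanishes as \<open>x\<close> tends to 1, and the
  inequality defining it is inherited by its infimum because \<open>x \<mapsto> P(W \<in> (x, 1))\<close> is continuous from the right.
\<close>

lemma s_index_props:
  assumes range: "measure \<mu> {0<..1} = 1" and k: "k > 0"
  shows "0 \<le> s_index \<mu> k" "s_index \<mu> k < 1"
    "measure \<mu> {s_index \<mu> k<..<1} \<le> exp (- (1 - 1 / theta \<mu>) * (1 - s_index \<mu> k) * k)"
proof -
  define c where "c = 1 - 1 / theta \<mu>"
  have c: "c > 0" using theta_gt_1[OF range] by (simp add: c_def)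
  have sub: "{a<..<1} \<subseteq> {b<..<1}" if "b \<le> a" for a b :: real using that by auto
  define A where "A = {x \<in> {0<..<1}. measure \<mu> {x<..<1} \<le> exp (- c * (1 - x) * k)}"
  define s where "s = Inf A"
  have s_eq: "s_index \<mu> k = s" by (simp add: s_index_def s_def A_def c_def)
  have "(\<lambda>n. measure \<mu> {1 - 1 / real (n + 2)<..<1}) \<longlonglongrightarrow> measure \<mu> (\<Inter>n. {1 - 1 / real (n + 2)<..<1})"
  proof (rule weight.finite_Lim_measure_decseq)
    have "1 - 1 / real (m + 2) \<le> 1 - 1 / real (n + 2)" if "m \<le> n" for m n
      using that by (simp add: frac_le)
    then show "decseq (\<lambda>n. {1 - 1 / real (n + 2)<..<1})"
      unfolding decseq_def by (intro allI impI sub)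
  qed auto
  also have "(\<Inter>n. {1 - 1 / real (n + 2)<..<1}) = {}"
  proof -
    have "\<exists>n. \<not> 1 - 1 / real (n + 2) < x" if "x < 1" for x :: real
    proof -
      have "0 < 1 - x" using that by simp
      from reals_Archimedean[OF this] obtain n where n: "inverse (real (Suc n)) < 1 - x" by blast
      have "1 / real (n + 2) \<le> inverse (real (Suc n))" by (simp add: inverse_eq_divide frac_le)
      then show ?thesis using n by (intro exI[of _ n]) linarith
    qed
    then show ?thesis by force
  qed
  finally have "eventually (\<lambda>n. measure \<mu> {1 - 1 / real (n + 2)<..<1} < exp (- c * k)) sequentially"
    by (intro order_tendstoD) auto
  then obtain n where n: "measure \<mu> {1 - 1 / real (n + 2)<..<1} < exp (- c * k)"
    by (auto simp: eventually_sequentially)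
  have x1: "1 - 1 / real (n + 2) \<in> A"
  proof -
    have "c * (1 / real (n + 2)) * k \<le> c * 1 * k"
      using c k by (intro mult_left_mono mult_right_mono) auto
    then have "exp (- c * k) \<le> exp (- c * (1 - (1 - 1 / real (n + 2))) * k)" by simp
    then have "measure \<mu> {1 - 1 / real (n + 2)<..<1} \<le> exp (- c * (1 - (1 - 1 / real (n + 2))) * k)"
      using n by linarith
    moreover have "1 - 1 / real (n + 2) \<in> {0<..<1}" by simp
    ultimately show ?thesis unfolding A_def by (intro CollectI conjI)
  qed
  have bdd: "bdd_below A" by (rule bdd_belowI[of _ 0]) (auto simp: A_def)
  have ne: "A \<noteq> {}" using x1 by blast
  have s0: "s \<ge> 0" unfolding s_def by (rule cInf_greatest[OF ne]) (simp add: A_def)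
  have "s \<le> 1 - 1 / real (n + 2)" unfolding s_def using x1 bdd by (rule cInf_lower)
  then have s1: "s < 1" by (smt (verit) divide_pos_pos of_nat_0_less_iff add_2_eq_Suc' zero_less_Suc)
  show "0 \<le> s_index \<mu> k" "s_index \<mu> k < 1" using s0 s1 by (simp_all add: s_eq)
  have le: "measure \<mu> {s + 1 / real (Suc j)<..<1} \<le> exp (- c * (1 - (s + 1 / real (Suc j))) * k)" for j
  proof -
    obtain x where x: "x \<in> A" "x < s + 1 / real (Suc j)"
      using cInf_lessD[of A "s + 1 / real (Suc j)"] x1 by (auto simp: s_def)
    have "measure \<mu> {s + 1 / real (Suc j)<..<1} \<le> measure \<mu> {x<..<1}"
      using x by (intro weight.finite_measure_mono) auto
    also have "\<dots> \<le> exp (- c * (1 - x) * k)" using x by (simp add: A_def)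
    also have "\<dots> \<le> exp (- c * (1 - (s + 1 / real (Suc j))) * k)"
    proof -
      have "c * (1 - (s + 1 / real (Suc j))) * k \<le> c * (1 - x) * k"
        using c k x by (intro mult_left_mono mult_right_mono) auto
      then show ?thesis by simp
    qed
    finally show ?thesis .
  qed
  have "(\<lambda>j. measure \<mu> {s + 1 / real (Suc j)<..<1}) \<longlonglongrightarrow> measure \<mu> (\<Union>j. {s + 1 / real (Suc j)<..<1})"
  proof (rule weight.finite_Lim_measure_incseq)
    have "s + 1 / real (Suc n) \<le> s + 1 / real (Suc m)" if "m \<le> n" for m n
      using that by (simp add: frac_le)
    then show "incseq (\<lambda>j. {s + 1 / real (Suc j)<..<1})"
      unfolding incseq_def by (intro allI impI sub)
  qed auto
  moreover have "(\<Union>j. {s + 1 / real (Suc j)<..<1}) = {s<..<1}"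
  proof -
    have "\<exists>j. s + 1 / real (Suc j) < x" if "s < x" for x
    proof -
      have "0 < x - s" using that by simp
      from reals_Archimedean[OF this] obtain j where "inverse (real (Suc j)) < x - s" by blast
      then have "s + 1 / real (Suc j) < x" unfolding inverse_eq_divide by linarith
      then show ?thesis by blast
    qed
    moreover have "s < x" if "s + 1 / real (Suc j) < x" for x j
      using that by (smt (verit) divide_pos_pos of_nat_0_less_iff zero_less_Suc)
    ultimately show ?thesis by auto
  qed
  moreover have "(\<lambda>j. exp (- c * (1 - (s + 1 / real (Suc j))) * k)) \<longlonglongrightarrow> exp (- c * (1 - (s + 0)) * k)"
    by (intro tendsto_intros LIMSEQ_Suc[OF lim_1_over_n])
  ultimately show "measure \<mu> {s_index \<mu> k<..<1} \<le> exp (- (1 - 1 / theta \<mu>) * (1 - s_index \<mu> k) * k)"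
    unfolding s_eq c_def[symmetric] using le by (intro LIMSEQ_le[of _ _ "\<lambda>j. exp (- c * (1 - (s + 1 / real (Suc j))) * k)"]) auto
qed

end

text \<open>
  The room for \<open>z\<close> comes from the strict Bernoulli inequality \<open>\<theta>^(3/4) < 1 + 3/4 (\<theta> - 1)\<close>, which for \<open>t = \<theta>^(1/4)\<close>
  is the factorisation \<open>3 t^4 - 4 t^3 + 1 = (t - 1)\<^sup>2 (3 t\<^sup>2 + 2 t + 1)\<close>.
\<close>

lemma tail_rates_exist:
  fixes \<theta> :: real
  assumes \<theta>: "1 < \<theta>"
  obtains z g \<eta> K0 where "\<theta> powr (3 / 4) < z" "1 < z"
    "\<And>K. K \<ge> K0 \<Longrightarrow> tail_rates (\<theta> - 1) (3 / 4) z g \<eta> K"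
proof -
  define t where "t = \<theta> powr (1 / 4)"
  have t1: "t > 1" unfolding t_def using \<theta> by (intro gr_one_powr) auto
  have t3: "\<theta> powr (3 / 4) = t ^ 3" and t4: "\<theta> = t ^ 4"
    using \<theta> by (simp_all add: t_def flip: powr_numeral add: powr_powr)
  have "0 < (t - 1)\<^sup>2 * (3 * t\<^sup>2 + 2 * t + 1)"
    using t1 by (intro mult_pos_pos) (auto intro!: add_pos_pos)
  also have "\<dots> = 4 * (1 + 3 / 4 * (t ^ 4 - 1) - t ^ 3)"
    by (simp add: power2_eq_square power3_eq_cube power4_eq_xxxx algebra_simps)
  finally have bern: "\<theta> powr (3 / 4) < 1 + 3 / 4 * (\<theta> - 1)" unfolding t3 by (subst t4) (simp only: zero_less_mult_iff, simp)
  from dense[OF bern] obtain z where z: "\<theta> powr (3 / 4) < z" "z < 1 + 3 / 4 * (\<theta> - 1)" by blast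
  have "1 < \<theta> powr (3 / 4)" using \<theta> by (intro gr_one_powr) auto
  then have z1: "1 < z" using z by simp
  have zt: "z < \<theta>" using z(2) \<theta> by (simp add: field_simps)
  define v where "v = (z - 1) / (\<theta> - 1)"
  have v: "v < 3 / 4" "v > 0" using z(2) z1 \<theta> by (simp_all add: v_def field_simps)
  from dense[OF v(1)] obtain g where g: "v < g" "g < 3 / 4" by blast
  from dense[OF g(1)] obtain y where y: "v < y" "y < g" by blast
  define \<eta> where "\<eta> = g - y"
  have \<eta>: "\<eta> > 0" "v < g - \<eta>" using y by (auto simp: \<eta>_def)
  have lim: "(\<lambda>n. real n powr (3 / 4 - 1)) \<longlonglongrightarrow> 0" by real_asymp
  have "(\<lambda>n. 4 * real n powr (3 / 4 - 1)) \<longlonglongrightarrow> 4 * 0" by (intro tendsto_intros lim)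
  then have e1: "eventually (\<lambda>n. 4 * real n powr (3 / 4 - 1) < \<theta> - 1) sequentially"
    by (rule order_tendstoD(2)) (use \<theta> in simp)
  have "filterlim (\<lambda>n. (\<theta> - 1) * real n) at_top sequentially"
    using \<theta> by (intro filterlim_tendsto_pos_mult_at_top[OF tendsto_const _ filterlim_real_sequentially]) auto
  then have e2: "eventually (\<lambda>n. 2 \<le> (\<theta> - 1) * real n) sequentially"
    by (simp add: filterlim_at_top)
  have "(\<lambda>n. v * (1 + 4 / (\<theta> - 1) * real n powr (3 / 4 - 1))) \<longlonglongrightarrow> v * (1 + 4 / (\<theta> - 1) * 0)"
    by (intro tendsto_intros lim)
  then have e3: "eventually (\<lambda>n. v * (1 + 4 / (\<theta> - 1) * real n powr (3 / 4 - 1)) < g - \<eta>) sequentially"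
    by (rule order_tendstoD(2)) (use \<eta> in simp)
  have "(\<lambda>n. real n * ((1 + 1 / real n) powr (3 / 4) - 1)) \<longlonglongrightarrow> 3 / 4" by real_asymp
  then have e4: "eventually (\<lambda>n. g < real n * ((1 + 1 / real n) powr (3 / 4) - 1)) sequentially"
    by (rule order_tendstoD(1)) (use g in simp)
  obtain K1 where K1: "\<And>n. n \<ge> K1 \<Longrightarrow> 4 * real n powr (3 / 4 - 1) < \<theta> - 1 \<and> 2 \<le> (\<theta> - 1) * real n \<and>
      v * (1 + 4 / (\<theta> - 1) * real n powr (3 / 4 - 1)) < g - \<eta> \<and>
      g < real n * ((1 + 1 / real n) powr (3 / 4) - 1)"
    using eventually_conj[OF e1 eventually_conj[OF e2 eventually_conj[OF e3 e4]]]
    by (auto simp: eventually_sequentially)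
  have "tail_rates (\<theta> - 1) (3 / 4) z g \<eta> K" if K: "K \<ge> max 1 K1" for K
  proof
    fix n assume n: "n \<ge> K"
    then have n1: "real n > 0" and nK: "n \<ge> K1" using K by auto
    note facts = K1[OF nK]
    show "4 * real n powr (3 / 4 - 1) \<le> \<theta> - 1" "2 \<le> (\<theta> - 1) * real n"
      using facts by auto
    show "(z - 1) / (\<theta> - 1) * (1 + 4 / (\<theta> - 1) * real n powr (3 / 4 - 1)) \<le> g - \<eta>"
      using facts by (simp add: v_def)
    have "1 + g / real n \<le> (1 + 1 / real n) powr (3 / 4)"
      using facts n1 by (simp add: field_simps)
    then have "real n powr (3 / 4) * (1 + g / real n) \<le> real n powr (3 / 4) * (1 + 1 / real n) powr (3 / 4)"
      by (intro mult_left_mono) auto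
    also have "\<dots> = (real n * (1 + 1 / real n)) powr (3 / 4)"
      using n1 by (subst powr_mult) auto
    also have "real n * (1 + 1 / real n) = real (Suc n)" using n1 by (simp add: field_simps)
    finally show "real n powr (3 / 4) * (1 + g / real n) \<le> real (Suc n) powr (3 / 4)" .
  qed (use \<theta> z1 zt \<eta> K in auto)
  then show thesis using that z(1) z1 by blast
qed

section \<open>Asymptotic normality\<close>

text \<open>
  The central limit theorem for Poisson variables: the exponent is \<open>l (exp(iu) - 1 - iu)\<close> with \<open>u = t / \<surd>l\<close>, and the third-order
  Taylor remainder is of size \<open>1 / \<surd>l\<close>.
\<close>

lemma poisson_char_clt:
  fixes l :: "nat \<Rightarrow> real"
  assumes l: "filterlim l at_top sequentially"
  shows "(\<lambda>n. iexp (- (t * sqrt (l n))) * exp (of_real (l n) * (iexp (t / sqrt (l n)) - 1)))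
    \<longlonglongrightarrow> of_real (exp (- t\<^sup>2 / 2))"
proof -
  define x where "x n = of_real (l n) * (iexp (t / sqrt (l n)) - 1) - \<i> * of_real (t * sqrt (l n))" for n
  have "(\<lambda>n. x n - of_real (- t\<^sup>2 / 2)) \<longlonglongrightarrow> 0"
  proof (rule Lim_null_comparison)
    have "eventually (\<lambda>n. l n > 0) sequentially"
      using l by (simp add: filterlim_at_top_dense)
    then show "eventually (\<lambda>n. norm (x n - of_real (- t\<^sup>2 / 2)) \<le> \<bar>t\<bar> ^ 3 / 6 / sqrt (l n)) sequentially"
    proof eventually_elim
      case (elim n)
      define s where "s = sqrt (l n)"
      define u where "u = t / s"
      have s: "s > 0" "l n = s\<^sup>2" using elim by (auto simp: s_def)
      have tu: "t = u * s" using s by (simp add: u_def)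
      have sum: "(\<Sum>k\<le>2. (\<i> * of_real u) ^ k / fact k) = 1 + \<i> * of_real u - of_real (u\<^sup>2 / 2)"
        by (simp add: numeral_2_eq_2 power_mult_distrib field_simps)
      have "x n - of_real (- t\<^sup>2 / 2) =
          of_real (s\<^sup>2) * (iexp u - (1 + \<i> * of_real u - of_real (u\<^sup>2 / 2)))"
        unfolding x_def s_def[symmetric] unfolding u_def[symmetric] unfolding s(2) tu
        by (simp add: algebra_simps power2_eq_square)
      then have "norm (x n - of_real (- t\<^sup>2 / 2)) =
          s\<^sup>2 * norm (iexp u - (1 + \<i> * of_real u - of_real (u\<^sup>2 / 2)))"
        by (simp add: norm_mult norm_power)
      also have "\<dots> \<le> s\<^sup>2 * (\<bar>u\<bar> ^ 3 / 6)"
        using iexp_approx1[of u 2] unfolding sum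
        by (intro mult_left_mono) (simp_all add: eval_nat_numeral)
      also have "\<dots> = \<bar>t\<bar> ^ 3 / 6 / s"
        using s(1) unfolding tu by (simp add: abs_mult power2_eq_square power3_eq_cube)
      finally show ?case unfolding s_def .
    qed
    have "filterlim (\<lambda>n. sqrt (l n)) at_top sequentially"
      by (rule filterlim_compose[OF sqrt_at_top l])
    then show "(\<lambda>n. \<bar>t\<bar> ^ 3 / 6 / sqrt (l n)) \<longlonglongrightarrow> 0"
      by (rule real_tendsto_divide_at_top[OF tendsto_const])
  qed
  then have "x \<longlonglongrightarrow> of_real (- t\<^sup>2 / 2)" by (rule LIM_zero_cancel)
  then have "(\<lambda>n. exp (x n)) \<longlonglongrightarrow> exp (of_real (- t\<^sup>2 / 2))" by (rule tendsto_exp)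
  moreover have "exp (x n) = iexp (- (t * sqrt (l n))) * exp (of_real (l n) * (iexp (t / sqrt (l n)) - 1))" for n
    unfolding x_def by (simp add: exp_add[symmetric] exp_diff exp_minus field_simps)
  moreover have "exp (of_real (- t\<^sup>2 / 2)) = complex_of_real (exp (- t\<^sup>2 / 2))" by (rule exp_of_real)
  ultimately show ?thesis by (simp only:)
qed

context weighted_recursive_tree begin

text \<open>
  For good weights the quenched estimate applies; on the exceptional event both characteristic functions have
  norm at most 1, which costs twice its probability.
\<close>

lemma annealed_char:
  fixes u s z g \<eta> :: real and K n m :: nat
  defines "r \<equiv> measure \<mu> {s<..<1}"
    and "l \<equiv> measure \<mu> {1} * (1 - 1 / theta \<mu>) * real n * (1 / theta \<mu>) ^ m"
    and "E \<equiv> tail_rates.error_const (theta \<mu> - 1) z \<eta> K"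
  defines "e \<equiv> 4 * (E * (1 / z) ^ m * real n powr (3 / 4))
      + real n * (1 / theta \<mu>) ^ m * (r + exp (- (1 - 1 / theta \<mu>) * (1 - s) * real m))"
  assumes range: "measure \<mu> {0<..1} = 1"
    and rates: "tail_rates (theta \<mu> - 1) (3 / 4) z g \<eta> K"
    and s: "0 \<le> s" "s < 1" and n: "n \<ge> K" and m: "m \<ge> 2"
  shows "norm ((\<integral>\<omega>. iexp (u * real (card {j \<in> {1..n}. load {2..n} (parents n \<omega>) j = m})) \<partial>M)
      - exp (of_real l * (iexp u - 1)))
    \<le> \<bar>u\<bar> * exp (l * u\<^sup>2 / 2) * ((l + e)
        * ((4 * real m + 2) * (E * (1 / z) ^ (m - 1) * real n powr (3 / 4))) + e)
      + 2 * deviation_tail K"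
proof -
  interpret R: tail_rates "theta \<mu> - 1" "3 / 4" z g \<eta> K by fact
  define F :: "(nat \<Rightarrow> nat) \<Rightarrow> complex"
    where "F c = iexp (u * real (card {j \<in> {1..n}. load {2..n} c j = m}))" for c
  let ?\<psi> = "\<lambda>\<omega>. quenched_expectation n F (\<lambda>i. W i \<omega>)"
  let ?z0 = "exp (of_real l * (iexp u - 1))"
  let ?B = "\<bar>u\<bar> * exp (l * u\<^sup>2 / 2) * ((l + e)
        * ((4 * real m + 2) * (E * (1 / z) ^ (m - 1) * real n powr (3 / 4))) + e)"
  have n1: "n \<ge> 1" using n R.K by simp
  have th: "1 + (theta \<mu> - 1) = theta \<mu>" by simp
  have q0: "0 \<le> measure \<mu> {1}" "measure \<mu> {1} \<le> 1" and r: "0 \<le> r" "r \<le> 1"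
    by (auto simp: r_def)
  have l0: "0 \<le> l" using theta_gt_1[OF range] q0 by (simp add: l_def)
  have E1: "1 \<le> E" unfolding E_def by (rule R.error_const_ge(1))
  have e0: "0 \<le> e" using E1 r theta_gt_1[OF range] R.z by (simp add: e_def)
  have B0: "0 \<le> ?B" using l0 e0 E1 R.z by simp
  have e_eq: "R.mean_error s r m n = e"
    unfolding R.mean_error_def e_def E_def th ..
  obtain A where A: "A \<in> sets M" "prob A \<le> deviation_tail K"
    "AE \<omega> in M. \<omega> \<notin> A \<longrightarrow> R.good_weights (measure \<mu> {1}) s r (\<lambda>i. W i \<omega>)"
    unfolding r_def by (rule good_weights_event[OF rates range s(1)])
  have AE: "AE \<omega> in M. norm (?\<psi> \<omega> - ?z0) \<le> ?B + 2 * indicator A \<omega>"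
    using A(3) AE_weight_pos
  proof eventually_elim
    case (elim \<omega>)
    have pos: "W i \<omega> > 0" if "i \<ge> 1" for i using elim that by blast
    show ?case
    proof (cases "\<omega> \<in> A")
      case True
      have "norm (?\<psi> \<omega> - ?z0) \<le> norm (?\<psi> \<omega>) + norm ?z0" by (rule norm_triangle_ineq4)
      also have "norm (?\<psi> \<omega>) \<le> 1"
        by (rule norm_quenched_expectation_le) (auto simp: pos F_def)
      also have "norm ?z0 \<le> 1" by (rule norm_exp_poisson_le(2)[OF l0])
      finally show ?thesis using True B0 by simp
    next
      case False
      then have good: "R.good_weights (measure \<mu> {1}) s r (\<lambda>i. W i \<omega>)" using elim by blast
      have qe: "?\<psi> \<omega> = measure_pmf.expectation (Pi_pmf {2..n} 0 (parent_pmf (\<lambda>i. W i \<omega>))) F"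
        by (rule quenched_expectation_eq) (rule pos)
      have "norm (?\<psi> \<omega> - ?z0) \<le> ?B"
        using R.quenched_char[OF good q0 s r n m, of u]
        unfolding qe unfolding F_def[abs_def] e_eq th l_def E_def .
      then show ?thesis using False by simp
    qed
  qed
  note X = expectation_parents[OF n1, of F]
  have iA: "integrable M (indicator A :: 'a \<Rightarrow> real)"
    using A(1) by (auto intro: integrable_const_bound[where B = 1])
  have ind: "integrable M (\<lambda>\<omega>. b + 2 * indicator A \<omega>)" for b :: real
    using iA by (intro Bochner_Integration.integrable_add integrable_mult_right) simp_all
  have "norm ((\<integral>\<omega>. F (parents n \<omega>) \<partial>M) - ?z0) = norm (\<integral>\<omega>. ?\<psi> \<omega> - ?z0 \<partial>M)"
    unfolding X(1) using X(2) by (subst Bochner_Integration.integral_diff) (auto simp: prob_space)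
  also have "\<dots> \<le> (\<integral>\<omega>. norm (?\<psi> \<omega> - ?z0) \<partial>M)" by (rule integral_norm_bound)
  also have "\<dots> \<le> (\<integral>\<omega>. ?B + 2 * indicator A \<omega> \<partial>M)"
    using X(2) AE by (intro integral_mono_AE ind integrable_norm Bochner_Integration.integrable_diff) simp_all
  also have "\<dots> = ?B + 2 * prob A"
    using A(1) iA by (subst Bochner_Integration.integral_add) (auto simp: prob_space)
  also have "\<dots> \<le> ?B + 2 * deviation_tail K" using A(2) by simp
  finally show ?thesis unfolding F_def .
qed

end

text \<open>
  With \<open>a = - i n\<close> the parameter \<open>l\<close> is of order \<open>\<theta> powr a\<close>, and the assumption on \<open>i\<close> says that \<open>a\<close> is negligible
  compared with \<open>ln n\<close> and with \<open>\<kappa>\<close>.  Hence \<open>(1/z)^m * n powr (3/4) = n powr (3/4 - log \<theta> z + o(1))\<close> is a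
  negative power of \<open>n\<close> because \<open>z > \<theta> powr (3/4)\<close>, and \<open>exp (- \<kappa> / 2)\<close> beats \<open>\<surd>l\<close>.
\<close>

lemma degree_scale_asymptotics:
  fixes \<theta> z q0 :: real and i :: "nat \<Rightarrow> int" and \<kappa> :: "nat \<Rightarrow> real"
  defines "k \<equiv> \<lambda>n. log \<theta> (real n)"
  defines "m \<equiv> \<lambda>n. nat (\<lfloor>k n\<rfloor> + i n)"
  defines "l \<equiv> \<lambda>n. q0 * (1 - 1 / \<theta>) * real n * (1 / \<theta>) ^ m n"
  assumes \<theta>: "1 < \<theta>" and z: "\<theta> powr (3 / 4) < z" "1 < z" and q0: "0 < q0" "q0 \<le> 1"
    and i_lim: "filterlim i at_bot sequentially"
    and \<kappa>: "\<And>n. 0 \<le> \<kappa> n"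
    and i_small: "(\<lambda>n. real_of_int (i n)) \<in> o(\<lambda>n. min (ln (real n)) (\<kappa> n))"
  shows "eventually (\<lambda>n. \<lfloor>k n\<rfloor> + i n = int (m n) \<and> m n \<ge> 2 \<and> k n / 2 \<le> real (m n) \<and> 0 < k n) sequentially"
    and "eventually (\<lambda>n. l n = q0 * (1 - 1 / \<theta>) * \<theta> powr (- real_of_int (i n) + (k n - of_int \<lfloor>k n\<rfloor>))) sequentially"
    and "filterlim l at_top sequentially"
    and "(\<lambda>n. sqrt (l n) * (4 * real (m n) + 2) * ((1 / z) ^ m n * real n powr (3 / 4))) \<longlonglongrightarrow> 0"
    and "(\<lambda>n. sqrt (l n) * exp (- \<kappa> n / 2)) \<longlonglongrightarrow> 0"
proof -
  define a where "a n = - real_of_int (i n)" for n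
  define d where "d = ln \<theta>"
  have d: "d > 0" using \<theta> by (simp add: d_def)
  have k_ln: "k n = ln (real n) / d" for n by (simp add: k_def log_def d_def)
  have a_lim: "filterlim a at_top sequentially"
  proof -
    have "filterlim (\<lambda>n. real_of_int (i n)) at_bot sequentially"
      using i_lim by (rule filterlim_compose[OF filterlim_real_of_int_at_bot, rotated]) 
    then show ?thesis unfolding a_def by (simp add: filterlim_uminus_at_top)
  qed
  have a_small: "eventually (\<lambda>n. 1 \<le> a n \<and> a n \<le> c * ln (real n) \<and> a n \<le> c * \<kappa> n) sequentially"
    if c: "c > 0" for c
  proof -
    have "eventually (\<lambda>n. 1 \<le> a n) sequentially" using a_lim by (simp add: filterlim_at_top)
    moreover have "eventually (\<lambda>n. norm (real_of_int (i n)) \<le> c * norm (min (ln (real n)) (\<kappa> n))) sequentially"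
      using i_small c by (rule landau_o.smallD)
    moreover have "eventually (\<lambda>n. n \<ge> 1) sequentially" by (rule eventually_ge_at_top)
    ultimately show ?thesis
    proof eventually_elim
      case (elim n)
      have "0 \<le> min (ln (real n)) (\<kappa> n)" using elim(3) \<kappa>[of n] by simp
      then have "a n \<le> c * min (ln (real n)) (\<kappa> n)" using elim(2) by (simp add: a_def)
      moreover have "c * min (ln (real n)) (\<kappa> n) \<le> c * ln (real n)" "c * min (ln (real n)) (\<kappa> n) \<le> c * \<kappa> n"
        using c by (intro mult_left_mono; simp)+
      ultimately show ?case using elim(1) by linarith
    qed
  qed
  have L_lim: "filterlim (\<lambda>n. ln (real n)) at_top sequentially" by real_asymp
  have c1: "1 / (4 * d) > 0" "1 / (6 * d) > 0" using d by simp_all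
  have k4: "eventually (\<lambda>n. 4 \<le> k n) sequentially"
  proof -
    have "eventually (\<lambda>n. 4 * d \<le> ln (real n)) sequentially" using L_lim by (simp add: filterlim_at_top)
    then show ?thesis by eventually_elim (use d in \<open>simp add: k_ln field_simps\<close>)
  qed
  have m_ev: "eventually (\<lambda>n. \<lfloor>k n\<rfloor> + i n = int (m n) \<and> m n \<ge> 2 \<and> k n / 2 \<le> real (m n) \<and> 0 < k n
      \<and> k n - 1 - a n \<le> real (m n) \<and> real (m n) \<le> k n) sequentially"
    using a_small[OF c1(1)] k4
  proof eventually_elim
    case (elim n)
    have "a n \<le> k n / 4" using elim d by (simp add: k_ln)
    then have 1: "real_of_int (\<lfloor>k n\<rfloor> + i n) \<ge> k n / 2" "real_of_int (\<lfloor>k n\<rfloor> + i n) \<ge> k n - 1 - a n"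
      using elim by (simp_all add: a_def) linarith+
    have "real_of_int 1 < real_of_int (\<lfloor>k n\<rfloor> + i n)" using 1 elim by linarith
    then have 2: "2 \<le> \<lfloor>k n\<rfloor> + i n" by linarith
    then have 3: "\<lfloor>k n\<rfloor> + i n = int (m n)" by (simp add: m_def)
    then have 4: "real (m n) = real_of_int (\<lfloor>k n\<rfloor> + i n)" by simp
    have "real_of_int (\<lfloor>k n\<rfloor> + i n) \<le> k n" using elim by (simp add: a_def) linarith
    then show ?case using 1 2 3 elim unfolding 4 by linarith
  qed
  then show "eventually (\<lambda>n. \<lfloor>k n\<rfloor> + i n = int (m n) \<and> m n \<ge> 2 \<and> k n / 2 \<le> real (m n) \<and> 0 < k n) sequentially"
    by eventually_elim blast
  have l_eq: "eventually (\<lambda>n. l n = q0 * (1 - 1 / \<theta>) * \<theta> powr (- real_of_int (i n) + (k n - of_int \<lfloor>k n\<rfloor>))) sequentially"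
    using m_ev eventually_ge_at_top[of 1]
  proof eventually_elim
    case (elim n)
    have m: "real (m n) = real_of_int \<lfloor>k n\<rfloor> + real_of_int (i n)" using elim by linarith
    have "real n * (1 / \<theta>) ^ m n = \<theta> powr k n * \<theta> powr (- real (m n))"
      using elim \<theta> by (simp add: k_def powr_minus powr_realpow power_one_over inverse_eq_divide)
    also have "\<dots> = \<theta> powr (- real_of_int (i n) + (k n - of_int \<lfloor>k n\<rfloor>))"
      unfolding powr_add[symmetric] m by (rule arg_cong) simp
    finally show ?case unfolding l_def by simp
  qed
  then show "eventually (\<lambda>n. l n = q0 * (1 - 1 / \<theta>) * \<theta> powr (- real_of_int (i n) + (k n - of_int \<lfloor>k n\<rfloor>))) sequentially" .
  define c0 where "c0 = q0 * (1 - 1 / \<theta>)"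
  have c0: "0 < c0" "c0 \<le> 1"
  proof -
    show "0 < c0" using q0 \<theta> by (simp add: c0_def)
    show "c0 \<le> 1" unfolding c0_def using q0 \<theta> by (intro mult_le_one) auto
  qed
  have l_bounds: "eventually (\<lambda>n. c0 * exp (d * a n) \<le> l n \<and> sqrt (l n) \<le> exp (d * (1 + a n))) sequentially"
    using l_eq a_small[OF zero_less_one]
  proof eventually_elim
    case (elim n)
    define f where "f = k n - of_int \<lfloor>k n\<rfloor>"
    have f: "0 \<le> f" "f \<le> 1" unfolding f_def by linarith+
    have "\<theta> powr (- real_of_int (i n) + f) = exp (d * (a n + f))"
      using \<theta> by (simp add: powr_def d_def a_def mult.commute)
    then have l: "l n = c0 * exp (d * (a n + f))" using elim by (simp add: c0_def f_def)
    have "exp (d * a n) \<le> exp (d * (a n + f))" using d f by simp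
    then have lower: "c0 * exp (d * a n) \<le> l n" unfolding l using c0 by (intro mult_left_mono) auto
    have "l n \<le> 1 * exp (d * (1 + a n))"
      unfolding l using c0 d f by (intro mult_mono) auto
    also have "\<dots> \<le> (exp (d * (1 + a n)))\<^sup>2"
      using d elim by (auto simp: power2_eq_square)
    finally have "sqrt (l n) \<le> exp (d * (1 + a n))" by (simp add: real_le_lsqrt)
    then show ?case using lower by blast
  qed
  have da: "filterlim (\<lambda>n. d * a n) at_top sequentially"
    using d a_lim by (intro filterlim_tendsto_pos_mult_at_top[OF tendsto_const]) auto
  show "filterlim l at_top sequentially"
  proof (rule filterlim_at_top_mono)
    show "filterlim (\<lambda>n. c0 * exp (d * a n)) at_top sequentially"
      using c0 by (intro filterlim_tendsto_pos_mult_at_top[OF tendsto_const] filterlim_compose[OF exp_at_top da]) auto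
    show "eventually (\<lambda>n. c0 * exp (d * a n) \<le> l n) sequentially"
      using l_bounds by eventually_elim blast
  qed
  have l0: "0 \<le> l n" for n using q0 \<theta> by (simp add: l_def)
  show "(\<lambda>n. sqrt (l n) * exp (- \<kappa> n / 2)) \<longlonglongrightarrow> 0"
  proof (rule Lim_null_comparison)
    show "eventually (\<lambda>n. norm (sqrt (l n) * exp (- \<kappa> n / 2)) \<le> exp (- (d * a n))) sequentially"
      using l_bounds a_small[OF c1(2)]
    proof eventually_elim
      case (elim n)
      have "d * (6 * a n) \<le> \<kappa> n" using elim d by (simp add: field_simps)
      moreover have "d * (1 + a n) \<le> d * (2 * a n)" using elim d by (intro mult_left_mono) auto
      ultimately have "d * (1 + a n) + - \<kappa> n / 2 \<le> - (d * a n)" by simp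
      then have le: "exp (d * (1 + a n)) * exp (- \<kappa> n / 2) \<le> exp (- (d * a n))"
        by (simp only: exp_add[symmetric] exp_le_cancel_iff)
      have "sqrt (l n) * exp (- \<kappa> n / 2) \<le> exp (d * (1 + a n)) * exp (- \<kappa> n / 2)"
        using elim by (intro mult_right_mono) auto
      from order_trans[OF this le] show ?case using l0[of n] by simp
    qed
    show "(\<lambda>n. exp (- (d * a n))) \<longlonglongrightarrow> 0"
      using da by (intro filterlim_compose[OF exp_at_bot]) (simp add: filterlim_uminus_at_top)
  qed
  define c where "c = ln z / d - 3 / 4"
  have c: "c > 0"
  proof -
    have "ln (\<theta> powr (3 / 4)) < ln z" using z \<theta> by (subst ln_less_cancel_iff) auto
    then have "3 / 4 * d < ln z" using \<theta> by (simp add: ln_powr d_def)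
    then show ?thesis using d by (simp add: c_def field_simps)
  qed
  define b where "b = ln z + d"
  have lnz: "ln z > 0" using z by simp
  have b: "b > 0" using lnz d by (simp add: b_def)
  have cb: "c / (4 * b) > 0" using b c by simp
  show "(\<lambda>n. sqrt (l n) * (4 * real (m n) + 2) * ((1 / z) ^ m n * real n powr (3 / 4))) \<longlonglongrightarrow> 0"
  proof (rule Lim_null_comparison)
    show "eventually (\<lambda>n. norm (sqrt (l n) * (4 * real (m n) + 2) * ((1 / z) ^ m n * real n powr (3 / 4)))
        \<le> exp (- (c / 2) * ln (real n)) * (4 * (ln (real n) / d) + 2)) sequentially"
      using l_bounds a_small[OF cb] m_ev eventually_ge_at_top[of 1]
    proof eventually_elim
      case (elim n)
      let ?L = "ln (real n)"
      have zm: "(1 / z) ^ m n = exp (- (real (m n) * ln z))"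
        using z by (simp add: exp_minus exp_of_nat_mult power_one_over inverse_eq_divide)
      have np: "real n powr (3 / 4) = exp (3 / 4 * ?L)" using elim by (simp add: powr_def)
      have zn: "(1 / z) ^ m n * real n powr (3 / 4) = exp (- (real (m n) * ln z) + 3 / 4 * ?L)"
        unfolding zm np by (rule exp_add[symmetric])
      have "(k n - 1 - a n) * ln z \<le> real (m n) * ln z" using elim lnz by (intro mult_right_mono) auto
      moreover have "k n * ln z = (c + 3 / 4) * ?L" by (simp add: k_ln c_def)
      ultimately have 1: "- (real (m n) * ln z) + 3 / 4 * ?L \<le> - c * ?L + (1 + a n) * ln z"
        by (simp add: algebra_simps)
      have "(1 + a n) * b \<le> (2 * a n) * b" using elim b by (intro mult_right_mono) auto
      also have "\<dots> \<le> c / 2 * ?L" using elim b by (simp add: field_simps)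
      finally have 2: "(1 + a n) * ln z + d * (1 + a n) \<le> c / 2 * ?L" by (simp add: b_def algebra_simps)
      have "sqrt (l n) * ((1 / z) ^ m n * real n powr (3 / 4))
          \<le> exp (d * (1 + a n)) * exp (- (real (m n) * ln z) + 3 / 4 * ?L)"
        unfolding zn using elim by (intro mult_right_mono) auto
      also have "\<dots> = exp (d * (1 + a n) + (- (real (m n) * ln z) + 3 / 4 * ?L))"
        by (rule exp_add[symmetric])
      also have "\<dots> \<le> exp (- (c / 2) * ?L)"
        unfolding exp_le_cancel_iff using 1 2 by (simp add: algebra_simps)
      finally have 3: "sqrt (l n) * ((1 / z) ^ m n * real n powr (3 / 4)) \<le> exp (- (c / 2) * ?L)" .
      have "sqrt (l n) * ((1 / z) ^ m n * real n powr (3 / 4)) * (4 * real (m n) + 2)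
          \<le> exp (- (c / 2) * ?L) * (4 * (?L / d) + 2)"
        using 3 elim k_ln[of n] by (intro mult_mono) auto
      moreover have "0 \<le> sqrt (l n) * (4 * real (m n) + 2) * ((1 / z) ^ m n * real n powr (3 / 4))"
        using l0[of n] z by simp
      ultimately show ?case by (simp add: mult_ac)
    qed
    show "(\<lambda>n. exp (- (c / 2) * ln (real n)) * (4 * (ln (real n) / d) + 2)) \<longlonglongrightarrow> 0"
      using c d by real_asymp
  qed
qed

theorem theorem2p9:
  fixes M :: "'a measure" and \<mu> :: "real measure"
    and W :: "nat \<Rightarrow> 'a \<Rightarrow> real" and parent :: "nat \<Rightarrow> 'a \<Rightarrow> nat"
    and C \<rho> x\<^sub>1 q\<^sub>0 :: real and i :: "nat \<Rightarrow> int"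
  assumes wrt: "weighted_recursive_tree M \<mu> W parent"
    and range: "measure \<mu> {0<..1} = 1"
    and sup_supp: "Sup {x. measure \<mu> {..x} < 1} = 1"
    and near_0: "C > 0" "\<rho> > 0" "x\<^sub>1 \<in> {0<..<1}"
      "\<And>x. x \<in> {0..x\<^sub>1} \<Longrightarrow> measure \<mu> {..x} \<le> C * x powr \<rho>"
    and atom: "q\<^sub>0 \<in> {0<..1}" "measure \<mu> {1} = q\<^sub>0"
    and i_lim: "filterlim i at_bot sequentially"
    and i_small: "(\<lambda>n. real_of_int (i n)) \<in>
      o(\<lambda>n. min (ln (real n)) \<bar>ln (r_index \<mu> (log (theta \<mu>) (real n)))\<bar>)"
  shows "weak_conv_m
    (\<lambda>n. distr M borel
      (\<lambda>\<omega>. (real (degree_count \<mu> parent n (i n) \<omega>)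
              - q\<^sub>0 * (1 - 1 / theta \<mu>) * theta \<mu> powr (- real_of_int (i n) + eps \<mu> n))
            / sqrt (q\<^sub>0 * (1 - 1 / theta \<mu>) * theta \<mu> powr (- real_of_int (i n) + eps \<mu> n))))
    std_normal_distribution"
proof -
  interpret weighted_recursive_tree M \<mu> W parent by fact
  define \<theta> where "\<theta> = theta \<mu>"
  define c where "c = 1 - 1 / \<theta>"
  define k where "k n = log \<theta> (real n)" for n
  define m where "m n = nat (\<lfloor>k n\<rfloor> + i n)" for n
  define l where "l n = q\<^sub>0 * (1 - 1 / \<theta>) * real n * (1 / \<theta>) ^ m n" for n
  define \<kappa> where "\<kappa> n = \<bar>ln (r_index \<mu> (k n))\<bar>" for n
  define s where "s n = s_index \<mu> (k n)" for n
  define X where "X n \<omega> = real (degree_count \<mu> parent n (i n) \<omega>)" for n \<omega>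
  define \<Lambda> where "\<Lambda> n = q\<^sub>0 * (1 - 1 / \<theta>) * \<theta> powr (- real_of_int (i n) + eps \<mu> n)" for n
  have \<theta>: "1 < \<theta>" unfolding \<theta>_def by (rule theta_gt_1[OF range])
  have q0: "0 < q\<^sub>0" "q\<^sub>0 \<le> 1" using atom by auto
  have c: "0 < c" using \<theta> by (simp add: c_def)
  obtain z g \<eta> K0 where z: "\<theta> powr (3 / 4) < z" "1 < z"
    and rates: "\<And>K. K \<ge> K0 \<Longrightarrow> tail_rates (\<theta> - 1) (3 / 4) z g \<eta> K"
    using tail_rates_exist[OF \<theta>] by metis
  have \<kappa>0: "0 \<le> \<kappa> n" for n by (simp add: \<kappa>_def)
  have small: "(\<lambda>n. real_of_int (i n)) \<in> o(\<lambda>n. min (ln (real n)) (\<kappa> n))"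
    unfolding \<kappa>_def k_def \<theta>_def by (rule i_small)
  note asym = degree_scale_asymptotics[OF \<theta> z q0 i_lim \<kappa>0 small,
      folded k_def, folded m_def, folded l_def]
  have \<Lambda>_eq: "eventually (\<lambda>n. \<Lambda> n = l n) sequentially"
    using asym(2) by eventually_elim (simp add: \<Lambda>_def eps_def k_def \<theta>_def)
  show ?thesis
    unfolding \<theta>_def[symmetric] \<Lambda>_def[symmetric] X_def[symmetric]
  proof (rule levy_continuity)
    have Y: "(\<lambda>\<omega>. (X n \<omega> - \<Lambda> n) / sqrt (\<Lambda> n)) \<in> borel_measurable M" for n
      unfolding X_def by measurable
    show "real_distribution (distr M borel (\<lambda>\<omega>. (X n \<omega> - \<Lambda> n) / sqrt (\<Lambda> n)))" for n
      using Y by (intro real_distribution_distr)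
    show "real_distribution std_normal_distribution" by (rule real_dist_normal_dist)
    fix t :: real
    define \<phi> where "\<phi> n = (\<integral>\<omega>. iexp (t / sqrt (l n) * X n \<omega>) \<partial>M)" for n
    define \<psi> where "\<psi> n = exp (of_real (l n) * (iexp (t / sqrt (l n)) - 1))" for n
    have char_eq: "eventually (\<lambda>n. char (distr M borel (\<lambda>\<omega>. (X n \<omega> - \<Lambda> n) / sqrt (\<Lambda> n))) t
        = iexp (- (t * sqrt (l n))) * \<phi> n) sequentially"
      using \<Lambda>_eq asym(3)[unfolded filterlim_at_top_dense, rule_format, of 0]
    proof eventually_elim
      case (elim n)
      have "char (distr M borel (\<lambda>\<omega>. (X n \<omega> - \<Lambda> n) / sqrt (\<Lambda> n))) t
          = (\<integral>\<omega>. iexp (t * ((X n \<omega> - \<Lambda> n) / sqrt (\<Lambda> n))) \<partial>M)"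
        unfolding char_def using Y by (subst integral_distr) auto
      also have "\<dots> = (\<integral>\<omega>. iexp (- (t * sqrt (l n))) * iexp (t / sqrt (l n) * X n \<omega>) \<partial>M)"
      proof (intro Bochner_Integration.integral_cong refl)
        fix \<omega>
        have "t * ((X n \<omega> - \<Lambda> n) / sqrt (\<Lambda> n)) = - (t * sqrt (l n)) + t / sqrt (l n) * X n \<omega>"
          unfolding elim(1) using elim(2) by (simp add: diff_divide_distrib real_div_sqrt algebra_simps)
        then show "iexp (t * ((X n \<omega> - \<Lambda> n) / sqrt (\<Lambda> n)))
            = iexp (- (t * sqrt (l n))) * iexp (t / sqrt (l n) * X n \<omega>)"
          by (simp only: of_real_add distrib_left exp_add)
      qed
      also have "\<dots> = iexp (- (t * sqrt (l n))) * \<phi> n" unfolding \<phi>_def by (rule integral_mult_right_zero)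
      finally show ?case .
    qed
    have dist: "(\<lambda>n. norm (\<phi> n - \<psi> n)) \<longlonglongrightarrow> 0"
    proof (rule LIMSEQ_I)
      fix \<epsilon> :: real assume \<epsilon>: "0 < \<epsilon>"
      have "eventually (\<lambda>K. 2 * deviation_tail K < \<epsilon> / 2) sequentially"
      proof (rule order_tendstoD(2))
        show "(\<lambda>K. 2 * deviation_tail K) \<longlonglongrightarrow> 2 * 0"
          by (intro tendsto_intros deviation_tail_tendsto_0)
      qed (use \<epsilon> in simp)
      from eventually_conj[OF this eventually_ge_at_top[of K0]]
      obtain K where K: "2 * deviation_tail K < \<epsilon> / 2" "K \<ge> K0"
        by (auto simp: eventually_sequentially)
      note R = rates[OF K(2)]
      interpret R: tail_rates "\<theta> - 1" "3 / 4" z g \<eta> K by (rule R)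
      define E where "E = R.error_const"
      have E: "E \<ge> 1" unfolding E_def by (rule R.error_const_ge(1))
      \<comment> \<open>All error terms are expressed through the null sequences \<open>A\<close> and \<open>B\<close>: the former contains the comparison bounds, the latter the vertices of weight below 1.\<close>
      define A where "A n = sqrt (l n) * (4 * real (m n) + 2) * ((1 / z) ^ m n * real n powr (3 / 4))" for n
      define B where "B n = sqrt (l n) * exp (- \<kappa> n / 2)" for n
      define Z where "Z n = 4 * E * A n + 2 / (q\<^sub>0 * c) * B n" for n
      define bd where "bd n = \<bar>t\<bar> * exp (t\<^sup>2 / 2) * (E * z * A n + Z n * (E * z * A n) + Z n)" for n
      have AB: "A \<longlonglongrightarrow> 0" "B \<longlonglongrightarrow> 0"
        using asym(4,5) unfolding A_def[abs_def] B_def[abs_def] by blast+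
      have "Z \<longlonglongrightarrow> 4 * E * 0 + 2 / (q\<^sub>0 * c) * 0"
        unfolding Z_def[abs_def] by (intro tendsto_intros AB)
      then have Z: "Z \<longlonglongrightarrow> 0" by simp
      have "bd \<longlonglongrightarrow> \<bar>t\<bar> * exp (t\<^sup>2 / 2) * (E * z * 0 + 0 * (E * z * 0) + 0)"
        unfolding bd_def[abs_def] by (intro tendsto_intros AB Z)
      then have "eventually (\<lambda>n. bd n < \<epsilon> / 2) sequentially"
        using \<epsilon> by (intro order_tendstoD(2)) auto
      moreover have "eventually (\<lambda>n. norm (\<phi> n - \<psi> n) \<le> bd n + 2 * deviation_tail K) sequentially"
        using asym(1) asym(3)[unfolded filterlim_at_top, rule_format, of 1] eventually_ge_at_top[of K]
      proof eventually_elim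
        case (elim n)
        have mn: "\<lfloor>k n\<rfloor> + i n = int (m n)" "m n \<ge> 2" "k n / 2 \<le> real (m n)" "0 < k n"
          using elim(1) by auto
        have l1: "1 \<le> l n" "1 \<le> sqrt (l n)" using elim(2) by auto
        note sprop = s_index_props[OF range mn(4), folded s_def, folded \<theta>_def, folded c_def]
        define r where "r = measure \<mu> {s n<..<1}"
        \<comment> \<open>The exponents of \<open>r_index\<close> belong to the index \<open>log \<theta> n\<close>, those of the mean to \<open>m n \<ge> (log \<theta> n) / 2\<close>; this costs the factor 1/2 in \<open>B\<close>.\<close>
        have kap: "\<kappa> n = c * (1 - s n) * k n"
          using c sprop(2) mn(4)
          by (simp add: \<kappa>_def r_index_def c_def \<theta>_def s_def abs_mult)
        have r: "r \<le> exp (- \<kappa> n / 2)"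
        proof -
          have "r \<le> exp (- \<kappa> n)" using sprop(3) by (simp add: r_def kap)
          also have "\<dots> \<le> exp (- \<kappa> n / 2)" using \<kappa>0[of n] by simp
          finally show ?thesis .
        qed
        have x: "exp (- c * (1 - s n) * real (m n)) \<le> exp (- \<kappa> n / 2)"
        proof -
          have "c * (1 - s n) * (k n / 2) \<le> c * (1 - s n) * real (m n)"
            using mn(3) c sprop(2) by (intro mult_left_mono) auto
          then show ?thesis by (simp add: kap)
        qed
        define \<delta> where "\<delta> = (1 / z) ^ m n * real n powr (3 / 4)"
        have \<delta>: "0 \<le> \<delta>" using z by (simp add: \<delta>_def)
        define e where "e = 4 * (E * (1 / z) ^ m n * real n powr (3 / 4))
          + real n * (1 / \<theta>) ^ m n * (r + exp (- c * (1 - s n) * real (m n)))"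
        have "X n \<omega> = real (card {j \<in> {1..n}. load {2..n} (parents n \<omega>) j = m n})" for \<omega>
          unfolding X_def degree_count_eq \<theta>_def[symmetric] k_def[symmetric] mn(1) by simp
        then have ann: "norm (\<phi> n - \<psi> n) \<le> \<bar>t / sqrt (l n)\<bar> * exp (l n * (t / sqrt (l n))\<^sup>2 / 2) * ((l n + e)
            * ((4 * real (m n) + 2) * (E * (1 / z) ^ (m n - 1) * real n powr (3 / 4))) + e)
            + 2 * deviation_tail K"
          using annealed_char[OF range R[unfolded \<theta>_def] sprop(1,2) elim(3) mn(2), of "t / sqrt (l n)"]
          unfolding \<phi>_def \<psi>_def e_def r_def E_def c_def l_def[of n] \<theta>_def atom(2) by simp
        have A_ge: "\<delta> \<le> A n" "(4 * real (m n) + 2) * \<delta> \<le> A n"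
        proof -
          have "1 * ((4 * real (m n) + 2) * \<delta>) \<le> sqrt (l n) * ((4 * real (m n) + 2) * \<delta>)"
            using l1 \<delta> by (intro mult_right_mono) auto
          then show 1: "(4 * real (m n) + 2) * \<delta> \<le> A n" by (simp add: A_def \<delta>_def mult.assoc)
          have "1 * \<delta> \<le> (4 * real (m n) + 2) * \<delta>" using \<delta> by (intro mult_right_mono) auto
          then show "\<delta> \<le> A n" using 1 by simp
        qed
        have A0: "0 \<le> A n" using \<delta> A_ge by linarith
        have e0: "0 \<le> e" using E z \<theta> by (simp add: e_def r_def)
        have eZ: "e / sqrt (l n) \<le> Z n"
        proof -
          have sq: "l n / sqrt (l n) = sqrt (l n)" using l1 by (simp add: real_div_sqrt)
          have "l n = (q\<^sub>0 * c) * (real n * (1 / \<theta>) ^ m n)"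
            unfolding l_def c_def by (simp only: mult.assoc)
          then have "real n * (1 / \<theta>) ^ m n = l n / (q\<^sub>0 * c)"
            using q0 c by simp
          then have "e = 4 * E * \<delta> + l n / (q\<^sub>0 * c) * (r + exp (- c * (1 - s n) * real (m n)))"
            by (simp add: e_def \<delta>_def)
          also have "\<dots> \<le> 4 * E * A n * sqrt (l n) + l n / (q\<^sub>0 * c) * (2 * exp (- \<kappa> n / 2))"
          proof (intro add_mono mult_left_mono)
            have "4 * E * \<delta> * 1 \<le> 4 * E * A n * sqrt (l n)"
              using A_ge(1) l1 E \<delta> A0 by (intro mult_mono) auto
            then show "4 * E * \<delta> \<le> 4 * E * A n * sqrt (l n)" by simp
            show "r + exp (- c * (1 - s n) * real (m n)) \<le> 2 * exp (- \<kappa> n / 2)"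
              using r x by linarith
            show "0 \<le> l n / (q\<^sub>0 * c)" using l1 q0 c by simp
          qed
          finally have "e / sqrt (l n) \<le>
              (4 * E * A n * sqrt (l n) + l n / (q\<^sub>0 * c) * (2 * exp (- \<kappa> n / 2))) / sqrt (l n)"
            using l1 by (intro divide_right_mono) auto
          also have "\<dots> = 4 * E * A n + (l n / sqrt (l n)) / (q\<^sub>0 * c) * (2 * exp (- \<kappa> n / 2))"
            using l1 by (simp add: add_divide_distrib)
          also have "\<dots> = Z n" unfolding sq Z_def B_def by simp
          finally show ?thesis .
        qed
        have lu: "l n * (t / sqrt (l n))\<^sup>2 = t\<^sup>2" using l1 by (simp add: power_divide)
        have zp: "(1 / z) ^ (m n - 1) = z * (1 / z) ^ m n"
          using mn(2) z by (cases "m n") auto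
        define q where "q = (4 * real (m n) + 2) * (E * (1 / z) ^ (m n - 1) * real n powr (3 / 4))"
        have q_eq: "q = E * z * ((4 * real (m n) + 2) * \<delta>)" unfolding q_def zp \<delta>_def by simp
        have q0': "0 \<le> q" using E z \<delta> by (simp add: q_eq)
        have qA: "q \<le> E * z * A n" unfolding q_eq using A_ge(2) E z by (intro mult_left_mono) auto
        have sqA: "sqrt (l n) * q = E * z * A n" by (simp add: q_eq A_def \<delta>_def)
        have "((l n + e) * q + e) / sqrt (l n) = (l n / sqrt (l n)) * q + (e / sqrt (l n)) * q + e / sqrt (l n)"
          by (simp add: add_divide_distrib distrib_right)
        also have "l n / sqrt (l n) = sqrt (l n)" using l1 by (simp add: real_div_sqrt)
        also have "sqrt (l n) * q + (e / sqrt (l n)) * q + e / sqrt (l n)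
            \<le> E * z * A n + Z n * (E * z * A n) + Z n"
          unfolding sqA using eZ qA q0' e0 l1
          by (intro add_mono mult_mono order_refl) (auto intro: order_trans[OF _ eZ])
        finally have main: "((l n + e) * q + e) / sqrt (l n) \<le> E * z * A n + Z n * (E * z * A n) + Z n" .
        have abs_t: "\<bar>t / sqrt (l n)\<bar> = \<bar>t\<bar> / sqrt (l n)"
          using l1(1) by (simp add: abs_divide)
        have "\<bar>t / sqrt (l n)\<bar> * exp (t\<^sup>2 / 2) * ((l n + e) * q + e) =
            \<bar>t\<bar> * exp (t\<^sup>2 / 2) * (((l n + e) * q + e) / sqrt (l n))"
          unfolding abs_t by (simp only: times_divide_eq_left times_divide_eq_right)
        also have "\<dots> \<le> bd n" unfolding bd_def using main by (intro mult_left_mono) auto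
        finally show ?case using ann unfolding lu q_def[symmetric] by linarith
      qed
      ultimately have "eventually (\<lambda>n. norm (norm (\<phi> n - \<psi> n) - 0) < \<epsilon>) sequentially"
        by eventually_elim (use K(1) in simp)
      then show "\<exists>no. \<forall>n\<ge>no. norm (norm (\<phi> n - \<psi> n) - 0) < \<epsilon>"
        by (simp add: eventually_sequentially)
    qed
    have "(\<lambda>n. iexp (- (t * sqrt (l n))) * (\<phi> n - \<psi> n)) \<longlonglongrightarrow> 0"
      by (rule Lim_null_comparison[OF _ dist]) (simp add: norm_mult)
    moreover have "(\<lambda>n. iexp (- (t * sqrt (l n))) * \<psi> n) \<longlonglongrightarrow> of_real (exp (- t\<^sup>2 / 2))"
      unfolding \<psi>_def by (rule poisson_char_clt[OF asym(3)])
    ultimately have "(\<lambda>n. iexp (- (t * sqrt (l n))) * (\<phi> n - \<psi> n) + iexp (- (t * sqrt (l n))) * \<psi> n)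
        \<longlonglongrightarrow> 0 + of_real (exp (- t\<^sup>2 / 2))"
      by (rule tendsto_add)
    then have "(\<lambda>n. iexp (- (t * sqrt (l n))) * \<phi> n) \<longlonglongrightarrow> of_real (exp (- t\<^sup>2 / 2))"
      by (simp add: right_diff_distrib)
    then show "(\<lambda>n. char (distr M borel (\<lambda>\<omega>. (X n \<omega> - \<Lambda> n) / sqrt (\<Lambda> n))) t)
        \<longlonglongrightarrow> char std_normal_distribution t"
      unfolding char_std_normal_distribution by (subst tendsto_cong[OF char_eq]) 
  qed
qed

end
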